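(* For every PL sphere $\Delta$ there exists an integer $k\ge 0$ such that the $k$-fold iterated derived subdivision $\mathrm{sd}^k \Delta$ is polytopal, i.e., it is combinatorially equivalent to the boundary complex of some convex polytope.
   Context: Simplicial complexes are finite. A PL $d$-sphere is a simplicial complex that is PL homeomorphic to the boundary $\partial\sigma^{d+1}$ of the $(d+1)$-simplex, i.e. it and $\partial\sigma^{d+1}$ have combinatorially equivalent (isomorphic) simplicial subdivisions. A PL sphere is a PL $d$-sphere for some $d$. For a simplicial complex $\Delta$ and a face $\tau$ of $\Delta$, let $\Delta-\tau$ denote the deletion of $\tau$ (the maximal subcomplex of $\Delta$ not containing $\tau$) and let $\mathrm{St}(\tau,\Delta)$ denote the star of $\tau$ (the minimal subcomplex of $\Delta$ containing all faces of $\Delta$ that contain $\tau$). The stellar subdivision of $\Delta$ at $\tau$ is $$\mathrm{st}(\tau,\Delta):=(\Delta-\tau)\cup\{\mathrm{conv}\{v_\tau\cup\sigma\}:\sigma\in \mathrm{St}(\tau,\Delta)-\tau\},$$ where $v_\tau$ is any point in the relative interior of $\tau$; its combinatorial type does not depend on the choice of $v_\tau$. A derived subdivision $\mathrm{sd}\,\Delta$ is obtained by stellarly subdividing $\Delta$ at all its faces in order of decreasing dimension (the barycentric subdivision is the special case where each $v_\tau$ is the barycenter of $\tau$). Set $\mathrm{sd}^0\Delta:=\Delta$ and $\mathrm{sd}^m\Delta:=\mathrm{sd}(\mathrm{sd}^{m-1}\Delta)$. *)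

theory Defs
  imports "HOL-Analysis.Analysis"
begin

text \<open>
  Complexes are geometric: sets of polytopes in a Euclidean space that contain the empty face.
  Simplicial complexes are those of the library (\<^const>\<open>simplicial_complex\<close>), hence finite.
  All face posets below include the empty face.
\<close>

definition boundary_complex :: "'a::euclidean_space set \<Rightarrow> 'a set set" where
  "boundary_complex P = {F. F face_of P \<and> F \<noteq> P}"

definition comb_equivalent :: "'a::euclidean_space set set \<Rightarrow> 'b::euclidean_space set set \<Rightarrow> bool"
  where "comb_equivalent K L \<longleftrightarrow>
    (\<exists>f. bij_betw f K L \<and> (\<forall>\<sigma>\<in>K. \<forall>\<tau>\<in>K. \<sigma> face_of \<tau> \<longleftrightarrow> f \<sigma> face_of f \<tau>))"

definition simplicial_subdivision :: "'a::euclidean_space set set \<Rightarrow> 'a set set \<Rightarrow> bool" where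
  "simplicial_subdivision K' K \<longleftrightarrow>
     simplicial_complex K' \<and> \<Union>K' = \<Union>K \<and> (\<forall>\<sigma>\<in>K'. \<exists>\<tau>\<in>K. \<sigma> \<subseteq> \<tau>)"

definition PL_homeomorphic :: "'a::euclidean_space set set \<Rightarrow> 'b::euclidean_space set set \<Rightarrow> bool"
  where "PL_homeomorphic K L \<longleftrightarrow>
    (\<exists>K' L'. simplicial_subdivision K' K \<and> simplicial_subdivision L' L \<and> comb_equivalent K' L')"

text \<open>
  The model simplex need not live in the same space as the complex. The type argument
  names the space in which it is taken; this space is arbitrary, and for a \<open>d\<close>-sphere
  every Euclidean space of dimension at least \<open>d + 1\<close> can be used.
\<close>

definition PL_d_sphere :: "'b::euclidean_space itself \<Rightarrow> nat \<Rightarrow> 'a::euclidean_space set set \<Rightarrow> bool"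
  where "PL_d_sphere _ d \<Delta> \<longleftrightarrow>
    simplicial_complex \<Delta> \<and>
    (\<exists>S :: 'b set. (int d + 1) simplex S \<and> PL_homeomorphic \<Delta> (boundary_complex S))"

definition PL_sphere :: "'b::euclidean_space itself \<Rightarrow> 'a::euclidean_space set set \<Rightarrow> bool" where
  "PL_sphere T \<Delta> \<longleftrightarrow> (\<exists>d. PL_d_sphere T d \<Delta>)"

definition polytopal :: "'b::euclidean_space itself \<Rightarrow> 'a::euclidean_space set set \<Rightarrow> bool" where
  "polytopal _ \<Delta> \<longleftrightarrow> (\<exists>P :: 'b set. polytope P \<and> comb_equivalent \<Delta> (boundary_complex P))"

definition subcomplex :: "'a::euclidean_space set set \<Rightarrow> 'a set set \<Rightarrow> bool" where
  "subcomplex K \<Delta> \<longleftrightarrow> simplicial_complex K \<and> K \<subseteq> \<Delta>"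

definition deletion :: "'a::euclidean_space set \<Rightarrow> 'a set set \<Rightarrow> 'a set set" where
  "deletion \<tau> \<Delta> = \<Union>{K. subcomplex K \<Delta> \<and> \<tau> \<notin> K}"

definition star :: "'a::euclidean_space set \<Rightarrow> 'a set set \<Rightarrow> 'a set set" where
  "star \<tau> \<Delta> = \<Delta> \<inter> \<Inter>{K. subcomplex K \<Delta> \<and> {\<rho>\<in>\<Delta>. \<tau> face_of \<rho>} \<subseteq> K}"

definition stellar_subdivision ::
    "'a::euclidean_space set \<Rightarrow> 'a \<Rightarrow> 'a set set \<Rightarrow> 'a set set" where
  "stellar_subdivision \<tau> v \<Delta> =
     deletion \<tau> \<Delta> \<union> {convex hull ({v} \<union> \<sigma>) |\<sigma>. \<sigma> \<in> deletion \<tau> (star \<tau> \<Delta>)}"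

text \<open>
  A derived subdivision depends on the choice of the points \<open>v \<tau>\<close> (and formally on the order in
  which faces of equal dimension are treated), so it is a relation. Only nonempty faces are
  subdivided, the empty face having no relative interior point.
\<close>

definition derived_subdivision :: "'a::euclidean_space set set \<Rightarrow> 'a set set \<Rightarrow> bool" where
  "derived_subdivision \<Delta> \<Delta>' \<longleftrightarrow>
     (\<exists>\<tau>s v. distinct \<tau>s \<and> set \<tau>s = \<Delta> - {{}} \<and>
        sorted_wrt (\<lambda>\<sigma> \<tau>. aff_dim \<sigma> \<ge> aff_dim \<tau>) \<tau>s \<and>
        (\<forall>\<tau>\<in>set \<tau>s. v \<tau> \<in> rel_interior \<tau>) \<and>
        \<Delta>' = fold (\<lambda>\<tau>. stellar_subdivision \<tau> (v \<tau>)) \<tau>s \<Delta>)"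


text \<open>Explicit descriptions of deletion and star.\<close>

lemma subcomplex_if:
  assumes "simplicial_complex \<Delta>" "K \<subseteq> \<Delta>" "\<And>F S. S \<in> K \<Longrightarrow> F face_of S \<Longrightarrow> F \<in> K"
  shows "subcomplex K \<Delta>"
proof -
  have fin: "finite \<Delta>" and simp: "\<And>S. S \<in> \<Delta> \<Longrightarrow> \<exists>n. n simplex S"
    and int: "\<And>S S'. S \<in> \<Delta> \<Longrightarrow> S' \<in> \<Delta> \<Longrightarrow> S \<inter> S' face_of S"
    using assms(1) unfolding simplicial_complex_def by blast+
  have "finite K" using fin assms(2) finite_subset by blast
  then show ?thesis
    unfolding subcomplex_def simplicial_complex_def
    using assms(2,3) simp int by (meson subsetD)
qed

lemma deletion_eq:
  assumes "simplicial_complex \<Delta>"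
  shows "deletion \<tau> \<Delta> = {\<sigma>\<in>\<Delta>. \<not> \<tau> face_of \<sigma>}"
proof
  show "deletion \<tau> \<Delta> \<subseteq> {\<sigma>\<in>\<Delta>. \<not> \<tau> face_of \<sigma>}"
    unfolding deletion_def subcomplex_def simplicial_complex_def by blast
  have "subcomplex {\<sigma>\<in>\<Delta>. \<not> \<tau> face_of \<sigma>} \<Delta>"
  proof (rule subcomplex_if[OF assms])
    fix F S assume "S \<in> {\<sigma>\<in>\<Delta>. \<not> \<tau> face_of \<sigma>}" "F face_of S"
    then show "F \<in> {\<sigma>\<in>\<Delta>. \<not> \<tau> face_of \<sigma>}"
      using assms face_of_trans unfolding simplicial_complex_def by blast
  qed auto
  moreover have "\<tau> \<notin> {\<sigma>\<in>\<Delta>. \<not> \<tau> face_of \<sigma>}"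
    using assms by (auto simp: simplicial_complex_def intro!: face_of_refl)
      (metis convex_simplex)
  ultimately show "{\<sigma>\<in>\<Delta>. \<not> \<tau> face_of \<sigma>} \<subseteq> deletion \<tau> \<Delta>"
    unfolding deletion_def by blast
qed

lemma star_eq:
  assumes "simplicial_complex \<Delta>"
  shows "star \<tau> \<Delta> = {\<sigma>. \<exists>\<rho>\<in>\<Delta>. \<sigma> face_of \<rho> \<and> \<tau> face_of \<rho>}" (is "_ = ?S")
proof
  have "subcomplex ?S \<Delta>"
  proof (rule subcomplex_if[OF assms])
    show "?S \<subseteq> \<Delta>" using assms unfolding simplicial_complex_def by blast
    show "F \<in> ?S" if "S \<in> ?S" "F face_of S" for F S
      using that face_of_trans by blast
  qed
  moreover have "{\<rho>\<in>\<Delta>. \<tau> face_of \<rho>} \<subseteq> ?S"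
    using assms by (auto simp: simplicial_complex_def intro!: bexI face_of_refl)
      (metis convex_simplex)
  ultimately show "star \<tau> \<Delta> \<subseteq> ?S" unfolding star_def by blast
  show "?S \<subseteq> star \<tau> \<Delta>"
    using assms unfolding star_def subcomplex_def simplicial_complex_def by blast
qed


text \<open>Iterated derived subdivisions always exist, so quantifying over all of them is not vacuous.\<close>

lemma derived_subdivision_exists_aux:
  assumes "finite \<Delta>" "\<forall>\<sigma>\<in>\<Delta>. convex \<sigma>"
  shows "\<exists>\<Delta>'. derived_subdivision \<Delta> \<Delta>' \<and> finite \<Delta>' \<and> (\<forall>\<sigma>\<in>\<Delta>'. convex \<sigma>)"
proof -
  obtain xs where xs: "distinct xs" "set xs = \<Delta> - {{}}"
    using finite_distinct_list assms(1) by (metis finite_Diff)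
  define \<tau>s where "\<tau>s = sort_key (\<lambda>\<sigma>. - aff_dim \<sigma>) xs"
  have "sorted (map (\<lambda>\<sigma>. - aff_dim \<sigma>) \<tau>s)" by (simp add: \<tau>s_def)
  then have sorted: "sorted_wrt (\<lambda>\<sigma> \<tau>. aff_dim \<sigma> \<ge> aff_dim \<tau>) \<tau>s"
    by (simp add: sorted_wrt_map)
  define v where "v \<tau> = (SOME x. x \<in> rel_interior \<tau>)" for \<tau> :: "'a set"
  have v: "v \<tau> \<in> rel_interior \<tau>" if "\<tau> \<in> set \<tau>s" for \<tau>
  proof -
    have "convex \<tau>" "\<tau> \<noteq> {}" using that xs assms by (auto simp: \<tau>s_def)
    then show ?thesis
      by (metis v_def rel_interior_eq_empty some_in_eq)
  qed
  have step: "finite (stellar_subdivision \<tau> x K) \<and> (\<forall>\<sigma>\<in>stellar_subdivision \<tau> x K. convex \<sigma>)"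
    if K: "finite K" "\<forall>\<sigma>\<in>K. convex \<sigma>" for \<tau> x and K :: "'a set set"
  proof -
    have sub: "deletion \<tau> L \<subseteq> L" "star \<tau> K \<subseteq> K" for L
      by (auto simp: deletion_def star_def subcomplex_def)
    have "finite (deletion \<tau> K)" "finite (deletion \<tau> (star \<tau> K))"
      using K(1) sub finite_subset by metis+
    then show ?thesis
      unfolding stellar_subdivision_def using sub K(2) by (auto simp: convex_convex_hull)
  qed
  have "finite (fold (\<lambda>\<tau>. stellar_subdivision \<tau> (v \<tau>)) ts K) \<and>
        (\<forall>\<sigma>\<in>fold (\<lambda>\<tau>. stellar_subdivision \<tau> (v \<tau>)) ts K. convex \<sigma>)"
    if "finite K" "\<forall>\<sigma>\<in>K. convex \<sigma>" for ts K
    using that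
  proof (induction ts arbitrary: K)
    case (Cons t ts)
    have "finite (stellar_subdivision t (v t) K)" "\<forall>\<sigma>\<in>stellar_subdivision t (v t) K. convex \<sigma>"
      using step[OF Cons.prems] by auto
    from Cons.IH[OF this] show ?case unfolding fold_simps by blast
  qed auto
  from this[OF assms, of \<tau>s] show ?thesis
    unfolding derived_subdivision_def using xs sorted v
    by (intro exI[of _ "fold (\<lambda>\<tau>. stellar_subdivision \<tau> (v \<tau>)) \<tau>s \<Delta>"] conjI
        exI[of _ \<tau>s] exI[of _ v]) (auto simp: \<tau>s_def)
qed

lemma iterated_derived_subdivision_exists:
  assumes "simplicial_complex \<Delta>"
  shows "\<exists>\<Delta>'. (derived_subdivision ^^ k) \<Delta> \<Delta>'"
proof -
  have "\<exists>\<Delta>'. (derived_subdivision ^^ k) \<Delta> \<Delta>' \<and> finite \<Delta>' \<and> (\<forall>\<sigma>\<in>\<Delta>'. convex \<sigma>)"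
  proof (induction k)
    case 0
    then show ?case
      using assms unfolding simplicial_complex_def by (auto intro: convex_simplex)
  next
    case (Suc k)
    then obtain \<Delta>' where D: "(derived_subdivision ^^ k) \<Delta> \<Delta>'" "finite \<Delta>'" "\<forall>\<sigma>\<in>\<Delta>'. convex \<sigma>"
      by blast
    from derived_subdivision_exists_aux[OF D(2,3)] D(1) show ?case
      by (auto simp: relcompp_apply)
  qed
  then show ?thesis by blast
qed

end

theory Submission
  imports Defs
begin

text \<open>
  The combinatorial type of an iterated derived subdivision depends only on the face poset, so the
  subdividing points may be chosen freely. If they are placed on a hyperplane whenever the face
  crosses it, then no simplex of the derived subdivision crosses it any more. Treating all
  hyperplanes needed to cut out a given subdivision of \<open>\<Delta>\<close> one after the other, some \<open>sd\<^sup>k \<Delta>\<close> refines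
  this subdivision and, by transport, is isomorphic to a subdivision \<open>M\<close> of the boundary of a
  simplex \<open>S\<close> around the origin.

  In the same way some \<open>sd\<^sup>m M\<close> refines the arrangement of the linear hyperplanes which cut out the
  cones over the simplices of \<open>M\<close>. The sum \<open>f\<close> of the absolute values of the corresponding
  functionals is convex, linear on the cones over the simplices of \<open>sd\<^sup>m M\<close>, and bends between
  different cones over simplices of \<open>M\<close>. Stellar subdivisions are regular, so there is a function
  \<open>g\<close>, linear on the simplices of \<open>sd\<^sup>m M\<close>, that is strictly convex inside each simplex of \<open>M\<close>.
  Adding the gauge of \<open>S\<close> (which is 1 on the boundary of \<open>S\<close>), \<open>h = 1 + f + t g\<close> is strictly convex
  for small \<open>t\<close>, and the points \<open>u / h u\<close> span a polytope with boundary complex \<open>sd\<^sup>m M\<close>.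
\<close>

subsection \<open>Vertex complexes\<close>

text \<open>The result has to hold for every run of derived subdivisions with one common
  \<open>k\<close>, while the argument needs points in special position. So only one good run per
  stage is constructed, and the arbitrary run is compared with it by isomorphism. A stage on the
  side of \<open>\<Delta>\<close> is unavoidable because the homeomorphism is linear only on the
  simplices of the given subdivision, which need not arise from stellar subdivisions; only after
  refining it do the simplices of the iterated derived subdivision have simplices as images. A
  further stage is needed because \<open>M\<close> is an arbitrary triangulation of the boundary of
  \<open>S\<close> and need not come from a convex height function. The remedy splits the task:
  \<open>f\<close> separates different simplices of \<open>M\<close>, and \<open>g\<close> only has
  to be convex inside each simplex of \<open>M\<close>. This local condition holds for
  \<open>M\<close> itself with height 0 and survives every stellar step. Since there are finitely
  many vertices, a small \<open>t\<close> keeps the strict inequalities that come from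
  \<open>f\<close> and the gauge, however \<open>g\<close> behaves across simplices. The gauge is
  what distinguishes a simplex of \<open>M\<close> from the cone over it.\<close>

definition weights :: "'a set \<Rightarrow> ('a \<Rightarrow> real) set" where
  "weights A = {l. (\<forall>x. 0 \<le> l x) \<and> (\<forall>x. x \<notin> A \<longrightarrow> l x = 0) \<and> sum l A = 1}"

text \<open>Weights are total functions that vanish off their vertex set, and the sum runs over
  their support. So the coordinates of a point do not mention the simplex in which they are taken,
  and uniqueness of coordinates across all simplices is plain injectivity of
  \<open>bary\<close>.\<close>

definition bary :: "('a::real_vector \<Rightarrow> real) \<Rightarrow> 'a" where
  "bary l = (\<Sum>x | l x \<noteq> 0. l x *\<^sub>R x)"

text \<open>
  A geometric simplicial complex is encoded by the vertex sets of its faces: a finite abstract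
  simplicial complex on points such that barycentric coordinates are unique throughout.
\<close>

definition geometric :: "'a::real_vector set set \<Rightarrow> bool" where
  "geometric V \<longleftrightarrow> finite V \<and> (\<forall>A\<in>V. finite A) \<and> (\<forall>A\<in>V. \<forall>B. B \<subseteq> A \<longrightarrow> B \<in> V) \<and>
     inj_on bary (\<Union>A\<in>V. weights A)"

definition hulls :: "'a::real_vector set set \<Rightarrow> 'a set set" where
  "hulls V = (hull) convex ` V"

definition body :: "'a::real_vector set set \<Rightarrow> 'a set" where
  "body V = \<Union>(hulls V)"

lemma body_eq: "body V = (\<Union>A\<in>V. convex hull A)"
  by (simp add: body_def hulls_def)

lemma Union_subset_body: "\<Union>V \<subseteq> body V"
proof
  fix u assume "u \<in> \<Union>V"
  then obtain A where "A \<in> V" "u \<in> A" by blast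
  then show "u \<in> body V" unfolding body_eq using hull_inc[of u A convex] by blast
qed

lemma bary_eq:
  assumes "finite A" "\<And>x. x \<notin> A \<Longrightarrow> l x = 0"
  shows "bary l = (\<Sum>x\<in>A. l x *\<^sub>R x)"
  unfolding bary_def using assms by (intro sum.mono_neutral_left) auto

lemma bary_weights: "finite A \<Longrightarrow> l \<in> weights A \<Longrightarrow> bary l = (\<Sum>x\<in>A. l x *\<^sub>R x)"
  by (rule bary_eq) (auto simp: weights_def)



lemma weights_shrink:
  assumes "finite B" "l \<in> weights B" "\<And>x. x \<in> B - A \<Longrightarrow> l x = 0" "A \<subseteq> B"
  shows "l \<in> weights A"
proof -
  have "sum l A = sum l B"
    using assms by (intro sum.mono_neutral_left) auto
  with assms show ?thesis by (auto simp: weights_def)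
qed

lemma convex_hull_weights:
  assumes "finite A"
  shows "convex hull A = bary ` weights A"
proof
  show "convex hull A \<subseteq> bary ` weights A"
  proof
    fix y assume "y \<in> convex hull A"
    then obtain u where u: "\<forall>x\<in>A. 0 \<le> u x" "sum u A = 1" "(\<Sum>x\<in>A. u x *\<^sub>R x) = y"
      using convex_hull_finite[OF assms] by auto
    define l where "l x = (if x \<in> A then u x else 0)" for x
    have l: "l \<in> weights A" using u by (auto simp: weights_def l_def)
    have "bary l = y" using u bary_weights[OF assms l] by (simp add: l_def)
    with l show "y \<in> bary ` weights A" by blast
  qed
  show "bary ` weights A \<subseteq> convex hull A"
    using bary_weights[OF assms] by (auto simp: convex_hull_finite[OF assms] weights_def)
qed

lemma weights_single: "l \<in> weights {x} \<longleftrightarrow> l = (\<lambda>y. if y = x then 1 else 0)"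
proof
  assume l: "l \<in> weights {x}"
  then have "l x = 1" "\<And>y. y \<noteq> x \<Longrightarrow> l y = 0" by (auto simp: weights_def)
  then show "l = (\<lambda>y. if y = x then 1 else 0)" by (simp add: fun_eq_iff)
qed (simp add: weights_def)

lemma geometric_finite: "geometric V \<Longrightarrow> A \<in> V \<Longrightarrow> finite A"
  and geometric_down: "geometric V \<Longrightarrow> A \<in> V \<Longrightarrow> B \<subseteq> A \<Longrightarrow> B \<in> V"
  by (auto simp: geometric_def)

lemma geometric_inj:
  assumes "geometric V" "A \<in> V" "B \<in> V" "l \<in> weights A" "m \<in> weights B" "bary l = bary m"
  shows "l = m"
  using assms unfolding geometric_def inj_on_def by blast

lemma geometric_subset:
  assumes "geometric V" "W \<subseteq> V" "\<And>A B. A \<in> W \<Longrightarrow> B \<subseteq> A \<Longrightarrow> B \<in> W"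
  shows "geometric W"
  using assms unfolding geometric_def
  by (meson UN_mono finite_subset inj_on_subset order_refl subsetD)

text \<open>An affine dependence splits into its positive and negative parts. Both have the same
  total weight \<open>s\<close>, and after division by \<open>s\<close> they are two different
  weight functions with the same barycentre.\<close>

lemma geometric_affine_independent:
  assumes V: "geometric V" "A \<in> V"
  shows "\<not> affine_dependent A"
proof
  assume dep: "affine_dependent A"
  have fin: "finite A" using V geometric_finite by blast
  obtain U where U: "sum U A = 0" "\<exists>v\<in>A. U v \<noteq> 0" "(\<Sum>v\<in>A. U v *\<^sub>R v) = 0"
    using dep affine_dependent_explicit_finite[OF fin] by auto
  define p where "p x = (if x \<in> A then max (U x) 0 else 0)" for x
  define q where "q x = (if x \<in> A then max (- U x) 0 else 0)" for x
  have pq: "p x - q x = U x" if "x \<in> A" for x using that by (auto simp: p_def q_def)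
  define s where "s = sum p A"
  have "sum p A - sum q A = 0"
    using pq U(1) by (simp flip: sum_subtractf)
  then have s: "sum q A = s" by (simp add: s_def)
  have "s > 0"
  proof (rule ccontr)
    assume "\<not> s > 0"
    moreover have "s \<ge> 0" unfolding s_def by (intro sum_nonneg) (auto simp: p_def)
    ultimately have "sum p A = 0" "sum q A = 0" using s s_def by auto
    moreover have "\<forall>x\<in>A. p x \<ge> 0" "\<forall>x\<in>A. q x \<ge> 0" by (auto simp: p_def q_def)
    ultimately have "\<forall>x\<in>A. p x = 0" "\<forall>x\<in>A. q x = 0"
      using fin by (simp_all add: sum_nonneg_eq_0_iff)
    then show False using pq U(2) by force
  qed
  have 1: "(\<lambda>x. p x / s) \<in> weights A" "(\<lambda>x. q x / s) \<in> weights A"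
    using \<open>s > 0\<close> s s_def by (auto simp: weights_def p_def q_def simp flip: sum_divide_distrib)
  have eq0: "bary (\<lambda>x. p x / s) - bary (\<lambda>x. q x / s) = (\<Sum>x\<in>A. (U x / s) *\<^sub>R x)"
    unfolding bary_weights[OF fin 1(1)] bary_weights[OF fin 1(2)]
    using pq by (simp flip: sum_subtractf scaleR_diff_left diff_divide_distrib)
  also have "\<dots> = (1/s) *\<^sub>R (\<Sum>x\<in>A. U x *\<^sub>R x)" by (simp add: scaleR_right.sum)
  finally have "bary (\<lambda>x. p x / s) = bary (\<lambda>x. q x / s)" using U by simp
  then have "(\<lambda>x. p x / s) = (\<lambda>x. q x / s)" by (rule geometric_inj[OF V(1) V(2) V(2) 1])
  then have "p x / s = q x / s" for x by meson
  then have "p x = q x" for x using \<open>s > 0\<close> by (metis divide_cancel_right less_irrefl)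
  then show False using pq U(2) by force
qed

text \<open>A common point has a single weight function, which vanishes off \<open>A\<close> and off
  \<open>B\<close>.\<close>

lemma geometric_hull_Int:
  assumes V: "geometric V" "A \<in> V" "B \<in> V"
  shows "convex hull A \<inter> convex hull B = convex hull (A \<inter> B)"
proof
  show "convex hull (A \<inter> B) \<subseteq> convex hull A \<inter> convex hull B"
    by (simp add: hull_mono)
  have fin: "finite A" "finite B" using V geometric_finite by auto
  show "convex hull A \<inter> convex hull B \<subseteq> convex hull (A \<inter> B)"
  proof
    fix x assume x: "x \<in> convex hull A \<inter> convex hull B"
    then obtain l m where lm: "l \<in> weights A" "m \<in> weights B" "x = bary l" "x = bary m"
      unfolding convex_hull_weights[OF fin(1)] convex_hull_weights[OF fin(2)] by blast
    then have "l = m" using geometric_inj V by metis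
    then have "\<And>x. x \<notin> B \<Longrightarrow> l x = 0" using lm(2) by (simp add: weights_def)
    then have "l \<in> weights (A \<inter> B)" by (intro weights_shrink[OF fin(1) lm(1)]) auto
    then show "x \<in> convex hull (A \<inter> B)"
      using convex_hull_weights[of "A \<inter> B"] fin lm by auto
  qed
qed



text \<open>Affinely independent points are the extreme points of their hull, and extreme points of
  a face are extreme in the whole set.\<close>

lemma hull_face_iff:
  fixes A B :: "'a::euclidean_space set"
  assumes "\<not> affine_dependent A" "\<not> affine_dependent B"
  shows "convex hull A face_of convex hull B \<longleftrightarrow> A \<subseteq> B"
proof
  assume L: "convex hull A face_of convex hull B"
  show "A \<subseteq> B"
  proof
    fix x assume "x \<in> A"
    then have "x extreme_point_of convex hull A"
      using assms by (simp add: extreme_point_of_convex_hull_affine_independent)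
    then have "x extreme_point_of convex hull B" using extreme_point_of_face[OF L] by blast
    then show "x \<in> B" by (rule extreme_point_of_convex_hull)
  qed
qed (use assms face_of_convex_hull_affine_independent in blast)

lemma hull_inj_aff_independent:
  fixes A B :: "'a::euclidean_space set"
  assumes "\<not> affine_dependent A" "\<not> affine_dependent B" "convex hull A = convex hull B"
  shows "A = B"
  using hull_face_iff[of A B] hull_face_iff[of B A] assms
  by (metis convex_convex_hull face_of_refl subset_antisym)

lemma geometric_face_iff:
  fixes V :: "'a::euclidean_space set set"
  shows "geometric V \<Longrightarrow> A \<in> V \<Longrightarrow> B \<in> V \<Longrightarrow> convex hull A face_of convex hull B \<longleftrightarrow> A \<subseteq> B"
  by (metis hull_face_iff geometric_affine_independent)

lemma geometric_hull_inj:
  fixes V :: "'a::euclidean_space set set"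
  shows "geometric V \<Longrightarrow> inj_on ((hull) convex) V"
  by (metis inj_onI hull_inj_aff_independent geometric_affine_independent)

lemma geometric_face_imp:
  fixes V :: "'a::euclidean_space set set"
  assumes "geometric V" "B \<in> V" "F face_of convex hull B"
  obtains A where "A \<subseteq> B" "F = convex hull A" "A \<in> V"
proof -
  obtain A where "A \<subseteq> B" "F = convex hull A"
    using assms(3) face_of_convex_hull_affine_independent geometric_affine_independent[OF assms(1,2)]
    by blast
  then show ?thesis using that geometric_down[OF assms(1,2)] by blast
qed

lemma geometric_imp_simplicial_complex:
  fixes V :: "'a::euclidean_space set set"
  assumes V: "geometric V"
  shows "simplicial_complex (hulls V)"
  unfolding simplicial_complex_def
proof (intro conjI ballI allI impI)
  show "finite (hulls V)" using V by (simp add: geometric_def hulls_def)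
  show "\<exists>n. n simplex S" if S: "S \<in> hulls V" for S
  proof -
    obtain A where A: "A \<in> V" "S = convex hull A" using S unfolding hulls_def by blast
    then have "(int (card A) - 1) simplex S"
      unfolding simplex_def using geometric_affine_independent[OF V] by auto
    then show ?thesis by blast
  qed
  show "F \<in> hulls V" if F: "S \<in> hulls V \<and> F face_of S" for F S
  proof -
    obtain B where "B \<in> V" "F face_of convex hull B" using F unfolding hulls_def by blast
    then show ?thesis using geometric_face_imp[OF V] unfolding hulls_def by (metis image_eqI)
  qed
  show "S \<inter> S' face_of S" if S: "S \<in> hulls V \<and> S' \<in> hulls V" for S S'
  proof -
    obtain A B where A: "A \<in> V" "S = convex hull A" and B: "B \<in> V" "S' = convex hull B"
      using S by (auto simp: hulls_def)
    have "S \<inter> S' = convex hull (A \<inter> B)" using geometric_hull_Int[OF V] A B by auto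
    then show ?thesis
      using face_of_convex_hull_affine_independent[OF geometric_affine_independent[OF V A(1)]] A
      by auto
  qed
qed

text \<open>Weights are restricted to their support, so that the barycentre lies in the relative
  interior of the hull. If two simplices share such a point, their intersection is a face of each
  that meets the relative interior; hence they coincide, and affine independence makes the weights
  equal.\<close>

lemma simplicial_complex_obtain_geometric:
  fixes \<Delta> :: "'a::euclidean_space set set"
  assumes \<Delta>: "simplicial_complex \<Delta>"
  obtains V where "geometric V" "\<Delta> = hulls V"
proof
  define V where "V = {A. \<not> affine_dependent A \<and> convex hull A \<in> \<Delta>}"
  have fin\<Delta>: "finite \<Delta>" and simp: "\<And>S. S \<in> \<Delta> \<Longrightarrow> \<exists>n. n simplex S"
    and face: "\<And>S F. S \<in> \<Delta> \<Longrightarrow> F face_of S \<Longrightarrow> F \<in> \<Delta>"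
    and int: "\<And>S S'. S \<in> \<Delta> \<Longrightarrow> S' \<in> \<Delta> \<Longrightarrow> S \<inter> S' face_of S"
    using \<Delta> unfolding simplicial_complex_def by blast+
  have ind: "\<not> affine_dependent A" if "A \<in> V" for A using that by (simp add: V_def)
  show "\<Delta> = hulls V"
  proof
    show "\<Delta> \<subseteq> hulls V"
    proof
      fix S assume "S \<in> \<Delta>"
      then obtain A where "\<not> affine_dependent A" "S = convex hull A"
        using simp unfolding simplex_def by blast
      then show "S \<in> hulls V" using \<open>S \<in> \<Delta>\<close> by (auto simp: hulls_def V_def)
    qed
  qed (auto simp: V_def hulls_def)
  have down: "B \<in> V" if "A \<in> V" "B \<subseteq> A" for A B
  proof -
    have "convex hull B face_of convex hull A"
      using that ind face_of_convex_hull_affine_independent by blast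
    then show ?thesis using that ind face affine_dependent_subset unfolding V_def by blast
  qed
  show "geometric V" unfolding geometric_def
  proof (intro conjI ballI allI impI)
    have "inj_on ((hull) convex) V"
      by (rule inj_onI) (use hull_inj_aff_independent ind in blast)
    moreover have "(hull) convex ` V \<subseteq> \<Delta>" by (auto simp: V_def)
    ultimately show "finite V" using fin\<Delta> by (metis finite_imageD finite_subset)
    show "finite A" if "A \<in> V" for A using ind[OF that] aff_independent_finite by blast
    show "B \<in> V" if "A \<in> V" "B \<subseteq> A" for A B using down that .
    show "inj_on bary (\<Union>A\<in>V. weights A)"
    proof (rule inj_onI)
      have supp: "\<exists>A\<in>V. l \<in> weights A \<and> (\<forall>x\<in>A. 0 < l x)" if l: "l \<in> (\<Union>A\<in>V. weights A)" for l
      proof -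
        obtain A where A: "A \<in> V" "l \<in> weights A" using l by blast
        have "l \<in> weights {x\<in>A. l x \<noteq> 0}"
          by (rule weights_shrink[OF aff_independent_finite[OF ind[OF A(1)]] A(2)]) auto
        moreover have "{x\<in>A. l x \<noteq> 0} \<in> V" using down[OF A(1)] by simp
        moreover have "\<forall>x\<in>{x\<in>A. l x \<noteq> 0}. 0 < l x"
          using A(2) unfolding weights_def by (auto simp: less_le)
        ultimately show ?thesis by blast
      qed
      fix l m assume l: "l \<in> (\<Union>A\<in>V. weights A)" and m: "m \<in> (\<Union>A\<in>V. weights A)"
        and eq: "bary l = bary m"
      obtain A where A: "A \<in> V" "l \<in> weights A" "\<forall>x\<in>A. 0 < l x" using supp[OF l] by blast
      obtain B where B: "B \<in> V" "m \<in> weights B" "\<forall>x\<in>B. 0 < m x" using supp[OF m] by blast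
      have fin: "finite A" "finite B" using A B ind aff_independent_finite by auto
      have mem: "bary l' \<in> rel_interior (convex hull C)"
        if C: "C \<in> V" "l' \<in> weights C" "\<forall>x\<in>C. 0 < l' x" for C l'
      proof -
        have "sum l' C = 1" using C(2) by (simp add: weights_def)
        then show ?thesis
          unfolding rel_interior_convex_hull_explicit[OF ind[OF C(1)]]
            bary_weights[OF aff_independent_finite[OF ind[OF C(1)]] C(2)]
          using C(3) by blast
      qed
      have rl: "bary l \<in> rel_interior (convex hull A)" by (rule mem) (use A in blast)+
      have rm: "bary m \<in> rel_interior (convex hull B)" by (rule mem) (use B in blast)+
      have inter: "bary l \<in> convex hull A \<inter> convex hull B"
        using subsetD[OF rel_interior_subset rl] subsetD[OF rel_interior_subset rm] eq by simp
      have AB: "convex hull A \<in> \<Delta>" "convex hull B \<in> \<Delta>" using A B by (auto simp: V_def)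
      have "convex hull A \<subseteq> convex hull A \<inter> convex hull B"
        using int[OF AB] by (rule subset_of_face_of) (use inter rl in auto)
      moreover have "convex hull B \<subseteq> convex hull B \<inter> convex hull A"
        using int[OF AB(2,1)] by (rule subset_of_face_of) (use inter rm eq in auto)
      ultimately have "convex hull A = convex hull B" by blast
      then have AeqB: "A = B" using hull_inj_aff_independent ind A(1) B(1) by blast
      have "sum (\<lambda>x. l x - m x) A = 0" using A(2) B(2) AeqB by (simp add: weights_def sum_subtractf)
      moreover have "(\<Sum>x\<in>A. (l x - m x) *\<^sub>R x) = 0"
        using eq bary_weights[OF fin(1) A(2)] bary_weights[OF fin(2) B(2)] AeqB
        by (simp add: scaleR_diff_left sum_subtractf)
      ultimately have "\<forall>x\<in>A. l x - m x = 0"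
        using ind[OF A(1)] affine_dependent_explicit_finite[OF fin(1)] by blast
      then show "l = m" using A(2) B(2) AeqB unfolding weights_def fun_eq_iff by auto
    qed
  qed
qed

subsection \<open>Combinatorial equivalence\<close>

definition set_iso :: "'a set set \<Rightarrow> 'b set set \<Rightarrow> bool" where
  "set_iso V W \<longleftrightarrow> (\<exists>f. bij_betw f V W \<and> (\<forall>A\<in>V. \<forall>B\<in>V. A \<subseteq> B \<longleftrightarrow> f A \<subseteq> f B))"

lemma set_iso_refl: "set_iso V V"
  unfolding set_iso_def by (intro exI[of _ id]) auto

lemma set_iso_sym:
  assumes "set_iso V W"
  shows "set_iso W V"
proof -
  obtain f where f: "bij_betw f V W" "\<forall>A\<in>V. \<forall>B\<in>V. A \<subseteq> B \<longleftrightarrow> f A \<subseteq> f B"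
    using assms unfolding set_iso_def by blast
  have "bij_betw (the_inv_into V f) W V" using f(1) by (rule bij_betw_the_inv_into)
  moreover have "the_inv_into V f A \<in> V \<and> f (the_inv_into V f A) = A" if "A \<in> W" for A
    using f(1) that by (metis bij_betw_def f_the_inv_into_f the_inv_into_into order_refl)
  ultimately show ?thesis unfolding set_iso_def using f(2) by metis
qed

lemma set_iso_trans:
  assumes "set_iso U V" "set_iso V W"
  shows "set_iso U W"
proof -
  obtain f where f: "bij_betw f U V" "\<forall>A\<in>U. \<forall>B\<in>U. A \<subseteq> B \<longleftrightarrow> f A \<subseteq> f B"
    using assms(1) unfolding set_iso_def by blast
  obtain g where g: "bij_betw g V W" "\<forall>A\<in>V. \<forall>B\<in>V. A \<subseteq> B \<longleftrightarrow> g A \<subseteq> g B"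
    using assms(2) unfolding set_iso_def by blast
  have "bij_betw (g \<circ> f) U W" by (rule bij_betw_trans[OF f(1) g(1)])
  moreover have "f A \<in> V" if "A \<in> U" for A using f that by (meson bij_betwE)
  ultimately show ?thesis unfolding set_iso_def using f(2) g(2)
    by (intro exI[of _ "g \<circ> f"]) auto
qed

text \<open>Taking hulls turns inclusion of vertex sets into the face relation, so isomorphisms are
  conjugated by it in both directions.\<close>

lemma comb_equivalent_hulls:
  fixes V :: "'a::euclidean_space set set" and W :: "'b::euclidean_space set set"
  assumes V: "geometric V" and W: "geometric W"
  shows "comb_equivalent (hulls V) (hulls W) \<longleftrightarrow> set_iso V W"
proof -
  define hv where "hv = ((hull) convex :: 'a set \<Rightarrow> 'a set)"
  define hw where "hw = ((hull) convex :: 'b set \<Rightarrow> 'b set)"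
  have bv: "bij_betw hv V (hulls V)" unfolding hv_def
    using geometric_hull_inj[OF V] by (simp add: bij_betw_def hulls_def)
  have bw: "bij_betw hw W (hulls W)" unfolding hw_def
    using geometric_hull_inj[OF W] by (simp add: bij_betw_def hulls_def)
  have fv: "hv A face_of hv B \<longleftrightarrow> A \<subseteq> B" if "A \<in> V" "B \<in> V" for A B
    using geometric_face_iff[OF V] that by (simp add: hv_def)
  have fw: "hw A face_of hw B \<longleftrightarrow> A \<subseteq> B" if "A \<in> W" "B \<in> W" for A B
    using geometric_face_iff[OF W] that by (simp add: hw_def)
  have hvim: "hulls V = hv ` V" by (simp add: hulls_def hv_def)
  show ?thesis
  proof
    assume "comb_equivalent (hulls V) (hulls W)"
    then obtain f where f: "bij_betw f (hulls V) (hulls W)"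
      "\<forall>\<sigma>\<in>hulls V. \<forall>\<tau>\<in>hulls V. \<sigma> face_of \<tau> \<longleftrightarrow> f \<sigma> face_of f \<tau>"
      unfolding comb_equivalent_def by blast
    define g where "g = the_inv_into W hw \<circ> f \<circ> hv"
    have "bij_betw g V W" unfolding g_def
      using bv f(1) bij_betw_the_inv_into[OF bw] by (metis bij_betw_trans)
    moreover have "A \<subseteq> B \<longleftrightarrow> g A \<subseteq> g B" if AB: "A \<in> V" "B \<in> V" for A B
    proof -
      have hm: "hv A \<in> hulls V" "hv B \<in> hulls V" using AB hvim by auto
      then have "f (hv A) \<in> hulls W" "f (hv B) \<in> hulls W" using f(1) by (auto dest: bij_betwE)
      then have "hw (g A) = f (hv A)" "hw (g B) = f (hv B)" "g A \<in> W" "g B \<in> W"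
        using bw calculation AB unfolding g_def
        by (auto simp: bij_betw_def f_the_inv_into_f dest: bij_betwE)
      then show ?thesis using fw fv f(2) hm AB by metis
    qed
    ultimately show "set_iso V W" unfolding set_iso_def by blast
  next
    assume "set_iso V W"
    then obtain f where f: "bij_betw f V W" "\<forall>A\<in>V. \<forall>B\<in>V. A \<subseteq> B \<longleftrightarrow> f A \<subseteq> f B"
      unfolding set_iso_def by blast
    define g where "g = hw \<circ> f \<circ> the_inv_into V hv"
    have "bij_betw g (hulls V) (hulls W)" unfolding g_def
      using bw f(1) bij_betw_the_inv_into[OF bv] by (metis bij_betw_trans)
    moreover have "g (hv A) = hw (f A)" if "A \<in> V" for A
      using that bv by (simp add: g_def bij_betw_def the_inv_into_f_f)
    moreover have "f A \<in> W" if "A \<in> V" for A using f that by (meson bij_betwE)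
    ultimately show "comb_equivalent (hulls V) (hulls W)"
      unfolding comb_equivalent_def hvim using fv fw f(2)
      by (intro exI[of _ g]) (auto simp: hvim)
  qed
qed

text \<open>The isomorphism sends the empty face to the empty face, hence minimal nonempty faces,
  which are the singletons, to singletons. This defines \<open>\<phi>\<close>, and a face is
  determined by the singletons below it.\<close>

lemma set_iso_vertex_map:
  assumes iso: "set_iso V W"
    and downV: "\<And>A B. A \<in> V \<Longrightarrow> B \<subseteq> A \<Longrightarrow> B \<in> V" and downW: "\<And>A B. A \<in> W \<Longrightarrow> B \<subseteq> A \<Longrightarrow> B \<in> W"
  obtains \<phi> where "inj_on \<phi> (\<Union>V)" "W = (`) \<phi> ` V"
proof -
  obtain f where f: "bij_betw f V W" "\<forall>A\<in>V. \<forall>B\<in>V. A \<subseteq> B \<longleftrightarrow> f A \<subseteq> f B"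
    using iso unfolding set_iso_def by blast
  have fV: "f A \<in> W" if "A \<in> V" for A using f that by (meson bij_betwE)
  have onto: "\<exists>A\<in>V. f A = B" if "B \<in> W" for B using f that by (metis bij_betw_def imageE)
  have emp: "f {} = {}" if "{} \<in> V"
  proof -
    have "{} \<in> W" using downW[OF fV[OF that]] by simp
    then obtain A where "A \<in> V" "f A = {}" using onto by blast
    then have "f {} \<subseteq> {}" using f(2) that by (metis empty_subsetI)
    then show ?thesis by simp
  qed
  have sing: "\<exists>w. f {x} = {w}" if x: "{x} \<in> V" for x
  proof -
    have e: "{} \<in> V" using downV[OF x] by simp
    have "f {x} \<noteq> {}" using f(1) emp[OF e] x e unfolding bij_betw_def inj_on_def
      by (metis insert_not_empty)
    then obtain u where u: "u \<in> f {x}" by blast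
    then have "{u} \<in> W" using downW[OF fV[OF x]] by simp
    then obtain B where B: "B \<in> V" "f B = {u}" using onto by blast
    then have "B \<subseteq> {x}" using f(2) x u by auto
    moreover have "B \<noteq> {}" using B emp by auto
    ultimately have "B = {x}" by auto
    with B show ?thesis by blast
  qed
  define \<phi> where "\<phi> x = (THE w. f {x} = {w})" for x
  have \<phi>: "f {x} = {\<phi> x}" if "{x} \<in> V" for x
    using sing[OF that] by (auto simp: \<phi>_def)
  have sV: "{x} \<in> V" if "x \<in> \<Union>V" for x using that downV by blast
  have fA: "f A = \<phi> ` A" if A: "A \<in> V" for A
  proof
    show "\<phi> ` A \<subseteq> f A"
    proof clarify
      fix x assume "x \<in> A"
      then have "{x} \<in> V" "{x} \<subseteq> A" using A sV by auto
      then show "\<phi> x \<in> f A" using f(2) A \<phi> by (metis insert_subset)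
    qed
    show "f A \<subseteq> \<phi> ` A"
    proof
      fix u assume u: "u \<in> f A"
      then have "{u} \<in> W" using downW[OF fV[OF A]] by simp
      then obtain B where B: "B \<in> V" "f B = {u}" using onto by blast
      then have BA: "B \<subseteq> A" using f(2) A u by auto
      have "B \<noteq> {}" using B emp by auto
      then obtain x where "x \<in> B" by blast
      then have xV: "{x} \<in> V" "{x} \<subseteq> B" using B sV by auto
      then have "{\<phi> x} \<subseteq> {u}" using f(2) B \<phi> by metis
      then show "u \<in> \<phi> ` A" using BA \<open>x \<in> B\<close> by auto
    qed
  qed
  show thesis
  proof
    show "inj_on \<phi> (\<Union>V)"
    proof (rule inj_onI)
      fix x y assume "x \<in> \<Union>V" "y \<in> \<Union>V" "\<phi> x = \<phi> y"
      then have "{x} = {y}" using \<phi> sV f(1) unfolding bij_betw_def inj_on_def by metis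
      then show "x = y" by simp
    qed
    show "W = (`) \<phi> ` V" using f(1) fA by (simp add: bij_betw_def)
  qed
qed

subsection \<open>Stellar subdivisions\<close>

text \<open>The condition \<open>A \<union> T \<in> V\<close> says that \<open>A\<close> lies in the
  closed star of \<open>T\<close>. The new faces are the cones with apex \<open>x\<close> over the
  faces of that star which do not contain \<open>T\<close>.\<close>

definition stellar :: "'a set \<Rightarrow> 'a \<Rightarrow> 'a set set \<Rightarrow> 'a set set" where
  "stellar T x V = {A\<in>V. \<not> T \<subseteq> A} \<union> {insert x A |A. A \<in> V \<and> \<not> T \<subseteq> A \<and> A \<union> T \<in> V}"

lemma rel_interior_hull_weights:
  fixes V :: "'a::euclidean_space set set"
  assumes V: "geometric V" "A \<in> V" and x: "x \<in> rel_interior (convex hull A)"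
  obtains l where "l \<in> weights A" "\<And>u. u \<in> A \<Longrightarrow> 0 < l u" "bary l = x"
proof -
  have fin: "finite A" using V geometric_finite by blast
  obtain u where u: "\<forall>y\<in>A. 0 < u y" "sum u A = 1" "(\<Sum>y\<in>A. u y *\<^sub>R y) = x"
    using x rel_interior_convex_hull_explicit[OF geometric_affine_independent[OF V]] by auto
  define l where "l y = (if y \<in> A then u y else 0)" for y
  have l: "l \<in> weights A" using u by (auto simp: weights_def l_def less_imp_le)
  have "bary l = x" using u bary_weights[OF fin l] by (simp add: l_def)
  then show thesis using that[OF l] u by (simp add: l_def)
qed

lemma bary_vertex: "bary (\<lambda>y. if y = x then 1 else 0) = (x :: 'a::real_vector)"
  using bary_eq[of "{x}" "\<lambda>y. if y = x then 1 else 0"] by simp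

text \<open>The coordinates of a vertex are its indicator function, whereas a relative interior
  point has positive weight on all of \<open>T\<close>. Hence a subdividing point is a new vertex
  except in the trivial case of a singleton.\<close>

lemma rel_interior_hull_vertex:
  fixes V :: "'a::euclidean_space set set"
  assumes V: "geometric V" "T \<in> V" "T \<noteq> {}" and x: "x \<in> rel_interior (convex hull T)" "x \<in> \<Union>V"
  shows "T = {x}"
proof -
  obtain b where b: "b \<in> weights T" "\<And>u. u \<in> T \<Longrightarrow> 0 < b u" "bary b = x"
    using rel_interior_hull_weights[OF V(1,2) x(1)] by blast
  have "{x} \<in> V" using x(2) V geometric_down by blast
  moreover have "(\<lambda>y. if y = x then 1 else 0) \<in> weights {x}" by (simp add: weights_single)
  moreover have "bary b = bary (\<lambda>y. if y = x then 1 else 0)" using b(3) bary_vertex by metis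
  ultimately have "b = (\<lambda>y. if y = x then 1 else 0)" by (rule geometric_inj[OF V(1,2) _ b(1)])
  then have "u = x" if "u \<in> T" for u using b(2)[OF that] by (simp split: if_splits)
  then have "T \<subseteq> {x}" by blast
  then show ?thesis using V by blast
qed

text \<open>\<open>b\<close> holds the barycentric coordinates of \<open>x\<close> in
  \<open>T\<close>. Their positivity makes \<open>x\<close> a relative interior point and allows
  division by them.\<close>

locale stellar_point =
  fixes V :: "'a::euclidean_space set set" and T :: "'a set" and x :: 'a and b :: "'a \<Rightarrow> real"
  assumes V: "geometric V" and T: "T \<in> V" "T \<noteq> {}"
    and b: "b \<in> weights T" "\<And>u. u \<in> T \<Longrightarrow> 0 < b u" "bary b = x"
begin

lemma fin: "A \<in> V \<Longrightarrow> finite A" using V geometric_finite by blast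

lemma x_hull: "x \<in> convex hull T"
  using convex_hull_weights[OF fin[OF T(1)]] b by blast

lemma x_rel_interior: "x \<in> rel_interior (convex hull T)"
  unfolding rel_interior_convex_hull_explicit[OF geometric_affine_independent[OF V T(1)]]
  using b bary_weights[OF fin[OF T(1)] b(1)] by (auto simp: weights_def)

lemma x_notin: "A \<in> V \<Longrightarrow> \<not> T \<subseteq> A \<Longrightarrow> x \<notin> A"
  using rel_interior_hull_vertex[OF V T x_rel_interior] by blast

text \<open>Faces of \<open>V\<close> that do not contain \<open>T\<close> never contain
  \<open>x\<close>, even if \<open>T\<close> is \<open>{x}\<close> itself. So
  \<open>x \<in> B\<close> separates the two kinds of faces, and \<open>B - {x}\<close> recovers the
  base of a cone.\<close>

lemma stellar_iff:
  "B \<in> stellar T x V \<longleftrightarrow> (x \<notin> B \<and> B \<in> V \<and> \<not> T \<subseteq> B) \<or>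
     (x \<in> B \<and> B - {x} \<in> V \<and> \<not> T \<subseteq> B - {x} \<and> (B - {x}) \<union> T \<in> V)"
proof
  assume "B \<in> stellar T x V"
  then consider "B \<in> V" "\<not> T \<subseteq> B" | A where "B = insert x A" "A \<in> V" "\<not> T \<subseteq> A" "A \<union> T \<in> V"
    unfolding stellar_def by blast
  then show "(x \<notin> B \<and> B \<in> V \<and> \<not> T \<subseteq> B) \<or>
     (x \<in> B \<and> B - {x} \<in> V \<and> \<not> T \<subseteq> B - {x} \<and> (B - {x}) \<union> T \<in> V)"
  proof cases
    case 2
    then have "B - {x} = A" using x_notin by auto
    then show ?thesis using 2 by auto
  qed (use x_notin in auto)
next
  assume "(x \<notin> B \<and> B \<in> V \<and> \<not> T \<subseteq> B) \<or>
     (x \<in> B \<and> B - {x} \<in> V \<and> \<not> T \<subseteq> B - {x} \<and> (B - {x}) \<union> T \<in> V)"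
  moreover have "B = insert x (B - {x})" if "x \<in> B" using that by blast
  ultimately show "B \<in> stellar T x V" unfolding stellar_def by blast
qed

text \<open>Since \<open>x\<close> lies in the hull of \<open>T\<close>, the cone with apex
  \<open>x\<close> over \<open>A\<close> lies in the simplex on \<open>A \<union> T\<close>.\<close>

lemma stellar_carrier:
  assumes "B \<in> stellar T x V"
  obtains D where "D \<in> V" "convex hull B \<subseteq> convex hull D" "x \<in> B \<Longrightarrow> D = (B - {x}) \<union> T"
    "x \<notin> B \<Longrightarrow> D = B"
proof (cases "x \<in> B")
  case True
  then have D: "(B - {x}) \<union> T \<in> V" using assms stellar_iff by blast
  have "B \<subseteq> convex hull ((B - {x}) \<union> T)"
    using x_hull hull_mono[of T "(B - {x}) \<union> T" convex] hull_subset[of "(B - {x}) \<union> T" convex]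
    by blast
  then show ?thesis using that[OF D] True by (simp add: hull_minimal)
next
  case False
  then show ?thesis using that[of B] assms stellar_iff by blast
qed

text \<open>
  Coordinates with respect to a subdivided face determine coordinates with respect to the original
  one by distributing the weight of \<open>x\<close> over \<open>T\<close>. Conversely the weight of \<open>x\<close> is the minimum of
  the quotients of the coordinates on \<open>T\<close> by those of \<open>x\<close>.
\<close>

definition push :: "('a \<Rightarrow> real) \<Rightarrow> 'a \<Rightarrow> real" where
  "push m u = (if u = x then 0 else m u) + m x * b u"

lemma push:
  assumes B: "B \<in> stellar T x V" and m: "m \<in> weights B"
  shows "bary (push m) = bary m" "\<exists>D\<in>V. push m \<in> weights D"
    "\<forall>u\<in>T. m x * b u \<le> push m u" "\<exists>u\<in>T. push m u = m x * b u"
proof -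
  have m0: "\<And>u. 0 \<le> m u" "\<And>u. u \<notin> B \<Longrightarrow> m u = 0" and msum: "sum m B = 1"
    using m by (auto simp: weights_def)
  have b0: "\<And>u. 0 \<le> b u" "\<And>u. u \<notin> T \<Longrightarrow> b u = 0" and bsum: "sum b T = 1"
    using b by (auto simp: weights_def)
  show "\<forall>u\<in>T. m x * b u \<le> push m u" using m0 by (simp add: push_def)
  \<comment> \<open>At a vertex of \<open>T\<close> missing from the base \<open>B - {x}\<close>
    only the share coming from \<open>x\<close> is left, so the inequality is attained
    there.\<close>
  have "\<not> T \<subseteq> B - {x}" using B stellar_iff by blast
  then obtain u where "u \<in> T" "u \<notin> B - {x}" by blast
  then show "\<exists>u\<in>T. push m u = m x * b u" using m0 by (auto simp: push_def)
  have finT: "finite T" using T fin by blast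
  have "bary (push m) = bary m \<and> (\<exists>D\<in>V. push m \<in> weights D)"
  proof (cases "x \<in> B")
    case False
    then have "push m = m" using m0 by (auto simp: push_def fun_eq_iff)
    moreover have "B \<in> V" using False B stellar_iff by blast
    ultimately show ?thesis using m by auto
  next
    case True
    define A where "A = B - {x}"
    define D where "D = A \<union> T"
    have D: "D \<in> V" "A \<in> V" using B True stellar_iff by (auto simp: A_def D_def)
    have finD: "finite D" "finite A" using D fin by auto
    have BA: "B = insert x A" "x \<notin> A" using True by (auto simp: A_def)
    have e1: "(\<Sum>u\<in>D. if u = x then 0 else m u) = sum m A"
      unfolding D_def using BA m0 finD finT by (intro sum.mono_neutral_cong_right) auto
    have e2: "(\<Sum>u\<in>D. b u) = sum b T"
      unfolding D_def using b0 finD finT by (intro sum.mono_neutral_right) auto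
    have "sum (push m) D = sum m A + m x * sum b T"
      unfolding push_def sum.distrib e1 by (simp add: e2 flip: sum_distrib_left)
    also have "\<dots> = 1" using msum BA finD bsum by simp
    finally have "push m \<in> weights D"
      using m0 b0 BA by (auto simp: weights_def push_def D_def)
    have f1: "(\<Sum>u\<in>D. (if u = x then 0 else m u) *\<^sub>R u) = (\<Sum>u\<in>A. m u *\<^sub>R u)"
      unfolding D_def using BA m0 finD finT by (intro sum.mono_neutral_cong_right) auto
    have f2: "(\<Sum>u\<in>D. b u *\<^sub>R u) = x"
      using b0 finD bary_eq[of D b] b(3) by (auto simp: D_def)
    have "bary (push m) = (\<Sum>u\<in>A. m u *\<^sub>R u) + m x *\<^sub>R x"
      unfolding bary_weights[OF finD(1) \<open>push m \<in> weights D\<close>] push_def scaleR_add_left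
        sum.distrib f1 by (simp add: f2 flip: scaleR_scaleR scaleR_right.sum)
    also have "\<dots> = bary m"
      using bary_weights[OF _ m] finD BA by simp
    finally show ?thesis using D \<open>push m \<in> weights D\<close> by blast
  qed
  then show "bary (push m) = bary m" "\<exists>D\<in>V. push m \<in> weights D" by auto
qed

lemma push_inj:
  assumes "B \<in> stellar T x V" "m \<in> weights B" "B' \<in> stellar T x V" "m' \<in> weights B'"
    and eq: "push m = push m'"
  shows "m = m'"
proof -
  have le: "m x \<le> m' x"
    if m: "B \<in> stellar T x V" "m \<in> weights B" "B' \<in> stellar T x V" "m' \<in> weights B'"
      "push m = push m'" for B m B' m'
  proof -
    obtain u where u: "u \<in> T" "push m' u = m' x * b u" using push(4) m by blast
    have "m x * b u \<le> push m u" using push(3)[OF m(1,2)] u by blast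
    then show ?thesis using u b(2)[OF u(1)] m(5) by simp
  qed
  have mx: "m x = m' x"
    using le[OF assms] le[OF assms(3,4,1,2) eq[symmetric]] by simp
  have "m u = m' u" for u
    using eq mx unfolding push_def fun_eq_iff by (cases "u = x") (auto dest: spec[of _ u])
  then show ?thesis by blast
qed

lemma geometric_stellar: "geometric (stellar T x V)"
  unfolding geometric_def
proof (intro conjI ballI allI impI)
  have "stellar T x V \<subseteq> V \<union> insert x ` V" unfolding stellar_def by auto
  moreover have "finite V" using V by (simp add: geometric_def)
  ultimately show "finite (stellar T x V)" by (meson finite_UnI finite_imageI finite_subset)
  show "finite A" if "A \<in> stellar T x V" for A
    using that fin unfolding stellar_def by auto
  show "C \<in> stellar T x V" if "A \<in> stellar T x V" "C \<subseteq> A" for A C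
  proof (cases "x \<in> C")
    case True
    then have x: "x \<in> A" using that by blast
    then have A: "\<not> T \<subseteq> A - {x}" "(A - {x}) \<union> T \<in> V"
      using that stellar_iff by auto
    have "C - {x} \<in> V" "(C - {x}) \<union> T \<in> V"
      by (rule geometric_down[OF V A(2)], use that(2) in blast)+
    then show ?thesis using stellar_iff True A(1) that(2) by blast
  next
    case False
    have "A - {x} \<in> V" "\<not> T \<subseteq> A - {x}"
      using that stellar_iff[of A] by (auto simp: Diff_insert0)
    then have "C \<in> V" "\<not> T \<subseteq> C"
      using geometric_down[OF V \<open>A - {x} \<in> V\<close>, of C] that(2) False by blast+
    then show ?thesis using stellar_iff False by blast
  qed
  show "inj_on bary (\<Union>A\<in>stellar T x V. weights A)"
  proof (rule inj_onI, clarify)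
    fix m m' B B' assume B: "B \<in> stellar T x V" "m \<in> weights B" "B' \<in> stellar T x V" "m' \<in> weights B'"
      and eq: "bary m = bary m'"
    obtain D D' where D: "D \<in> V" "push m \<in> weights D" "D' \<in> V" "push m' \<in> weights D'"
      using push(2) B by meson
    have "push m = push m'"
      by (rule geometric_inj[OF V D(1,3,2,4)]) (use push(1) B eq in metis)
    then show "m = m'" using push_inj B by blast
  qed
qed

lemma body_stellar: "body (stellar T x V) = body V"
proof
  show "body (stellar T x V) \<subseteq> body V"
    unfolding body_eq
  proof (rule UN_least)
    fix B assume "B \<in> stellar T x V"
    then obtain D where "D \<in> V" "convex hull B \<subseteq> convex hull D" by (rule stellar_carrier)
    then show "convex hull B \<subseteq> (\<Union>A\<in>V. convex hull A)" by blast
  qed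
  show "body V \<subseteq> body (stellar T x V)"
  proof
    fix y assume "y \<in> body V"
    then obtain A where A: "A \<in> V" "y \<in> convex hull A" unfolding body_eq by blast
    show "y \<in> body (stellar T x V)"
    proof (cases "T \<subseteq> A")
      case False
      then have "A \<in> stellar T x V" using A(1) unfolding stellar_def by simp
      then show ?thesis using A(2) unfolding body_eq by blast
    next
      case True
      have finA: "finite A" and finT: "finite T" using fin A T by auto
      obtain l where l: "l \<in> weights A" "bary l = y"
        using A(2) unfolding convex_hull_weights[OF finA] by blast
      have l0: "\<And>u. 0 \<le> l u" "\<And>u. u \<notin> A \<Longrightarrow> l u = 0" and lsum: "sum l A = 1"
        using l by (auto simp: weights_def)
      have b0: "\<And>u. 0 \<le> b u" "\<And>u. u \<notin> T \<Longrightarrow> b u = 0" and bsum: "sum b T = 1"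
        using b by (auto simp: weights_def)
      \<comment> \<open>\<open>t\<close> is the largest multiple of \<open>b\<close> that can be
        subtracted from \<open>l\<close> without making a coordinate negative. It becomes the weight
        of \<open>x\<close>, and a vertex \<open>u0\<close> of \<open>T\<close> at which the minimum
        is attained loses all its weight and is dropped.\<close>
      define t where "t = Min ((\<lambda>u. l u / b u) ` T)"
      have "t \<in> (\<lambda>u. l u / b u) ` T" unfolding t_def using finT T by (intro Min_in) auto
      then obtain u0 where u0: "u0 \<in> T" "t = l u0 / b u0" by blast
      have tb: "t * b u \<le> l u" for u
      proof (cases "u \<in> T")
        case True
        then have "t \<le> l u / b u" unfolding t_def using finT by (intro Min_le) auto
        then show ?thesis using b(2)[OF True] by (simp add: field_simps)
      qed (use b0 l0 in simp)
      have tb0: "l u0 - t * b u0 = 0" using u0 b(2)[OF u0(1)] by simp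
      have t0: "t \<ge> 0" using u0 l0 b0 by simp
      define A' where "A' = A - {u0}"
      have finA': "finite A'" using finA by (simp add: A'_def)
      have A': "A' \<in> V" "\<not> T \<subseteq> A'" "A' \<union> T \<in> V"
        using geometric_down[OF V A(1)] True u0 by (auto simp: A'_def)
      then have xA': "x \<notin> A'" using x_notin by blast
      have st: "insert x A' \<in> stellar T x V" unfolding stellar_def using A' by blast
      define m where "m u = (if u = x then t else if u \<in> A' then l u - t * b u else 0)" for u
      have bA: "sum b A = 1" unfolding bsum[symmetric] using True finA b0
        by (intro sum.mono_neutral_right) auto
      have "sum (\<lambda>u. l u - t * b u) A' = sum (\<lambda>u. l u - t * b u) A"
        using finA tb0 by (intro sum.mono_neutral_left) (auto simp: A'_def)
      also have "\<dots> = 1 - t" by (simp add: sum_subtractf lsum bA flip: sum_distrib_left)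
      finally have s1: "sum (\<lambda>u. l u - t * b u) A' = 1 - t" .
      have mA': "(\<Sum>u\<in>A'. m u) = (\<Sum>u\<in>A'. l u - t * b u)"
        "(\<Sum>u\<in>A'. m u *\<^sub>R u) = (\<Sum>u\<in>A'. (l u - t * b u) *\<^sub>R u)"
        using xA' by (auto simp: m_def intro!: sum.cong)
      have mx: "m x = t" by (simp add: m_def)
      have m: "m \<in> weights (insert x A')"
        unfolding weights_def using finA' xA' mA' s1 mx t0 tb by (auto simp: m_def)
      have "(\<Sum>u\<in>A'. (l u - t * b u) *\<^sub>R u) = (\<Sum>u\<in>A. (l u - t * b u) *\<^sub>R u)"
        using finA tb0 by (intro sum.mono_neutral_left) (auto simp: A'_def)
      also have "\<dots> = y - t *\<^sub>R (\<Sum>u\<in>A. b u *\<^sub>R u)"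
        using bary_weights[OF finA l(1)] l(2)
        by (simp add: scaleR_diff_left sum_subtractf scaleR_right.sum)
      also have "(\<Sum>u\<in>A. b u *\<^sub>R u) = x"
        using bary_eq[of A b] finA True b0(2) b(3) by (metis subsetD)
      finally have "bary m = y"
        using bary_weights[OF _ m] finA' xA' mA' mx by simp
      then have "y \<in> convex hull (insert x A')"
        using convex_hull_weights[of "insert x A'"] finA' m by blast
      then show ?thesis using st unfolding body_eq by blast
    qed
  qed
qed

lemma stellar_subdivision_hulls:
  assumes V0: "{} \<in> V"
  shows "stellar_subdivision (convex hull T) x (hulls V) = hulls (stellar T x V)"
proof -
  have del: "deletion (convex hull T) (hulls W) = hulls {A\<in>W. \<not> T \<subseteq> A}"
    if W: "geometric W" for W
  proof -
    have "deletion (convex hull T) (hulls W) = {\<sigma>\<in>hulls W. \<not> convex hull T face_of \<sigma>}"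
      by (rule deletion_eq[OF geometric_imp_simplicial_complex[OF W]])
    moreover have "convex hull T face_of convex hull A \<longleftrightarrow> T \<subseteq> A" if "A \<in> W" for A
      using hull_face_iff geometric_affine_independent[OF V T(1)]
        geometric_affine_independent[OF W that] by blast
    ultimately show ?thesis unfolding hulls_def by auto
  qed
  \<comment> \<open>The vertex sets of the closed star of \<open>T\<close>. They form a complex of
    their own, so the formula for deletions applies to it as well.\<close>
  let ?S = "{A\<in>V. A \<union> T \<in> V}"
  have S: "geometric ?S"
    using geometric_subset[OF V, of ?S] geometric_down[OF V] by (smt (verit) Un_mono mem_Collect_eq order_refl subsetI)
  have "star (convex hull T) (hulls V) =
      {\<sigma>. \<exists>\<rho>\<in>hulls V. \<sigma> face_of \<rho> \<and> convex hull T face_of \<rho>}"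
    by (rule star_eq[OF geometric_imp_simplicial_complex[OF V]])
  also have "\<dots> = hulls ?S"
  proof
    show "{\<sigma>. \<exists>\<rho>\<in>hulls V. \<sigma> face_of \<rho> \<and> convex hull T face_of \<rho>} \<subseteq> hulls ?S"
    proof clarify
      fix \<sigma> \<rho> assume r: "\<rho> \<in> hulls V" "\<sigma> face_of \<rho>" "convex hull T face_of \<rho>"
      obtain R where R: "R \<in> V" "\<rho> = convex hull R" using r(1) unfolding hulls_def by blast
      obtain A where A: "A \<subseteq> R" "\<sigma> = convex hull A" "A \<in> V"
        using geometric_face_imp[OF V R(1)] r(2) R(2) by metis
      have "T \<subseteq> R" using geometric_face_iff[OF V T(1) R(1)] r(3) R(2) by blast
      then have "A \<union> T \<in> V" using geometric_down[OF V R(1)] A(1) by blast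
      then show "\<sigma> \<in> hulls ?S" using A unfolding hulls_def by blast
    qed
    show "hulls ?S \<subseteq> {\<sigma>. \<exists>\<rho>\<in>hulls V. \<sigma> face_of \<rho> \<and> convex hull T face_of \<rho>}"
    proof
      fix \<sigma> assume "\<sigma> \<in> hulls ?S"
      then obtain A where A: "A \<in> V" "A \<union> T \<in> V" "\<sigma> = convex hull A" unfolding hulls_def by blast
      then have "\<sigma> face_of convex hull (A \<union> T)" "convex hull T face_of convex hull (A \<union> T)"
        using geometric_face_iff[OF V] T by auto
      then show "\<sigma> \<in> {\<sigma>. \<exists>\<rho>\<in>hulls V. \<sigma> face_of \<rho> \<and> convex hull T face_of \<rho>}"
        using A(2) unfolding hulls_def by blast
    qed
  qed
  finally have star: "star (convex hull T) (hulls V) = hulls ?S" .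
  have cone: "convex hull ({x} \<union> convex hull A) = convex hull (insert x A)" for A
    using hull_Un_right[of convex "{x}" A] by simp
  have "{convex hull ({x} \<union> \<sigma>) |\<sigma>. \<sigma> \<in> hulls {A\<in>?S. \<not> T \<subseteq> A}} =
      hulls {insert x A |A. A \<in> V \<and> \<not> T \<subseteq> A \<and> A \<union> T \<in> V}" (is "?L = ?R")
  proof
    show "?L \<subseteq> ?R"
    proof clarify
      fix \<sigma> assume "\<sigma> \<in> hulls {A\<in>?S. \<not> T \<subseteq> A}"
      then obtain A where A: "A \<in> V" "A \<union> T \<in> V" "\<not> T \<subseteq> A" "\<sigma> = convex hull A"
        unfolding hulls_def by blast
      have "convex hull ({x} \<union> \<sigma>) = convex hull (insert x A)" unfolding A(4) by (rule cone)
      then show "convex hull ({x} \<union> \<sigma>) \<in> ?R" unfolding hulls_def using A by blast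
    qed
    show "?R \<subseteq> ?L"
    proof
      fix \<sigma> assume "\<sigma> \<in> ?R"
      then obtain A where A: "A \<in> V" "A \<union> T \<in> V" "\<not> T \<subseteq> A" "\<sigma> = convex hull (insert x A)"
        unfolding hulls_def by blast
      have "convex hull A \<in> hulls {A\<in>?S. \<not> T \<subseteq> A}" unfolding hulls_def using A by blast
      then show "\<sigma> \<in> ?L" unfolding A(4) using cone[of A] by blast
    qed
  qed
  then show ?thesis
    unfolding stellar_subdivision_def star del[OF V] del[OF S] stellar_def
    by (simp add: hulls_def image_Un)
qed

end

definition stellar_step :: "'a::euclidean_space set set \<Rightarrow> 'a set set \<Rightarrow> bool" where
  "stellar_step V W \<longleftrightarrow> (\<exists>T x b. stellar_point V T x b \<and> W = stellar T x V)"

lemma stellar_pointI: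
  assumes V: "geometric V" "T \<in> V" "T \<noteq> {}" and x: "x \<in> rel_interior (convex hull T)"
  obtains b where "stellar_point V T x b"
proof -
  obtain b where "b \<in> weights T" "\<And>u. u \<in> T \<Longrightarrow> 0 < b u" "bary b = x"
    using rel_interior_hull_weights[OF V(1,2) x] by blast
  then have "stellar_point V T x b" using V by unfold_locales auto
  then show thesis by (rule that)
qed

definition refines :: "'a::euclidean_space set set \<Rightarrow> 'a set set \<Rightarrow> bool" where
  "refines W V \<longleftrightarrow> (\<forall>B\<in>W. \<exists>A\<in>V. convex hull B \<subseteq> convex hull A)"

lemma refines_refl: "refines V V"
  unfolding refines_def by blast

lemma refines_trans: "refines W V \<Longrightarrow> refines V U \<Longrightarrow> refines W U"
  unfolding refines_def by (meson subset_trans)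

lemma stellar_step:
  assumes "stellar_step V W"
  shows "geometric W" "body W = body V" "refines W V" "{} \<in> V \<Longrightarrow> {} \<in> W"
proof -
  obtain T x b where sp: "stellar_point V T x b" and W: "W = stellar T x V"
    using assms unfolding stellar_step_def by blast
  interpret stellar_point V T x b by (fact sp)
  show "geometric W" "body W = body V" using geometric_stellar body_stellar W by auto
  show "refines W V" unfolding refines_def W using stellar_carrier by metis
  show "{} \<in> W" if "{} \<in> V" using that T unfolding W stellar_def by blast
qed

lemma stellar_steps:
  assumes "stellar_step\<^sup>*\<^sup>* V W" "geometric V"
  shows "geometric W" "body W = body V" "refines W V" "{} \<in> V \<Longrightarrow> {} \<in> W"
  using assms
proof (induction rule: rtranclp_induct)
  case base
  {
    case 1 then show ?case .
  next
    case 2 show ?case ..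
  next
    case 3 show ?case by (rule refines_refl)
  next
    case 4 then show ?case by simp
  }
next
  case (step W U)
  {
    case 1 show ?case using stellar_step(1)[OF step(2)] .
  next
    case 2 then show ?case using stellar_step(2)[OF step(2)] step.IH by simp
  next
    case 3 then show ?case using stellar_step(3)[OF step(2)] step.IH refines_trans by blast
  next
    case 4 then show ?case using stellar_step(4)[OF step(2)] step.IH by simp
  }
qed

subsection \<open>Derived subdivisions\<close>

text \<open>The order complex of the poset of nonempty faces. It carries the combinatorial type of a
  derived subdivision, whatever points are chosen.\<close>

definition chains :: "'a set set \<Rightarrow> 'a set set set" where
  "chains V = {C. C \<subseteq> V - {{}} \<and> (\<forall>A\<in>C. \<forall>B\<in>C. A \<subseteq> B \<or> B \<subseteq> A)}"

definition derived_by :: "('a set \<Rightarrow> 'a) \<Rightarrow> 'a set set \<Rightarrow> 'a set set" where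
  "derived_by v V = (`) v ` chains V"

definition derived :: "'a::euclidean_space set set \<Rightarrow> 'a set set \<Rightarrow> bool" where
  "derived V W \<longleftrightarrow> (\<exists>v. (\<forall>A\<in>V - {{}}. v A \<in> rel_interior (convex hull A)) \<and> W = derived_by v V)"

text \<open>The complex reached once exactly the faces in \<open>P\<close> have been subdivided.\<close>

definition partly_derived :: "('a set \<Rightarrow> 'a) \<Rightarrow> 'a set set \<Rightarrow> 'a set set \<Rightarrow> 'a set set" where
  "partly_derived v V P =
     {A \<union> v ` C |A C. C \<in> chains V \<and> C \<subseteq> P \<and> A \<in> V \<and> A \<notin> P \<and> (\<forall>c\<in>C. A \<subseteq> c)}"

locale derived_points =
  fixes V :: "'a::euclidean_space set set" and v :: "'a set \<Rightarrow> 'a"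
  assumes V: "geometric V" and V0: "{} \<in> V"
    and v: "\<And>A. A \<in> V \<Longrightarrow> A \<noteq> {} \<Longrightarrow> v A \<in> rel_interior (convex hull A)"
begin

lemma v_vertex: "A \<in> V \<Longrightarrow> A \<noteq> {} \<Longrightarrow> v A \<in> \<Union>V \<Longrightarrow> A = {v A}"
  using rel_interior_hull_vertex[OF V] v by blast

text \<open>The coordinates of \<open>v A\<close> have support \<open>A\<close>, so the point
  determines the face.\<close>

lemma v_inj: "inj_on v (V - {{}})"
proof (rule inj_onI)
  fix A B assume A: "A \<in> V - {{}}" and B: "B \<in> V - {{}}" and eq: "v A = v B"
  obtain l where l: "l \<in> weights A" "\<And>u. u \<in> A \<Longrightarrow> 0 < l u" "bary l = v A"
    using rel_interior_hull_weights[OF V _ v] A by blast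
  obtain m where m: "m \<in> weights B" "\<And>u. u \<in> B \<Longrightarrow> 0 < m u" "bary m = v B"
    using rel_interior_hull_weights[OF V _ v] B by blast
  have "l = m" using geometric_inj[OF V, of A B l m] A B l m eq by simp
  have "u \<in> A \<longleftrightarrow> u \<in> B" for u
    using l(1,2) m(1,2) \<open>l = m\<close> unfolding weights_def by force
  then show "A = B" by blast
qed

lemma partly_derived_empty: "partly_derived v V {} = V"
  unfolding partly_derived_def chains_def by auto

lemma partly_derived_all: "partly_derived v V (V - {{}}) = derived_by v V"
  unfolding partly_derived_def derived_by_def chains_def using V0 by auto

text \<open>\<open>P\<close> is closed upwards and contains everything strictly above
  \<open>T\<close>. Hence a face of the intermediate complex contains \<open>T\<close> only if its
  old part is \<open>T\<close> and its chain lies above \<open>T\<close>; subdividing at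
  \<open>T\<close> then amounts to adding \<open>T\<close> at the bottom of such chains.\<close>

lemma partly_derived_step:
  assumes P: "P \<subseteq> V - {{}}" "\<And>A B. A \<in> P \<Longrightarrow> B \<in> V \<Longrightarrow> A \<subseteq> B \<Longrightarrow> B \<in> P"
    and T: "T \<in> V" "T \<noteq> {}" "T \<notin> P" "\<And>B. B \<in> V \<Longrightarrow> T \<subset> B \<Longrightarrow> B \<in> P"
  shows "stellar T (v T) (partly_derived v V P) = partly_derived v V (insert T P)"
proof -
  \<comment> \<open>A point \<open>v c\<close> is an old vertex \<open>a\<close> only if
    \<open>c = {a}\<close>. For \<open>a \<in> T\<close> the upward closure of \<open>P\<close>
    would then put \<open>T\<close> into \<open>P\<close>. So whether a face contains
    \<open>T\<close> is decided by its old part alone.\<close>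
  have disj: "a \<notin> v ` C" if "C \<subseteq> P" "a \<in> T" for a C
  proof
    assume "a \<in> v ` C"
    then obtain c where c: "c \<in> C" "a = v c" by blast
    have "c \<in> V" "c \<noteq> {}" "v c \<in> \<Union>V" using c that P(1) T(1) by auto
    then have "c = {a}" using v_vertex c by blast
    then have "c \<subseteq> T" using that by blast
    then show False using P(2)[of c T] c that T by blast
  qed
  have sub: "T \<subseteq> A \<union> v ` C \<longleftrightarrow> T \<subseteq> A" if "C \<subseteq> P" for A C
    using disj[OF that] by blast
  show ?thesis
  proof
    show "stellar T (v T) (partly_derived v V P) \<subseteq> partly_derived v V (insert T P)"
    proof
      fix B assume "B \<in> stellar T (v T) (partly_derived v V P)"
      then consider "B \<in> partly_derived v V P" "\<not> T \<subseteq> B"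
        | B' where "B = insert (v T) B'" "B' \<in> partly_derived v V P" "\<not> T \<subseteq> B'"
          "B' \<union> T \<in> partly_derived v V P"
        unfolding stellar_def by blast
      then show "B \<in> partly_derived v V (insert T P)"
      proof cases
        case 1
        then obtain A C where AC: "B = A \<union> v ` C" "C \<in> chains V" "C \<subseteq> P" "A \<in> V" "A \<notin> P"
          "\<forall>c\<in>C. A \<subseteq> c"
          unfolding partly_derived_def by blast
        then have "A \<noteq> T" using 1 by blast
        then show ?thesis unfolding partly_derived_def using AC by blast
      next
        case 2
        obtain A C where AC: "B' = A \<union> v ` C" "C \<in> chains V" "C \<subseteq> P" "A \<in> V" "A \<notin> P"
          "\<forall>c\<in>C. A \<subseteq> c"
          using 2(2) unfolding partly_derived_def by blast
        obtain A' C' where AC': "B' \<union> T = A' \<union> v ` C'" "C' \<in> chains V" "C' \<subseteq> P" "A' \<in> V"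
          "A' \<notin> P" "\<forall>c\<in>C'. A' \<subseteq> c"
          using 2(4) unfolding partly_derived_def by blast
        have "T \<subseteq> A'" using sub[OF AC'(3)] AC'(1) by blast
        then have A'T: "A' = T" using T(4) AC'(4,5) by blast
        \<comment> \<open>A vertex \<open>a\<close> of \<open>A\<close> outside \<open>T\<close>
          would be a point \<open>v c\<close> of the chain \<open>C'\<close> above \<open>T\<close>.
          Then \<open>c = {a}\<close>, which cannot contain the nonempty set
          \<open>T\<close>.\<close>
        have AT: "A \<subseteq> T"
        proof
          fix a assume a: "a \<in> A"
          show "a \<in> T"
          proof (rule ccontr)
            assume "a \<notin> T"
            then obtain c where c: "c \<in> C'" "a = v c" using AC(1) AC'(1) A'T a by blast
            have "c \<in> V" "c \<noteq> {}" "v c \<in> \<Union>V" using c AC'(3) P(1) a AC(4) by auto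
            then have "c = {a}" using v_vertex c by blast
            then have "T \<subseteq> {a}" using AC'(6) A'T c by blast
            then show False using T(2) \<open>a \<notin> T\<close> by blast
          qed
        qed
        have "\<not> T \<subseteq> A" using 2(3) AC(1) by blast
        have TC: "T \<subseteq> c" if c: "c \<in> C" for c
        proof -
          have "v c \<notin> T" using disj[OF AC(3)] c by blast
          then have "v c \<in> v ` C'" using AC(1) AC'(1) A'T c by blast
          then have "c \<in> C'"
            using v_inj AC(3) AC'(3) P(1) c by (meson inj_on_image_mem_iff subset_trans subsetD)
          then show ?thesis using AC'(6) A'T by blast
        qed
        have "insert T C \<in> chains V" using AC(2) TC T(1,2) unfolding chains_def by auto
        moreover have "B = A \<union> v ` insert T C" using 2(1) AC(1) by auto
        moreover have "insert T C \<subseteq> insert T P" "A \<notin> insert T P" "\<forall>c\<in>insert T C. A \<subseteq> c"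
          using AC AT \<open>\<not> T \<subseteq> A\<close> by auto
        ultimately show ?thesis unfolding partly_derived_def using AC(4) by blast
      qed
    qed
    show "partly_derived v V (insert T P) \<subseteq> stellar T (v T) (partly_derived v V P)"
    proof
      fix B assume "B \<in> partly_derived v V (insert T P)"
      then obtain A C where AC: "B = A \<union> v ` C" "C \<in> chains V" "C \<subseteq> insert T P" "A \<in> V"
        "A \<notin> insert T P" "\<forall>c\<in>C. A \<subseteq> c"
        unfolding partly_derived_def by blast
      have TA: "\<not> T \<subseteq> A" using AC(4,5) T(4) by blast
      show "B \<in> stellar T (v T) (partly_derived v V P)"
      proof (cases "T \<in> C")
        case False
        then have "C \<subseteq> P" using AC(3) by blast
        then have "\<not> T \<subseteq> B" using sub TA AC(1) by simp
        moreover have "B \<in> partly_derived v V P"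
          unfolding partly_derived_def using AC \<open>C \<subseteq> P\<close> by blast
        ultimately show ?thesis unfolding stellar_def by blast
      next
        case True
        define D where "D = C - {T}"
        have D: "D \<subseteq> P" "D \<in> chains V" using AC(2,3) unfolding D_def chains_def by auto
        have AT: "A \<subseteq> T" using AC(6) True by blast
        have TD: "T \<subseteq> c" if c: "c \<in> D" for c
        proof (rule ccontr)
          assume "\<not> T \<subseteq> c"
          then have "c \<subseteq> T" using AC(2) c True unfolding D_def chains_def by blast
          then show False using P(2)[of c T] D(1) c T by blast
        qed
        have "A \<union> v ` D \<in> partly_derived v V P"
          unfolding partly_derived_def using AC D unfolding D_def by blast
        moreover have "T \<union> v ` D \<in> partly_derived v V P"
          unfolding partly_derived_def using T D TD by blast
        moreover have "(A \<union> v ` D) \<union> T = T \<union> v ` D" using AT by blast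
        moreover have "\<not> T \<subseteq> A \<union> v ` D" using sub[OF D(1)] TA by simp
        moreover have "B = insert (v T) (A \<union> v ` D)" unfolding AC(1) D_def using True by blast
        ultimately have "B = insert (v T) (A \<union> v ` D) \<and> A \<union> v ` D \<in> partly_derived v V P \<and>
            \<not> T \<subseteq> A \<union> v ` D \<and> (A \<union> v ` D) \<union> T \<in> partly_derived v V P"
          by metis
        then show ?thesis unfolding stellar_def by blast
      qed
    qed
  qed
qed

text \<open>\<open>P\<close> holds the faces already treated. The order is only required to list no
  face before a strictly larger one, which keeps \<open>P\<close> closed upwards; the order among
  faces of equal dimension thus has no influence on the result.\<close>

lemma fold_stellar:
  assumes "distinct Ts" "P \<inter> set Ts = {}" "P \<union> set Ts = V - {{}}"
    "sorted_wrt (\<lambda>S T. \<not> S \<subset> T) Ts" "\<And>A B. A \<in> P \<Longrightarrow> B \<in> set Ts \<Longrightarrow> \<not> A \<subset> B"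
    "stellar_step\<^sup>*\<^sup>* V (partly_derived v V P)"
  shows "stellar_step\<^sup>*\<^sup>* V (derived_by v V) \<and>
    fold (\<lambda>T. stellar_subdivision (convex hull T) (v T)) Ts (hulls (partly_derived v V P)) =
      hulls (derived_by v V)"
  using assms
proof (induction Ts arbitrary: P)
  case Nil
  then show ?case using partly_derived_all by simp
next
  case (Cons T Ts)
  have T: "T \<in> V" "T \<noteq> {}" "T \<notin> P" using Cons.prems by auto
  have PV: "P \<subseteq> V - {{}}" using Cons.prems by blast
  have up: "B \<in> P" if "A \<in> P" "B \<in> V" "A \<subseteq> B" for A B
  proof -
    have "B \<noteq> {}" using that PV by blast
    then have "B \<in> P \<or> B \<in> set (T # Ts)" using Cons.prems(3) that by blast
    then show ?thesis using Cons.prems(5)[OF that(1), of B] that by blast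
  qed
  have above: "B \<in> P" if "B \<in> V" "T \<subset> B" for B
  proof -
    have "B \<in> P \<or> B \<in> set Ts" using Cons.prems(3) that by auto
    then show ?thesis using Cons.prems(4) that by auto
  qed
  have eq: "stellar T (v T) (partly_derived v V P) = partly_derived v V (insert T P)"
    by (rule partly_derived_step[OF PV up T above])
  have W: "geometric (partly_derived v V P)" "{} \<in> partly_derived v V P"
    using stellar_steps[OF Cons.prems(6) V] V0 by auto
  have "T \<union> v ` {} \<in> partly_derived v V P"
    unfolding partly_derived_def chains_def using T by blast
  then have TW: "T \<in> partly_derived v V P" by simp
  obtain b where "stellar_point (partly_derived v V P) T (v T) b"
    using stellar_pointI[OF W(1) TW T(2) v[OF T(1,2)]] by blast
  then interpret sp: stellar_point "partly_derived v V P" T "v T" b .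
  have hull: "stellar_subdivision (convex hull T) (v T) (hulls (partly_derived v V P)) =
      hulls (partly_derived v V (insert T P))"
    using sp.stellar_subdivision_hulls[OF W(2)] eq by simp
  have "stellar_step (partly_derived v V P) (partly_derived v V (insert T P))"
    unfolding stellar_step_def using sp.stellar_point_axioms eq by metis
  then have step: "stellar_step\<^sup>*\<^sup>* V (partly_derived v V (insert T P))"
    using Cons.prems(6) by simp
  have "stellar_step\<^sup>*\<^sup>* V (derived_by v V) \<and>
    fold (\<lambda>T. stellar_subdivision (convex hull T) (v T)) Ts
      (hulls (partly_derived v V (insert T P))) = hulls (derived_by v V)"
  proof (rule Cons.IH[OF _ _ _ _ _ step])
    show "\<not> A \<subset> B" if "A \<in> insert T P" "B \<in> set Ts" for A B
      using that Cons.prems(4,5) by auto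
  qed (use Cons.prems in auto)
  then show ?case using hull by simp
qed

lemma fold_stellar_all:
  assumes "distinct Ts" "set Ts = V - {{}}" "sorted_wrt (\<lambda>S T. \<not> S \<subset> T) Ts"
  shows "stellar_step\<^sup>*\<^sup>* V (derived_by v V)"
    "fold (\<lambda>T. stellar_subdivision (convex hull T) (v T)) Ts (hulls V) = hulls (derived_by v V)"
  using fold_stellar[of Ts "{}"] assms partly_derived_empty by auto

lemma derived_by_iso: "set_iso (derived_by v V) (chains V)"
proof (rule set_iso_sym)
  have C: "C \<subseteq> V - {{}}" if "C \<in> chains V" for C using that by (simp add: chains_def)
  have "C \<subseteq> D \<longleftrightarrow> v ` C \<subseteq> v ` D" if "C \<in> chains V" "D \<in> chains V" for C D
    using inj_on_image_subset_iff[OF v_inj C[OF that(1)] C[OF that(2)]] by simp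
  moreover have "inj_on ((`) v) (chains V)"
    by (rule inj_on_subset[OF inj_on_image_Pow[OF v_inj]]) (use C in blast)
  ultimately show "set_iso (chains V) (derived_by v V)"
    unfolding set_iso_def derived_by_def by (intro exI[of _ "(`) v"]) (simp add: bij_betw_def)
qed

end

text \<open>With a derived subdivision presented as a sequence of stellar steps, whatever a single
  step preserves (the underlying set, refinement, the existence of locally convex heights) passes to
  derived subdivisions by induction.\<close>

lemma derived_steps:
  assumes V: "geometric V" "{} \<in> V" and d: "derived V W"
  shows "stellar_step\<^sup>*\<^sup>* V W"
proof -
  obtain v where v: "\<And>A. A \<in> V \<Longrightarrow> A \<noteq> {} \<Longrightarrow> v A \<in> rel_interior (convex hull A)"
    and W: "W = derived_by v V"
    using d unfolding derived_def by blast
  interpret derived_points V v using V v by unfold_locales auto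
  have fin: "finite (V - {{}})" "\<And>A. A \<in> V \<Longrightarrow> finite A" using V(1) by (auto simp: geometric_def)
  obtain xs where xs: "distinct xs" "set xs = V - {{}}"
    using finite_distinct_list[OF fin(1)] by blast
  define Ts where "Ts = rev (sort_key card xs)"
  have "sorted_wrt (\<lambda>S T. card S \<ge> card T) Ts"
    unfolding Ts_def sorted_wrt_rev using sorted_sort_key[of card xs] by (simp add: sorted_map)
  moreover have Ts: "distinct Ts" "set Ts = V - {{}}" using xs by (simp_all add: Ts_def)
  ultimately have "sorted_wrt (\<lambda>S T. \<not> S \<subset> T) Ts"
    by (elim sorted_wrt_mono_rel[rotated]) (use fin psubset_card_mono in \<open>metis DiffD1 leD\<close>)
  then show ?thesis using fold_stellar_all(1)[OF Ts] W by simp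
qed

lemma derived_props:
  assumes "geometric V" "{} \<in> V" "derived V W"
  shows "geometric W" "{} \<in> W" "body W = body V" "refines W V"
  using stellar_steps[OF derived_steps[OF assms] assms(1)] assms(2) by auto

lemma derived_iter_steps:
  assumes "(derived ^^ k) V W" "geometric V" "{} \<in> V"
  shows "stellar_step\<^sup>*\<^sup>* V W"
  using assms
proof (induction k arbitrary: W)
  case (Suc k)
  then obtain U where U: "(derived ^^ k) V U" "derived U W" by auto
  then have s: "stellar_step\<^sup>*\<^sup>* V U" using Suc by blast
  have "geometric U" "{} \<in> U" using stellar_steps[OF s] Suc.prems by auto
  then show ?case using derived_steps U(2) s by (meson rtranclp_trans)
qed auto

text \<open>For a simplex \<open>aff_dim\<close> is the number of vertices minus one, so a listing
  by decreasing dimension has no face before a strictly larger one. Every admissible listing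
  therefore ends in the same complex of chains.\<close>

lemma derived_subdivision_hulls:
  fixes V :: "'a::euclidean_space set set"
  assumes V: "geometric V" "{} \<in> V" and d: "derived_subdivision (hulls V) \<Delta>'"
  shows "\<exists>W. derived V W \<and> \<Delta>' = hulls W"
proof -
  obtain \<tau>s v where t: "distinct \<tau>s" "set \<tau>s = hulls V - {{}}"
    "sorted_wrt (\<lambda>\<sigma> \<tau>. aff_dim \<sigma> \<ge> aff_dim \<tau>) \<tau>s" "\<forall>\<tau>\<in>set \<tau>s. v \<tau> \<in> rel_interior \<tau>"
    "\<Delta>' = fold (\<lambda>\<tau>. stellar_subdivision \<tau> (v \<tau>)) \<tau>s (hulls V)"
    using d unfolding derived_subdivision_def by blast
  define h where "h = ((hull) convex :: 'a set \<Rightarrow> 'a set)"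
  have inj: "inj_on h V" unfolding h_def by (rule geometric_hull_inj[OF V(1)])
  have him: "h ` (V - {{}}) = set \<tau>s" unfolding t(2) hulls_def h_def by auto
  define w where "w A = v (convex hull A)" for A
  have w: "w A \<in> rel_interior (convex hull A)" if "A \<in> V" "A \<noteq> {}" for A
    using t(4) him that unfolding w_def h_def by blast
  interpret derived_points V w using V w by unfold_locales auto
  define g where "g = the_inv_into V h"
  define Ts where "Ts = map g \<tau>s"
  have g: "g \<tau> \<in> V" "h (g \<tau>) = \<tau>" if "\<tau> \<in> set \<tau>s" for \<tau>
    using that him inj unfolding g_def
    by (auto intro!: the_inv_into_into f_the_inv_into_f)
  have gh: "g (h A) = A" if "A \<in> V" for A using that inj by (simp add: g_def the_inv_into_f_f)
  have sTs: "set Ts = V - {{}}"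
  proof -
    have "set Ts = g ` h ` (V - {{}})" unfolding Ts_def him by simp
    also have "\<dots> = V - {{}}" using gh by (force simp: image_image)
    finally show ?thesis .
  qed
  have dTs: "distinct Ts"
    unfolding Ts_def distinct_map using t(1) g(2) by (metis inj_onI)
  have aff: "aff_dim (h A) = int (card A) - 1" if "A \<in> V" for A
    using aff_dim_affine_independent[OF geometric_affine_independent[OF V(1) that]]
    by (simp add: h_def aff_dim_convex_hull)
  have "\<not> g \<sigma> \<subset> g \<tau>" if st: "\<sigma> \<in> set \<tau>s" "\<tau> \<in> set \<tau>s" "aff_dim \<sigma> \<ge> aff_dim \<tau>" for \<sigma> \<tau>
  proof
    assume "g \<sigma> \<subset> g \<tau>"
    then have "card (g \<sigma>) < card (g \<tau>)"
      using geometric_finite[OF V(1)] g(1)[OF st(2)] psubset_card_mono by blast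
    moreover have "aff_dim \<sigma> = int (card (g \<sigma>)) - 1" "aff_dim \<tau> = int (card (g \<tau>)) - 1"
      using aff[OF g(1)[OF st(1)]] aff[OF g(1)[OF st(2)]] g(2) st by auto
    ultimately show False using st(3) by simp
  qed
  then have sorted: "sorted_wrt (\<lambda>S T. \<not> S \<subset> T) Ts"
    unfolding Ts_def sorted_wrt_map by (rule sorted_wrt_mono_rel[OF _ t(3)])
  have "fold (\<lambda>T. stellar_subdivision (convex hull T) (w T)) Ts K =
      fold (\<lambda>\<tau>. stellar_subdivision \<tau> (v \<tau>)) \<tau>s K" for K
    unfolding Ts_def fold_map using g(2) by (intro fold_cong) (auto simp: w_def h_def)
  then have "\<Delta>' = hulls (derived_by w V)"
    using fold_stellar_all(2)[OF dTs sTs sorted] t(5) by simp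
  then show ?thesis unfolding derived_def using w by blast
qed

lemma derived_subdivision_iter_hulls:
  fixes V :: "'a::euclidean_space set set"
  assumes "geometric V" "{} \<in> V" "(derived_subdivision ^^ k) (hulls V) \<Delta>'"
  shows "\<exists>W. (derived ^^ k) V W \<and> \<Delta>' = hulls W"
  using assms
proof (induction k arbitrary: \<Delta>')
  case (Suc k)
  then obtain \<Delta>1 where D: "(derived_subdivision ^^ k) (hulls V) \<Delta>1" "derived_subdivision \<Delta>1 \<Delta>'"
    by auto
  then obtain U where U: "(derived ^^ k) V U" "\<Delta>1 = hulls U" using Suc by blast
  have "geometric U" "{} \<in> U"
    using stellar_steps[OF derived_iter_steps[OF U(1) Suc.prems(1,2)]] Suc.prems by auto
  then obtain W where "derived U W" "\<Delta>' = hulls W"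
    using derived_subdivision_hulls D(2) U(2) by blast
  then show ?case using U(1) by auto
qed auto

section \<open>Invariance of iterated derived subdivisions under isomorphism of face posets\<close>

lemma chains_iso:
  assumes iso: "set_iso V W" and V0: "{} \<in> V" and W0: "{} \<in> W"
  shows "set_iso (chains V) (chains W)"
proof -
  obtain f where f: "bij_betw f V W" "\<forall>A\<in>V. \<forall>B\<in>V. A \<subseteq> B \<longleftrightarrow> f A \<subseteq> f B"
    using iso unfolding set_iso_def by blast
  have inj: "inj_on f V" and im: "f ` V = W" using f(1) by (auto simp: bij_betw_def)
  obtain A0 where A0: "A0 \<in> V" "f A0 = {}" using W0 im by blast
  then have "f {} \<subseteq> {}" using f(2) V0 by (metis empty_subsetI)
  then have f0: "f {} = {}" by simp
  have im0: "f ` (V - {{}}) = W - {{}}"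
    using inj im V0 f0 by (simp add: inj_on_image_set_diff[OF inj])
  have ch: "C \<in> chains V \<longleftrightarrow> f ` C \<in> chains W" if "C \<subseteq> V - {{}}" for C
  proof -
    have "f ` C \<subseteq> W - {{}}" using that im0 by blast
    then show ?thesis unfolding chains_def using that f(2) by (auto simp: subset_iff)
  qed
  have C: "C \<subseteq> V - {{}}" if "C \<in> chains V" for C using that by (simp add: chains_def)
  have inj0: "inj_on f (V - {{}})" using inj inj_on_subset by blast
  have "inj_on ((`) f) (chains V)"
    by (rule inj_on_subset[OF inj_on_image_Pow[OF inj0]]) (use C in blast)
  moreover have "(`) f ` chains V = chains W"
  proof
    show "(`) f ` chains V \<subseteq> chains W" using ch C by blast
    show "chains W \<subseteq> (`) f ` chains V"
    proof
      fix D assume D: "D \<in> chains W"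
      then have "D \<subseteq> f ` (V - {{}})" unfolding im0 by (simp add: chains_def)
      then obtain C where "C \<subseteq> V - {{}}" "D = f ` C" by (auto simp: subset_image_iff)
      then show "D \<in> (`) f ` chains V" using ch D by blast
    qed
  qed
  moreover have "C \<subseteq> D \<longleftrightarrow> f ` C \<subseteq> f ` D" if "C \<in> chains V" "D \<in> chains V" for C D
    using inj_on_image_subset_iff[OF inj0 C[OF that(1)] C[OF that(2)]] by simp
  ultimately show ?thesis unfolding set_iso_def by (intro exI[of _ "(`) f"]) (simp add: bij_betw_def)
qed

lemma derived_iso_chains:
  assumes V: "geometric V" "{} \<in> V" and d: "derived V W"
  shows "set_iso W (chains V)"
proof -
  obtain v where v: "\<And>A. A \<in> V \<Longrightarrow> A \<noteq> {} \<Longrightarrow> v A \<in> rel_interior (convex hull A)"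
    and W: "W = derived_by v V"
    using d unfolding derived_def by blast
  interpret derived_points V v using V v by unfold_locales auto
  show ?thesis using derived_by_iso W by simp
qed

text \<open>A derived subdivision is isomorphic to the order complex of the face poset, and
  isomorphic posets have isomorphic order complexes. For \<open>V = W\<close> this is independence
  of the chosen points.\<close>

lemma derived_iter_set_iso:
  assumes "geometric V" "{} \<in> V" "geometric W" "{} \<in> W" "set_iso V W"
    "(derived ^^ k) V V'" "(derived ^^ k) W W'"
  shows "set_iso V' W'"
  using assms(6,7)
proof (induction k arbitrary: V' W')
  case 0
  then show ?case using assms(5) by simp
next
  case (Suc k)
  obtain V1 where V1: "(derived ^^ k) V V1" "derived V1 V'" using Suc.prems(1) by auto
  obtain W1 where W1: "(derived ^^ k) W W1" "derived W1 W'" using Suc.prems(2) by auto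
  have gV: "geometric V1" "{} \<in> V1"
    using stellar_steps[OF derived_iter_steps[OF V1(1) assms(1,2)]] assms by auto
  have gW: "geometric W1" "{} \<in> W1"
    using stellar_steps[OF derived_iter_steps[OF W1(1) assms(3,4)]] assms by auto
  have "set_iso (chains V1) (chains W1)"
    using chains_iso[OF Suc.IH[OF V1(1) W1(1)]] gV gW by blast
  then show ?case
    using derived_iso_chains[OF gV V1(2)] derived_iso_chains[OF gW W1(2)]
      set_iso_sym set_iso_trans by meson
qed

subsection \<open>Derived subdivisions refine hyperplane arrangements\<close>

text \<open>The pair \<open>(a, b)\<close> stands for the hyperplane
  \<open>a \<bullet> u = b\<close>. The sides are closed, so points on the hyperplane are
  allowed.\<close>

definition one_sided :: "'a::real_inner \<times> real \<Rightarrow> 'a set \<Rightarrow> bool" where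
  "one_sided h A \<longleftrightarrow> (\<forall>u\<in>A. fst h \<bullet> u \<le> snd h) \<or> (\<forall>u\<in>A. fst h \<bullet> u \<ge> snd h)"

lemma one_sided_hull:
  assumes "one_sided h A" "B \<subseteq> convex hull A"
  shows "one_sided h B"
proof -
  consider "A \<subseteq> {u. fst h \<bullet> u \<le> snd h}" | "A \<subseteq> {u. fst h \<bullet> u \<ge> snd h}"
    using assms(1) unfolding one_sided_def by blast
  then show ?thesis
  proof cases
    case 1
    then have "convex hull A \<subseteq> {u. fst h \<bullet> u \<le> snd h}"
      by (intro hull_minimal convex_halfspace_le)
    then show ?thesis unfolding one_sided_def using assms(2) by blast
  next
    case 2
    then have "convex hull A \<subseteq> {u. fst h \<bullet> u \<ge> snd h}"
      by (intro hull_minimal convex_halfspace_ge)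
    then show ?thesis unfolding one_sided_def using assms(2) by blast
  qed
qed

text \<open>If a vertex lies strictly on the other side of the hyperplane than a relative interior
  point \<open>p\<close>, the segment from \<open>p\<close> to it crosses the hyperplane before the
  vertex is reached, and its points other than the vertex are relative interior. If there is no such
  vertex, \<open>p\<close> itself will do.\<close>

lemma rel_interior_point_near_hyperplane:
  fixes A :: "'a::euclidean_space set"
  assumes "A \<noteq> {}"
  obtains x where "x \<in> rel_interior (convex hull A)"
    "a \<bullet> x = b \<or> (a \<bullet> x < b \<and> (\<forall>u\<in>A. a \<bullet> u \<le> b)) \<or> (a \<bullet> x > b \<and> (\<forall>u\<in>A. a \<bullet> u \<ge> b))"
proof -
  obtain p where p: "p \<in> rel_interior (convex hull A)"
    using assms by (metis convex_convex_hull equals0I hull_inc rel_interior_eq_empty empty_iff convex_hull_eq_empty)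
  have cross: "\<exists>x\<in>rel_interior (convex hull A). a \<bullet> x = b"
    if u: "u \<in> A" and t: "0 < (a \<bullet> p - b) / (a \<bullet> p - a \<bullet> u)" "(a \<bullet> p - b) / (a \<bullet> p - a \<bullet> u) < 1" for u
  proof -
    \<comment> \<open>The parameter, measured from \<open>u\<close> towards \<open>p\<close>, at
      which the segment takes the value \<open>b\<close>.\<close>
    define s where "s = 1 - (a \<bullet> p - b) / (a \<bullet> p - a \<bullet> u)"
    have s: "0 < s" "s \<le> 1" using t by (auto simp: s_def)
    have ne: "a \<bullet> p - a \<bullet> u \<noteq> 0" using t by auto
    have "u - s *\<^sub>R (u - p) \<in> rel_interior (convex hull A)"
      by (rule rel_interior_convex_shrink[OF _ p _ s]) (use u hull_inc in auto)
    moreover have "a \<bullet> (u - s *\<^sub>R (u - p)) = a \<bullet> u + s * (a \<bullet> p - a \<bullet> u)"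
      by (simp add: inner_diff_right algebra_simps)
    moreover have "s * (a \<bullet> p - a \<bullet> u) = b - a \<bullet> u" using ne unfolding s_def by (simp add: field_simps)
    ultimately show ?thesis by force
  qed
  consider "a \<bullet> p = b" | "a \<bullet> p < b" "\<forall>u\<in>A. a \<bullet> u \<le> b" | "a \<bullet> p > b" "\<forall>u\<in>A. a \<bullet> u \<ge> b"
    | u where "u \<in> A" "a \<bullet> p < b" "a \<bullet> u > b" | u where "u \<in> A" "a \<bullet> p > b" "a \<bullet> u < b"
    by fastforce
  then show thesis
  proof cases
    case 4
    have "0 < (a \<bullet> p - b) / (a \<bullet> p - a \<bullet> u)" "(a \<bullet> p - b) / (a \<bullet> p - a \<bullet> u) < 1"
      using 4 by (auto simp: divide_simps)
    then show thesis using cross 4(1) that by blast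
  next
    case 5
    have "0 < (a \<bullet> p - b) / (a \<bullet> p - a \<bullet> u)" "(a \<bullet> p - b) / (a \<bullet> p - a \<bullet> u) < 1"
      using 5 by (auto simp: divide_simps)
    then show thesis using cross 5(1) that by blast
  qed (use p that in blast)+
qed

text \<open>
  Whenever possible, the subdividing point of a face is put on the hyperplane. For two faces whose
  points lie strictly on different sides, the larger one would lie on a single side.
\<close>

lemma derived_one_sided:
  fixes V :: "'a::euclidean_space set set"
  assumes V: "geometric V"
  obtains W where "derived V W" "\<And>A. A \<in> W \<Longrightarrow> one_sided h A"
proof -
  obtain a b where h: "h = (a, b)" by fastforce
  define good where "good A x \<longleftrightarrow> x \<in> rel_interior (convex hull A) \<and>
    (a \<bullet> x = b \<or> (a \<bullet> x < b \<and> (\<forall>u\<in>A. a \<bullet> u \<le> b)) \<or> (a \<bullet> x > b \<and> (\<forall>u\<in>A. a \<bullet> u \<ge> b)))" for A x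
  define v where "v A = (SOME x. good A x)" for A
  have v: "good A (v A)" if "A \<noteq> {}" for A
  proof -
    have "\<exists>x. good A x"
      unfolding good_def using rel_interior_point_near_hyperplane[OF that, of a b] by metis
    then show ?thesis unfolding v_def by (rule someI_ex)
  qed
  have d: "derived V (derived_by v V)" unfolding derived_def using v good_def by blast
  have sided: "one_sided h S" if S: "S \<in> derived_by v V" for S
  proof (rule ccontr)
    assume "\<not> one_sided h S"
    obtain C where C: "S = v ` C" "C \<in> chains V" using S unfolding derived_by_def by blast
    obtain A B where AB: "A \<in> C" "B \<in> C" "a \<bullet> v A < b" "a \<bullet> v B > b"
      using \<open>\<not> one_sided h S\<close> unfolding one_sided_def C h by (auto simp: not_le)
    have ne: "A \<noteq> {}" "B \<noteq> {}" and ch: "A \<subseteq> B \<or> B \<subseteq> A" using C(2) AB unfolding chains_def by auto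
    have A: "v A \<in> convex hull A" "A \<subseteq> {u. a \<bullet> u \<le> b}"
      using v[OF ne(1)] AB(3) rel_interior_subset unfolding good_def by auto
    have B: "v B \<in> convex hull B" "B \<subseteq> {u. a \<bullet> u \<ge> b}"
      using v[OF ne(2)] AB(4) rel_interior_subset unfolding good_def by auto
    from ch show False
    proof
      assume "A \<subseteq> B"
      then have "convex hull A \<subseteq> {u. a \<bullet> u \<ge> b}"
        using B(2) by (intro hull_minimal convex_halfspace_ge) auto
      then show False using A(1) AB(3) by force
    next
      assume "B \<subseteq> A"
      then have "convex hull B \<subseteq> {u. a \<bullet> u \<le> b}"
        using A(2) by (intro hull_minimal convex_halfspace_le) auto
      then show False using B(1) AB(4) by force
    qed
  qed
  show thesis using that[OF d sided] .
qed

lemma derived_iter_props: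
  assumes "(derived ^^ k) V W" "geometric V" "{} \<in> V"
  shows "geometric W" "{} \<in> W" "body W = body V" "refines W V"
  using stellar_steps[OF derived_iter_steps[OF assms] assms(2)] assms(3) by auto

text \<open>One derived subdivision per hyperplane is enough: each later simplex lies inside an
  earlier one and inherits its one-sidedness.\<close>

lemma derived_iter_arrangement:
  fixes V :: "'a::euclidean_space set set"
  assumes V: "geometric V" "{} \<in> V" and H: "finite H"
  obtains k W where "(derived ^^ k) V W" "\<And>A h. A \<in> W \<Longrightarrow> h \<in> H \<Longrightarrow> one_sided h A"
proof -
  have "\<exists>k W. (derived ^^ k) V W \<and> (\<forall>A\<in>W. \<forall>h\<in>H. one_sided h A)"
    using H
  proof (induction H)
    case empty
    have "(derived ^^ 0) V V" by simp
    then show ?case by blast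
  next
    case (insert h H)
    then obtain k W where W: "(derived ^^ k) V W" "\<forall>A\<in>W. \<forall>h\<in>H. one_sided h A" by blast
    note gW = derived_iter_props[OF W(1) V]
    obtain U where U: "derived W U" "\<And>A. A \<in> U \<Longrightarrow> one_sided h A"
      using derived_one_sided[OF gW(1)] by blast
    have "(derived ^^ Suc k) V U" using W(1) U(1) by auto
    moreover have "one_sided h' A" if A: "A \<in> U" and h': "h' \<in> H" for A h'
    proof -
      obtain B where B: "B \<in> W" "convex hull A \<subseteq> convex hull B"
        using derived_props(4)[OF gW(1,2) U(1)] A unfolding refines_def by blast
      have "A \<subseteq> convex hull B" by (rule order_trans[OF hull_subset B(2)])
      then show ?thesis using one_sided_hull W(2) B(1) h' by blast
    qed
    ultimately show ?case using U(2) by blast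
  qed
  then show thesis using that by blast
qed

text \<open>
  If all simplices of \<open>W\<close> lie on one side of each hyperplane bounding one of the polytopes \<open>\<sigma>\<close>,
  then a simplex whose relative interior meets \<open>\<sigma>\<close> lies in \<open>\<sigma>\<close>.
\<close>

lemma derived_iter_refines:
  fixes V :: "'a::euclidean_space set set"
  assumes V: "geometric V" "{} \<in> V"
    and K: "finite K" "\<And>\<sigma>. \<sigma> \<in> K \<Longrightarrow> polytope \<sigma>" "\<Union>K = body V" "K \<noteq> {}"
  obtains k W where "(derived ^^ k) V W" "\<forall>A\<in>W. \<exists>\<sigma>\<in>K. convex hull A \<subseteq> \<sigma>"
proof -
  have "\<forall>\<sigma>\<in>K. \<exists>F. finite F \<and> \<sigma> = {x. \<forall>h\<in>F. fst h \<bullet> x \<le> snd h}"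
  proof
    fix \<sigma> assume \<sigma>: "\<sigma> \<in> K"
    obtain F where F: "finite F" "\<sigma> = \<Inter> F" "\<forall>h\<in>F. \<exists>a b. a \<noteq> 0 \<and> h = {x. a \<bullet> x \<le> b}"
      using polytope_imp_polyhedron[OF K(2)[OF \<sigma>]] unfolding polyhedron_def by blast
    have "\<forall>h\<in>F. \<exists>p. h = {x. fst p \<bullet> x \<le> snd p}"
    proof
      fix h assume "h \<in> F"
      then obtain a b where "h = {x. a \<bullet> x \<le> b}" using F(3) by blast
      then show "\<exists>p. h = {x. fst p \<bullet> x \<le> snd p}" by (intro exI[of _ "(a, b)"]) simp
    qed
    then obtain g where g: "\<forall>h\<in>F. h = {x. fst (g h) \<bullet> x \<le> snd (g h)}" by metis
    have "\<sigma> = {x. \<forall>p\<in>g ` F. fst p \<bullet> x \<le> snd p}" unfolding F(2) using g by auto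
    then show "\<exists>F. finite F \<and> \<sigma> = {x. \<forall>h\<in>F. fst h \<bullet> x \<le> snd h}"
      using F(1) by (intro exI[of _ "g ` F"]) simp
  qed
  from bchoice[OF this] obtain F where
    F': "\<forall>\<sigma>\<in>K. finite (F \<sigma>) \<and> \<sigma> = {x. \<forall>h\<in>F \<sigma>. fst h \<bullet> x \<le> snd h}" by blast
  have F: "finite (F \<sigma>)" "\<sigma> = {x. \<forall>h\<in>F \<sigma>. fst h \<bullet> x \<le> snd h}" if "\<sigma> \<in> K" for \<sigma>
    using F' that by blast+
  obtain k W where W: "(derived ^^ k) V W" "\<And>A h. A \<in> W \<Longrightarrow> h \<in> (\<Union>\<sigma>\<in>K. F \<sigma>) \<Longrightarrow> one_sided h A"
    using derived_iter_arrangement[OF V, of "\<Union>\<sigma>\<in>K. F \<sigma>"] F(1) K(1) by blast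
  note gW = derived_iter_props[OF W(1) V]
  have "\<exists>\<sigma>\<in>K. convex hull A \<subseteq> \<sigma>" if A: "A \<in> W" for A
  proof (cases "A = {}")
    case True
    then show ?thesis using K(4) by auto
  next
    case False
    then obtain x where x: "x \<in> rel_interior (convex hull A)"
      by (metis convex_convex_hull equals0I rel_interior_eq_empty convex_hull_eq_empty)
    obtain l where l: "l \<in> weights A" "\<And>u. u \<in> A \<Longrightarrow> 0 < l u" "bary l = x"
      using rel_interior_hull_weights[OF gW(1) A x] by blast
    have finA: "finite A" using gW(1) A geometric_finite by blast
    have lsum: "sum l A = 1" using l by (simp add: weights_def)
    have "x \<in> body W" unfolding body_eq using A x rel_interior_subset by blast
    then obtain \<sigma> where \<sigma>: "\<sigma> \<in> K" "x \<in> \<sigma>" using gW(3) K(3) by blast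
    have "A \<subseteq> \<sigma>"
    proof
      fix u assume u: "u \<in> A"
      have "fst h \<bullet> u \<le> snd h" if h: "h \<in> F \<sigma>" for h
      proof (rule ccontr)
        assume neg: "\<not> fst h \<bullet> u \<le> snd h"
        \<comment> \<open>One violated inequality forces all of \<open>A\<close> onto the wrong
          closed side. As \<open>x\<close> has positive weight at every vertex, it would violate the
          inequality strictly.\<close>
        then have ge: "\<forall>w\<in>A. fst h \<bullet> w \<ge> snd h"
          using W(2)[OF A, of h] h \<sigma>(1) u unfolding one_sided_def by blast
        have "fst h \<bullet> x = (\<Sum>w\<in>A. l w * (fst h \<bullet> w))"
          unfolding l(3)[symmetric] bary_weights[OF finA l(1)] by (simp add: inner_sum_right)
        also have "\<dots> > (\<Sum>w\<in>A. l w * snd h)"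
          using neg u ge l(2) by (intro sum_strict_mono_ex1[OF finA])
            (auto intro!: bexI[of _ u] simp: mult_left_mono less_imp_le)
        also have "(\<Sum>w\<in>A. l w * snd h) = snd h" using lsum by (simp flip: sum_distrib_right)
        finally show False using F(2)[OF \<sigma>(1)] \<sigma>(2) h by force
      qed
      then show "u \<in> \<sigma>" using F(2)[OF \<sigma>(1)] by blast
    qed
    moreover have "convex \<sigma>" using K(2)[OF \<sigma>(1)] polytope_imp_convex by blast
    ultimately show ?thesis using \<sigma>(1) hull_minimal by metis
  qed
  then show thesis using that W(1) by blast
qed

subsection \<open>Transport along a piecewise linear homeomorphism\<close>

text \<open>The inverse is taken on a set \<open>D\<close> that may be larger than one simplex, so
  that weights pushed from different simplices are given by one formula and can be compared.\<close>

definition push_weights :: "'a set \<Rightarrow> ('a \<Rightarrow> 'b) \<Rightarrow> ('a \<Rightarrow> real) \<Rightarrow> 'b \<Rightarrow> real" where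
  "push_weights D f l y = (if y \<in> f ` D then l (the_inv_into D f y) else 0)"

definition pull_weights :: "'a set \<Rightarrow> ('a \<Rightarrow> 'b) \<Rightarrow> ('b \<Rightarrow> real) \<Rightarrow> 'a \<Rightarrow> real" where
  "pull_weights A f m u = (if u \<in> A then m (f u) else 0)"

lemma push_weights_apply: "inj_on f D \<Longrightarrow> w \<in> D \<Longrightarrow> push_weights D f l (f w) = l w"
  by (simp add: push_weights_def the_inv_into_f_f)

lemma push_weights:
  fixes f :: "'a \<Rightarrow> 'b::real_vector"
  assumes inj: "inj_on f D" and A: "A \<subseteq> D" "finite A" and l: "l \<in> weights A"
  shows "push_weights D f l \<in> weights (f ` A)" "bary (push_weights D f l) = (\<Sum>w\<in>A. l w *\<^sub>R f w)"
proof -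
  have injA: "inj_on f A" using inj A(1) by (rule inj_on_subset)
  have app: "push_weights D f l (f w) = l w" if "w \<in> D" for w
    using push_weights_apply[OF inj that] .
  have zero: "push_weights D f l y = 0" if "y \<notin> f ` A" for y
  proof (cases "y \<in> f ` D")
    case True
    then obtain w where "w \<in> D" "y = f w" by blast
    then show ?thesis using app that l by (auto simp: weights_def)
  qed (simp add: push_weights_def)
  have "0 \<le> push_weights D f l y" for y using l by (simp add: push_weights_def weights_def)
  moreover have "sum (push_weights D f l) (f ` A) = sum l A"
    using injA A app by (auto simp: sum.reindex intro!: sum.cong)
  ultimately show m: "push_weights D f l \<in> weights (f ` A)"
    using zero l by (simp add: weights_def)
  show "bary (push_weights D f l) = (\<Sum>w\<in>A. l w *\<^sub>R f w)"
    using bary_weights[OF _ m] A injA app by (auto simp: sum.reindex intro!: sum.cong)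
qed

lemma pull_weights:
  fixes f :: "'a \<Rightarrow> 'b::real_vector"
  assumes inj: "inj_on f A" and A: "finite A" and m: "m \<in> weights (f ` A)"
  shows "pull_weights A f m \<in> weights A" "bary m = (\<Sum>u\<in>A. pull_weights A f m u *\<^sub>R f u)"
proof -
  have "sum (pull_weights A f m) A = sum m (f ` A)"
    using inj by (simp add: sum.reindex pull_weights_def)
  then show "pull_weights A f m \<in> weights A"
    using m by (simp add: weights_def pull_weights_def)
  show "bary m = (\<Sum>u\<in>A. pull_weights A f m u *\<^sub>R f u)"
    using bary_weights[OF _ m] A inj by (simp add: sum.reindex pull_weights_def)
qed

lemma sum_scaleR_swap:
  fixes f :: "'a \<Rightarrow> 'c::real_vector"
  shows "(\<Sum>w\<in>A. (\<Sum>u\<in>B. m u * L u w) *\<^sub>R f w) = (\<Sum>u\<in>B. m u *\<^sub>R (\<Sum>w\<in>A. L u w *\<^sub>R f w))"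
  unfolding scaleR_sum_left scaleR_sum_right scaleR_scaleR by (rule sum.swap)



section \<open>Linear extensions of vertex maps\<close>

definition coords :: "'a::real_vector set set \<Rightarrow> 'a \<Rightarrow> 'a \<Rightarrow> real" where
  "coords V x = the_inv_into (\<Union>A\<in>V. weights A) bary x"

definition simplicial_map :: "'a::real_vector set set \<Rightarrow> ('a \<Rightarrow> 'b::real_vector) \<Rightarrow> 'a \<Rightarrow> 'b" where
  "simplicial_map V \<phi> x = (\<Sum>w\<in>\<Union>V. coords V x w *\<^sub>R \<phi> w)"

lemma coords_bary: "geometric V \<Longrightarrow> A \<in> V \<Longrightarrow> l \<in> weights A \<Longrightarrow> coords V (bary l) = l"
  unfolding coords_def geometric_def by (blast intro: the_inv_into_f_f)

lemma simplicial_map_bary: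
  assumes V: "geometric V" "A \<in> V" and l: "l \<in> weights A"
  shows "simplicial_map V \<phi> (bary l) = (\<Sum>w\<in>A. l w *\<^sub>R \<phi> w)"
proof -
  have "finite (\<Union>V)" using V(1) by (auto simp: geometric_def)
  then show ?thesis
    unfolding simplicial_map_def coords_bary[OF V l]
    using V(2) l by (intro sum.mono_neutral_right) (auto simp: weights_def)
qed

text \<open>As \<open>B\<close> lies in a single simplex, the coordinates \<open>L u\<close> of its
  points are weights on one set \<open>A\<close>. Their combination with coefficients
  \<open>m\<close> is again a weight function on \<open>A\<close>, and by uniqueness it is the
  coordinate function of \<open>bary m\<close>.\<close>

lemma simplicial_map_affine:
  assumes V: "geometric V" "A \<in> V" and B: "finite B" "B \<subseteq> convex hull A" and m: "m \<in> weights B"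
  shows "simplicial_map V \<phi> (bary m) = (\<Sum>u\<in>B. m u *\<^sub>R simplicial_map V \<phi> u)"
proof -
  have finA: "finite A" using V geometric_finite by blast
  have "\<forall>u\<in>B. \<exists>l\<in>weights A. u = bary l" using B(2) convex_hull_weights[OF finA] by blast
  then obtain L where L: "\<And>u. u \<in> B \<Longrightarrow> L u \<in> weights A" "\<And>u. u \<in> B \<Longrightarrow> u = bary (L u)" by metis
  define l where "l w = (\<Sum>u\<in>B. m u * L u w)" for w
  have m0: "\<And>u. 0 \<le> m u" and msum: "sum m B = 1" using m by (auto simp: weights_def)
  have L0: "\<And>u w. u \<in> B \<Longrightarrow> 0 \<le> L u w" "\<And>u w. u \<in> B \<Longrightarrow> w \<notin> A \<Longrightarrow> L u w = 0"
    and Lsum: "\<And>u. u \<in> B \<Longrightarrow> sum (L u) A = 1"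
    using L(1) by (auto simp: weights_def)
  have "sum l A = (\<Sum>u\<in>B. \<Sum>w\<in>A. m u * L u w)" unfolding l_def by (rule sum.swap)
  also have "\<dots> = (\<Sum>u\<in>B. m u)" using Lsum by (intro sum.cong) (auto simp flip: sum_distrib_left)
  finally have "sum l A = 1" using msum by simp
  then have l: "l \<in> weights A"
    unfolding weights_def using m0 L0 by (auto simp: l_def intro!: sum_nonneg sum.neutral)
  have "u = (\<Sum>w\<in>A. L u w *\<^sub>R w)" if "u \<in> B" for u
    using L[OF that] bary_weights[OF finA] by metis
  then have "bary m = bary l"
    unfolding bary_weights[OF B(1) m] bary_weights[OF finA l] unfolding l_def sum_scaleR_swap
    by (intro sum.cong) auto
  moreover have "simplicial_map V \<phi> u = (\<Sum>w\<in>A. L u w *\<^sub>R \<phi> w)" if "u \<in> B" for u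
    using simplicial_map_bary[OF V L(1)[OF that]] L(2)[OF that] by metis
  then have "simplicial_map V \<phi> (bary l) = (\<Sum>u\<in>B. m u *\<^sub>R simplicial_map V \<phi> u)"
    unfolding simplicial_map_bary[OF V l] unfolding l_def sum_scaleR_swap
    by (intro sum.cong) auto
  ultimately show ?thesis by simp
qed

text \<open>On coordinates the map merely renames vertices, so injectivity follows from uniqueness
  of coordinates in the image complex.\<close>

lemma simplicial_map_bij:
  assumes V: "geometric V" and inj: "inj_on \<phi> (\<Union>V)" and W: "geometric ((`) \<phi> ` V)"
  shows "bij_betw (simplicial_map V \<phi>) (body V) (body ((`) \<phi> ` V))"
proof -
  have fin: "finite A" if "A \<in> V" for A using V that geometric_finite by blast
  have sub: "A \<subseteq> \<Union>V" if "A \<in> V" for A using that by blast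
  have injA: "inj_on \<phi> A" if "A \<in> V" for A using inj sub[OF that] by (rule inj_on_subset)
  have coord: "\<exists>A\<in>V. \<exists>l\<in>weights A. x = bary l" if x: "x \<in> body V" for x
  proof -
    obtain A where "A \<in> V" "x \<in> convex hull A" using x unfolding body_eq by blast
    then show ?thesis using convex_hull_weights[OF fin] by blast
  qed
  have img: "simplicial_map V \<phi> (bary l) = bary (push_weights (\<Union>V) \<phi> l)"
    "push_weights (\<Union>V) \<phi> l \<in> weights (\<phi> ` A)"
    if A: "A \<in> V" "l \<in> weights A" for A l
    using simplicial_map_bary[OF V A] push_weights[OF inj sub fin, OF A(1) A(1) A(2)] by auto
  show ?thesis unfolding bij_betw_def
  proof
    show "inj_on (simplicial_map V \<phi>) (body V)"
    proof (rule inj_onI)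
      fix x y assume x: "x \<in> body V" and y: "y \<in> body V"
        and eq: "simplicial_map V \<phi> x = simplicial_map V \<phi> y"
      obtain A l where A: "A \<in> V" "l \<in> weights A" "x = bary l" using coord[OF x] by blast
      obtain B m where B: "B \<in> V" "m \<in> weights B" "y = bary m" using coord[OF y] by blast
      have "push_weights (\<Union>V) \<phi> l = push_weights (\<Union>V) \<phi> m"
        by (rule geometric_inj[OF W _ _ img(2)[OF A(1,2)] img(2)[OF B(1,2)]])
          (use A B eq img(1) in auto)
      then have "l w = m w" if "w \<in> \<Union>V" for w
        using push_weights_apply[OF inj that] by metis
      moreover have "l w = m w" if "w \<notin> \<Union>V" for w
      proof -
        have "w \<notin> A" "w \<notin> B" using that A(1) B(1) by auto
        then show ?thesis using A(2) B(2) by (simp add: weights_def)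
      qed
      ultimately have "l = m" by blast
      then show "x = y" using A(3) B(3) by simp
    qed
    show "simplicial_map V \<phi> ` body V = body ((`) \<phi> ` V)"
    proof
      show "simplicial_map V \<phi> ` body V \<subseteq> body ((`) \<phi> ` V)"
      proof clarify
        fix x assume "x \<in> body V"
        then obtain A l where A: "A \<in> V" "l \<in> weights A" "x = bary l" using coord by blast
        have "simplicial_map V \<phi> x \<in> convex hull (\<phi> ` A)"
          using img[OF A(1,2)] A(3) convex_hull_weights[of "\<phi> ` A"] fin[OF A(1)] by auto
        then show "simplicial_map V \<phi> x \<in> body ((`) \<phi> ` V)" unfolding body_eq using A(1) by blast
      qed
      show "body ((`) \<phi> ` V) \<subseteq> simplicial_map V \<phi> ` body V"
      proof
        fix y assume "y \<in> body ((`) \<phi> ` V)"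
        then obtain A where A: "A \<in> V" "y \<in> convex hull (\<phi> ` A)" unfolding body_eq by blast
        obtain m where m: "m \<in> weights (\<phi> ` A)" "y = bary m"
          using A(2) convex_hull_weights[of "\<phi> ` A"] fin[OF A(1)] by auto
        note l = pull_weights[OF injA[OF A(1)] fin[OF A(1)] m(1)]
        have "simplicial_map V \<phi> (bary (pull_weights A \<phi> m)) = y"
          using simplicial_map_bary[OF V A(1) l(1)] l(2) m(2) by simp
        moreover have "bary (pull_weights A \<phi> m) \<in> body V"
          unfolding body_eq using convex_hull_weights[OF fin[OF A(1)]] l(1) A(1) by blast
        ultimately show "y \<in> simplicial_map V \<phi> ` body V" by blast
      qed
    qed
  qed
qed

text \<open>Weights on the image of a simplex pull back to weights on the simplex, and
  \<open>F\<close> maps their barycentres to each other. Injectivity of \<open>F\<close> thus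
  reduces uniqueness of coordinates in the image to uniqueness in \<open>U\<close>.\<close>

lemma geometric_affine_image:
  fixes F :: "'a::real_vector \<Rightarrow> 'b::real_vector"
  assumes U: "geometric U" and inj: "inj_on F (body U)"
    and aff: "\<And>B m. B \<in> U \<Longrightarrow> m \<in> weights B \<Longrightarrow> F (bary m) = (\<Sum>u\<in>B. m u *\<^sub>R F u)"
  shows "geometric ((`) F ` U)" "body ((`) F ` U) = F ` body U" "set_iso U ((`) F ` U)"
proof -
  have fin: "finite B" if "B \<in> U" for B using U that geometric_finite by blast
  have vert: "\<Union>U \<subseteq> body U" unfolding body_eq using hull_inc by fast
  have injU: "inj_on F (\<Union>U)" using inj vert by (rule inj_on_subset)
  have injB: "inj_on F B" if "B \<in> U" for B using injU by (rule inj_on_subset) (use that in blast)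
  have mem: "bary m \<in> body U" if "B \<in> U" "m \<in> weights B" for B m
    unfolding body_eq using convex_hull_weights[OF fin[OF that(1)]] that by blast
  have pull: "pull_weights B F m \<in> weights B" "bary m = F (bary (pull_weights B F m))"
    if B: "B \<in> U" "m \<in> weights (F ` B)" for B m
    using pull_weights[OF injB fin, OF B(1) B(1) B(2)] aff[OF B(1)] by auto
  show "geometric ((`) F ` U)" unfolding geometric_def
  proof (intro conjI ballI allI impI)
    show "finite ((`) F ` U)" using U by (simp add: geometric_def)
    show "finite A" if "A \<in> (`) F ` U" for A using that fin by auto
    show "C \<in> (`) F ` U" if "A \<in> (`) F ` U" "C \<subseteq> A" for A C
      using that geometric_down[OF U] by (auto simp: subset_image_iff)
    show "inj_on bary (\<Union>A\<in>(`) F ` U. weights A)"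
    proof (rule inj_onI)
      fix m m' assume "m \<in> (\<Union>A\<in>(`) F ` U. weights A)" "m' \<in> (\<Union>A\<in>(`) F ` U. weights A)"
        and eq: "bary m = bary m'"
      then obtain B B' where B: "B \<in> U" "m \<in> weights (F ` B)" "B' \<in> U" "m' \<in> weights (F ` B')"
        by blast
      note p = pull[OF B(1,2)] pull[OF B(3,4)]
      have "bary (pull_weights B F m) = bary (pull_weights B' F m')"
        by (rule inj_onD[OF inj]) (use p eq mem B in auto)
      then have n: "pull_weights B F m = pull_weights B' F m'"
        by (rule geometric_inj[OF U B(1,3) p(1,3)])
      have val: "m (F u) = pull_weights B F m u"
        if "u \<in> \<Union>U" "B \<in> U" "m \<in> weights (F ` B)" for u B m
      proof (cases "u \<in> B")
        case False
        then have "F u \<notin> F ` B" using injU that(1,2) by (auto dest: inj_onD)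
        then show ?thesis using that(3) False by (simp add: weights_def pull_weights_def)
      qed (simp add: pull_weights_def)
      show "m = m'"
      proof
        fix y
        show "m y = m' y"
        proof (cases "y \<in> F ` \<Union>U")
          case True
          then obtain u where "u \<in> \<Union>U" "y = F u" by blast
          then show ?thesis using val[OF _ B(1,2)] val[OF _ B(3,4)] n by simp
        next
          case False
          then have "y \<notin> F ` B" "y \<notin> F ` B'" using B(1,3) by auto
          then show ?thesis using B(2,4) by (simp add: weights_def)
        qed
      qed
    qed
  qed
  have "convex hull (F ` B) = F ` (convex hull B)" if B: "B \<in> U" for B
  proof
    show "convex hull (F ` B) \<subseteq> F ` (convex hull B)"
      using pull[OF B] convex_hull_weights[OF fin[OF B]] convex_hull_weights[of "F ` B"] fin[OF B]
      by auto
    show "F ` (convex hull B) \<subseteq> convex hull (F ` B)"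
    proof clarify
      fix x assume "x \<in> convex hull B"
      then obtain m where m: "m \<in> weights B" "x = bary m" using convex_hull_weights[OF fin[OF B]] by blast
      have "F x = bary (push_weights B F m)"
        using push_weights(2)[OF injB[OF B] order_refl fin[OF B] m(1)] aff[OF B m(1)] m(2) by simp
      then show "F x \<in> convex hull (F ` B)"
        using push_weights(1)[OF injB[OF B] order_refl fin[OF B] m(1)]
          convex_hull_weights[of "F ` B"] fin[OF B] by auto
    qed
  qed
  then show "body ((`) F ` U) = F ` body U" unfolding body_eq by (simp add: image_UN)
  have "inj_on ((`) F) U"
    by (rule inj_on_subset[OF inj_on_image_Pow[OF injU]]) blast
  moreover have "A \<subseteq> B \<longleftrightarrow> F ` A \<subseteq> F ` B" if "A \<in> U" "B \<in> U" for A B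
    using inj_on_image_subset_iff[OF injU, of A B] that by blast
  ultimately show "set_iso U ((`) F ` U)"
    unfolding set_iso_def by (intro exI[of _ "(`) F"]) (simp add: bij_betw_def)
qed

text \<open>The linear extension of \<open>\<phi>\<close> is affine on each simplex of
  \<open>U\<close>, because that simplex lies in a simplex of \<open>V\<close>. The translation by
  \<open>p\<close> serves to move an interior point of the target to the origin, from which cones
  are taken later.\<close>

lemma transport:
  fixes V U :: "'a::euclidean_space set set" and \<phi> :: "'a \<Rightarrow> 'b::euclidean_space"
  assumes V: "geometric V" and inj: "inj_on \<phi> (\<Union>V)" and W: "geometric ((`) \<phi> ` V)"
    and U: "geometric U" "refines U V" "body U = body V"
  obtains M where "geometric M" "body M = (\<lambda>y. y - p) ` body ((`) \<phi> ` V)" "set_iso U M"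
proof -
  define F where "F x = simplicial_map V \<phi> x - p" for x
  note bij = simplicial_map_bij[OF V inj W]
  have injF: "inj_on F (body U)"
    using bij unfolding F_def U(3) bij_betw_def inj_on_def by simp
  have aff: "F (bary m) = (\<Sum>u\<in>B. m u *\<^sub>R F u)" if B: "B \<in> U" "m \<in> weights B" for B m
  proof -
    obtain A where A: "A \<in> V" "convex hull B \<subseteq> convex hull A"
      using U(2) B(1) unfolding refines_def by blast
    have fin: "finite B" using U(1) B(1) geometric_finite by blast
    have "B \<subseteq> convex hull A" by (rule order_trans[OF hull_subset A(2)])
    then have "simplicial_map V \<phi> (bary m) = (\<Sum>u\<in>B. m u *\<^sub>R simplicial_map V \<phi> u)"
      by (rule simplicial_map_affine[OF V A(1) fin _ B(2)])
    moreover have "(\<Sum>u\<in>B. m u *\<^sub>R p) = p"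
      using B(2) by (simp add: weights_def flip: scaleR_sum_left)
    ultimately show ?thesis unfolding F_def by (simp add: scaleR_diff_right sum_subtractf)
  qed
  note M = geometric_affine_image[OF U(1) injF aff]
  show thesis
  proof
    show "body ((`) F ` U) = (\<lambda>y. y - p) ` body ((`) \<phi> ` V)"
      using M(2) unfolding U(3) bij_betw_imp_surj_on[OF bij, symmetric] image_image F_def .
  qed (use M in auto)
qed

subsection \<open>Convex height functions\<close>

text \<open>Strict convexity in terms of supporting functionals, tested only inside each simplex
  \<open>B\<close> of \<open>M\<close>; vertices outside the hull of \<open>B\<close> are left free,
  since another summand of the height controls them. The functionals are linear rather than affine
  because heights are compared on cones from the origin.\<close>

definition locally_convex :: "'a::euclidean_space set set \<Rightarrow> 'a set set \<Rightarrow> ('a \<Rightarrow> real) \<Rightarrow> bool" where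
  "locally_convex M W g \<longleftrightarrow> (\<forall>B\<in>M. \<forall>A\<in>W. convex hull A \<subseteq> convex hull B \<longrightarrow>
     (\<exists>l. linear l \<and> (\<forall>u\<in>A. l u = g u) \<and> (\<forall>u\<in>\<Union>W - A. u \<in> convex hull B \<longrightarrow> l u < g u)))"

lemma eventually_small_perturbation:
  fixes a c k :: real
  assumes "a < c"
  shows "eventually (\<lambda>e. a + e * k < c) (at_right 0)"
proof -
  have "((\<lambda>e. a + e * k) \<longlongrightarrow> a + 0 * k) (at_right 0)" by (intro tendsto_intros)
  then show ?thesis by (rule order_tendstoD(2)) (use assms in simp)
qed

lemma linear_combination:
  fixes l k :: "'a::real_vector \<Rightarrow> real"
  assumes "linear l" "linear k"
  shows "linear (\<lambda>x. l x + e * k x)"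
  using linear_compose_add[OF assms(1) linear_compose_scale_right[OF assms(2), of e]] by simp

text \<open>Applying \<open>l\<close> to a linear dependence shows that its coefficients sum to
  zero, so it is an affine dependence.\<close>

lemma independent_height_one:
  fixes A :: "'a::euclidean_space set" and l :: "'a \<Rightarrow> real"
  assumes A: "\<not> affine_dependent A" and l: "linear l" "\<And>u. u \<in> A \<Longrightarrow> l u = 1"
  shows "independent A"
proof
  assume dep: "dependent A"
  have fin: "finite A" using A aff_independent_finite by blast
  obtain U where U: "\<exists>v\<in>A. U v \<noteq> 0" "(\<Sum>v\<in>A. U v *\<^sub>R v) = 0"
    using dep dependent_finite[OF fin] by auto
  have "l (\<Sum>v\<in>A. U v *\<^sub>R v) = (\<Sum>v\<in>A. U v * l v)"
    by (simp add: linear_sum[OF l(1)] linear_cmul[OF l(1)])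
  then have "sum U A = 0" using U(2) l linear_0[OF l(1)] by simp
  then show False using A U affine_dependent_explicit_finite[OF fin] by blast
qed

lemma vertex_in_hull:
  assumes V: "geometric V" "B \<in> V" and u: "u \<in> \<Union>V" "u \<in> convex hull B"
  shows "u \<in> B"
proof -
  have "{u} \<in> V" using u(1) geometric_down[OF V(1)] by blast
  then have "convex hull {u} \<inter> convex hull B = convex hull ({u} \<inter> B)"
    by (rule geometric_hull_Int[OF V(1) _ V(2)])
  moreover have "u \<in> convex hull {u} \<inter> convex hull B" using u(2) by simp
  ultimately have hull: "u \<in> convex hull ({u} \<inter> B)" by simp
  show ?thesis
  proof (rule ccontr)
    assume "u \<notin> B"
    then have "{u} \<inter> B = {}" by blast
    then show False using hull by simp
  qed
qed

text \<open>By linear independence some functional is 0 on the face \<open>A\<close> of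
  \<open>B\<close> and -1 at the other vertices of \<open>B\<close>. The hull of \<open>B\<close>
  contains no further vertices of \<open>M\<close>.\<close>

lemma locally_convex_refl:
  assumes M: "geometric M" and ind: "\<And>A. A \<in> M \<Longrightarrow> independent A"
  shows "locally_convex M M (\<lambda>_. 0)"
  unfolding locally_convex_def
proof (intro ballI impI)
  fix B A assume B: "B \<in> M" and A: "A \<in> M" "convex hull A \<subseteq> convex hull B"
  have vert: "u \<in> B" if "u \<in> \<Union>M" "u \<in> convex hull B" for u
    using vertex_in_hull[OF M B that] .
  obtain l where l: "linear l" "\<forall>u\<in>B. l u = (if u \<in> A then 0 else - 1 :: real)"
    using linear_independent_extend[OF ind[OF B], of "\<lambda>u. if u \<in> A then 0 else - 1"] by blast
  have "A \<subseteq> convex hull B" by (rule order_trans[OF hull_subset A(2)])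
  then have "A \<subseteq> B" using vert A(1) by blast
  show "\<exists>l. linear l \<and> (\<forall>u\<in>A. l u = (0::real)) \<and>
      (\<forall>u\<in>\<Union>M - A. u \<in> convex hull B \<longrightarrow> l u < 0)"
  proof (intro exI[of _ l] conjI ballI impI)
    show "linear l" by (fact l(1))
    show "l u = 0" if "u \<in> A" for u using l(2) \<open>A \<subseteq> B\<close> that by auto
    show "l u < 0" if "u \<in> \<Union>M - A" "u \<in> convex hull B" for u
      using l(2) vert[OF _ that(2)] that(1) by auto
  qed
qed

text \<open>
  The height of the new vertex is placed slightly below the value at \<open>x\<close> of the interpolation of
  \<open>g\<close> on \<open>T\<close>.
\<close>

lemma locally_convex_stellar:
  assumes sp: "stellar_point W T x b"
    and M: "geometric M" and ref: "refines W M" and ind: "\<And>A. A \<in> W \<Longrightarrow> independent A"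
    and g: "locally_convex M W g"
  obtains g' where "locally_convex M (stellar T x W) g'"
proof (cases "x \<in> \<Union>W")
  \<comment> \<open>If \<open>x\<close> is already a vertex, then \<open>T\<close> is
    \<open>{x}\<close> and the subdivision changes nothing.\<close>
  case True
  interpret stellar_point W T x b by (fact sp)
  have Tx: "T = {x}" using rel_interior_hull_vertex[OF V T x_rel_interior True] .
  have "stellar T x W = W"
  proof
    show "stellar T x W \<subseteq> W" unfolding stellar_def Tx by auto
    show "W \<subseteq> stellar T x W"
    proof
      fix A assume A: "A \<in> W"
      show "A \<in> stellar T x W"
      proof (cases "x \<in> A")
        case True
        then have "A - {x} \<in> W" "A - {x} \<union> {x} = A" "insert x (A - {x}) = A"
          using geometric_down[OF V A] by auto
        then show ?thesis using stellar_iff[of A] True A unfolding Tx by auto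
      qed (use A in \<open>simp add: stellar_def Tx\<close>)
    qed
  qed
  then show thesis using that g by simp
next
  case False
  interpret stellar_point W T x b by (fact sp)
  let ?W = "stellar T x W"
  have finT: "finite T" using fin T(1) by blast
  define s where "s = (\<Sum>u\<in>T. b u * g u)"
  define g' where "g' e = g(x := s - e)" for e :: real
  have verts: "\<Union>?W \<subseteq> insert x (\<Union>W)" unfolding stellar_def by auto
  have lx: "l x = (\<Sum>u\<in>T. b u * l u)" if "linear l" for l :: "'a \<Rightarrow> real"
    unfolding b(3)[symmetric] bary_weights[OF finT b(1)]
    by (simp add: linear_sum[OF that] linear_cmul[OF that])
  \<comment> \<open>\<open>x\<close> lies in the relative interior of the hull of \<open>T\<close>,
    so a face of a simplex of \<open>M\<close> that contains \<open>x\<close> contains all of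
    \<open>T\<close>.\<close>
  have TB: "T \<subseteq> convex hull B" if B: "B \<in> M" "x \<in> convex hull B" for B
  proof -
    obtain B1 where B1: "B1 \<in> M" "convex hull T \<subseteq> convex hull B1"
      using ref T(1) unfolding refines_def by blast
    have "convex hull B1 \<inter> convex hull B = convex hull (B1 \<inter> B)"
      by (rule geometric_hull_Int[OF M B1(1) B(1)])
    then have "convex hull B1 \<inter> convex hull B face_of convex hull B1"
      using face_of_convex_hull_affine_independent[OF geometric_affine_independent[OF M B1(1)]]
      by auto
    then have "convex hull T \<subseteq> convex hull B1 \<inter> convex hull B"
      by (rule subset_of_face_of[OF _ B1(2)]) (use x_rel_interior x_hull B1 B in blast)
    then show ?thesis using order_trans[OF hull_subset[of T convex]] by blast
  qed
  let ?P = "\<lambda>A B e. \<exists>l. linear l \<and> (\<forall>u\<in>A. l u = g' e u) \<and>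
    (\<forall>u\<in>\<Union>?W - A. u \<in> convex hull B \<longrightarrow> l u < g' e u)"
  have main: "eventually (?P A B) (at_right 0)"
    if A: "A \<in> ?W" and B: "B \<in> M" and AB: "convex hull A \<subseteq> convex hull B" for A B
  proof (cases "x \<in> A")
    case xA: False
    then have AW: "A \<in> W" "\<not> T \<subseteq> A" using A stellar_iff by auto
    obtain l where l: "linear l" "\<forall>u\<in>A. l u = g u" "\<forall>u\<in>\<Union>W - A. u \<in> convex hull B \<longrightarrow> l u < g u"
      using g B AW(1) AB unfolding locally_convex_def by blast
    have ev: "eventually (\<lambda>e. x \<in> convex hull B \<longrightarrow> l x < s - e) (at_right 0)"
    proof (cases "x \<in> convex hull B")
      case True
      have le: "l u \<le> g u" if "u \<in> T" for u
        using l(2,3) TB[OF B True] T(1) that by (cases "u \<in> A") (auto intro: less_imp_le)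
      \<comment> \<open>\<open>A\<close> misses a vertex of \<open>T\<close>, where \<open>l\<close>
        is strictly below \<open>g\<close>. Positivity of \<open>b\<close> keeps the inequality
        strict after averaging over \<open>T\<close>, which leaves room for lowering the height of
        \<open>x\<close> by \<open>e\<close>.\<close>
      obtain u0 where u0: "u0 \<in> T" "u0 \<notin> A" using AW(2) by blast
      then have "l u0 < g u0" using l(3) TB[OF B True] T(1) by blast
      then have "l x < s"
        unfolding lx[OF l(1)] s_def using le u0(1) b(2)
        by (intro sum_strict_mono_ex1[OF finT]) (auto intro!: bexI[of _ u0] mult_left_mono simp: less_imp_le)
      then have "eventually (\<lambda>e. l x + e * 1 < s) (at_right 0)" by (rule eventually_small_perturbation)
      then show ?thesis by (rule eventually_mono) simp
    qed simp
    show ?thesis using ev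
    proof (rule eventually_mono)
      fix e assume e: "x \<in> convex hull B \<longrightarrow> l x < s - e"
      show "?P A B e"
      proof (intro exI[of _ l] conjI ballI impI)
        show "linear l" by (fact l(1))
        show "l u = g' e u" if "u \<in> A" for u using l(2) that xA by (auto simp: g'_def)
        show "l u < g' e u" if u: "u \<in> \<Union>?W - A" "u \<in> convex hull B" for u
        proof (cases "u = x")
          case False
          then have "u \<in> \<Union>W - A" using u(1) verts by blast
          then show ?thesis using l(3) u(2) False by (simp add: g'_def)
        qed (use e u in \<open>simp add: g'_def\<close>)
      qed
    qed
  next
    case xA: True
    define A0 where "A0 = A - {x}"
    define D where "D = A0 \<union> T"
    have AW: "A0 \<in> W" "\<not> T \<subseteq> A0" "D \<in> W"
      using A xA stellar_iff unfolding A0_def D_def by auto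
    have AsubB: "A \<subseteq> convex hull B" by (rule order_trans[OF hull_subset AB])
    then have "D \<subseteq> convex hull B" using TB[OF B] xA unfolding D_def A0_def by blast
    then have "convex hull D \<subseteq> convex hull B" by (simp add: hull_minimal)
    then obtain l where l: "linear l" "\<forall>u\<in>D. l u = g u"
      "\<forall>u\<in>\<Union>W - D. u \<in> convex hull B \<longrightarrow> l u < g u"
      using g B AW(3) unfolding locally_convex_def by blast
    \<comment> \<open>\<open>c\<close> normalises \<open>k\<close> to the value -1 at
      \<open>x\<close>: it is 0 on the base \<open>A0\<close> and \<open>- (1/c)\<close> on the rest
      of \<open>T\<close>. Adding \<open>e * k\<close> to \<open>l\<close> lowers the value at
      \<open>x\<close> by exactly \<open>e\<close> and drops strictly below \<open>g\<close> at the
      vertices of \<open>T\<close> outside \<open>A0\<close>; the strict inequalities elsewhere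
      survive for small \<open>e\<close>.\<close>
    define c where "c = (\<Sum>u\<in>T - A0. b u)"
    obtain u0 where u0: "u0 \<in> T" "u0 \<notin> A0" using AW(2) by blast
    have "c > 0" unfolding c_def using finT u0 b(2) by (intro sum_pos) auto
    obtain k where k: "linear k" "\<forall>u\<in>D. k u = (if u \<in> A0 then 0 else - (1/c))"
      using linear_independent_extend[OF ind[OF AW(3)], of "\<lambda>u. if u \<in> A0 then 0 else - (1/c)"]
      by blast
    have "k x = (\<Sum>u\<in>T. b u * (if u \<in> A0 then 0 else - (1/c)))"
      unfolding lx[OF k(1)] using k(2) by (intro sum.cong) (auto simp: D_def)
    also have "\<dots> = (\<Sum>u\<in>T - A0. b u * (- (1/c)))"
      using finT by (intro sum.mono_neutral_cong_right) auto
    also have "\<dots> = c * (- (1/c))" unfolding c_def by (rule sum_distrib_right[symmetric])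
    finally have kx: "k x = - 1" using \<open>c > 0\<close> by simp
    have lxs: "l x = s" unfolding lx[OF l(1)] s_def using l(2) by (intro sum.cong) (auto simp: D_def)
    have "finite (\<Union>W - D)" using V by (auto simp: geometric_def)
    then have "eventually (\<lambda>e. \<forall>u\<in>\<Union>W - D. u \<in> convex hull B \<longrightarrow> l u + e * k u < g u) (at_right 0)"
    proof (intro eventually_ball_finite ballI)
      fix u assume u: "u \<in> \<Union>W - D"
      show "eventually (\<lambda>e. u \<in> convex hull B \<longrightarrow> l u + e * k u < g u) (at_right 0)"
      proof (cases "u \<in> convex hull B")
        case True
        then have "l u < g u" using l(3) u by blast
        then have "eventually (\<lambda>e. l u + e * k u < g u) (at_right 0)"
          by (rule eventually_small_perturbation)
        then show ?thesis by (rule eventually_mono) simp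
      qed simp
    qed
    moreover have "eventually (\<lambda>e::real. e > 0) (at_right 0)"
      by (rule eventually_at_right_less)
    ultimately show ?thesis
    proof eventually_elim
      case (elim e)
      let ?l = "\<lambda>u. l u + e * k u"
      have "linear ?l" using linear_combination[OF l(1) k(1)] .
      moreover have "?l u = g' e u" if "u \<in> A" for u
      proof (cases "u = x")
        case False
        then have "u \<in> A0" "u \<in> D" using that by (auto simp: A0_def D_def)
        then show ?thesis using False l(2) k(2) by (simp add: g'_def)
      qed (simp add: g'_def lxs kx)
      moreover have "?l u < g' e u" if u: "u \<in> \<Union>?W - A" "u \<in> convex hull B" for u
      proof -
        have ux: "u \<noteq> x" "u \<in> \<Union>W" "u \<notin> A0" using u xA verts by (auto simp: A0_def)
        show ?thesis
        proof (cases "u \<in> D")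
          case True
          then show ?thesis using l(2) k(2) ux elim(2) \<open>c > 0\<close> by (simp add: g'_def)
        next
          case False
          then show ?thesis using elim(1) ux u(2) by (simp add: g'_def)
        qed
      qed
      ultimately show ?case by blast
    qed
  qed
  have "finite M" "finite ?W" using M geometric_stellar by (auto simp: geometric_def)
  then have "eventually (\<lambda>e. \<forall>B\<in>M. \<forall>A\<in>?W. convex hull A \<subseteq> convex hull B \<longrightarrow> ?P A B e) (at_right 0)"
  proof (intro eventually_ball_finite ballI)
    fix B A assume "B \<in> M" "A \<in> ?W"
    then show "eventually (\<lambda>e. convex hull A \<subseteq> convex hull B \<longrightarrow> ?P A B e) (at_right 0)"
      using main by (cases "convex hull A \<subseteq> convex hull B") simp_all
  qed
  then obtain e where "\<forall>B\<in>M. \<forall>A\<in>?W. convex hull A \<subseteq> convex hull B \<longrightarrow> ?P A B e"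
    using eventually_happens trivial_limit_at_right_real by blast
  then show thesis using that[of "g' e"] unfolding locally_convex_def by blast
qed

subsection \<open>From convex heights to a polytope\<close>

text \<open>The global counterpart of local convexity, with all vertices tested. On the points
  \<open>u / h u\<close> the functional \<open>l\<close> becomes an inequality
  \<open>l y \<le> 1\<close>, in which equality holds exactly for the vertices in
  \<open>A\<close>.\<close>

definition convex_heights :: "'a::euclidean_space set set \<Rightarrow> ('a \<Rightarrow> real) \<Rightarrow> bool" where
  "convex_heights W h \<longleftrightarrow> (\<forall>u\<in>\<Union>W. 0 < h u) \<and>
     (\<forall>A\<in>W. \<exists>l. linear l \<and> (\<forall>u\<in>A. l u = h u) \<and> (\<forall>u\<in>\<Union>W - A. l u < h u))"

lemma linear_real_inner:
  fixes l :: "'a::euclidean_space \<Rightarrow> real"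
  assumes "linear l"
  obtains a where "\<And>x. l x = a \<bullet> x"
proof
  show "l x = adjoint l 1 \<bullet> x" for x
    using adjoint_works[OF assms, of x 1] by (simp add: inner_commute)
qed

text \<open>The inequality with normal \<open>a A\<close> exposes \<open>F A\<close>, so the sets
  \<open>F A\<close> are faces in the right inclusion order. That no proper face is missed comes
  from \<open>cover\<close>: every ray from 0 in \<open>Y\<close> meets the relative interior of
  some \<open>F A\<close>, and a proper face does not contain 0. The subspace \<open>Y\<close>
  allows for polytopes that are not full-dimensional.\<close>

lemma convex_heights_polytopal:
  fixes W :: "'b::euclidean_space set set"
  assumes W: "geometric W" "{} \<in> W" and ne: "\<Union>W \<noteq> {}" and h: "convex_heights W h"
    and Y: "subspace Y" "\<Union>W \<subseteq> Y" and cover: "\<And>y. y \<in> Y \<Longrightarrow> y \<noteq> 0 \<Longrightarrow> \<exists>c>0. c *\<^sub>R y \<in> body W"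
  shows "polytopal TYPE('b) (hulls W)"
proof -
  define q where "q u = u /\<^sub>R h u" for u
  define P where "P = convex hull (q ` \<Union>W)"
  define F where "F A = convex hull (q ` A)" for A
  have finW: "finite (\<Union>W)" and finA: "A \<in> W \<Longrightarrow> finite A" for A
    using W(1) by (auto simp: geometric_def)
  have hpos: "0 < h u" if "u \<in> \<Union>W" for u using h that unfolding convex_heights_def by blast
  have P: "polytope P" unfolding P_def polytope_def using finW by blast
  have FP: "F A \<subseteq> P" if "A \<in> W" for A unfolding F_def P_def using that by (intro hull_mono) blast
  have "\<forall>A\<in>W. \<exists>a. (\<forall>u\<in>A. a \<bullet> u = h u) \<and> (\<forall>u\<in>\<Union>W - A. a \<bullet> u < h u)"
  proof
    fix A assume "A \<in> W"
    then obtain l where l: "linear l" "\<forall>u\<in>A. l u = h u" "\<forall>u\<in>\<Union>W - A. l u < h u"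
      using h unfolding convex_heights_def by blast
    obtain a where "\<And>x. l x = a \<bullet> x" using linear_real_inner[OF l(1)] by blast
    then show "\<exists>a. (\<forall>u\<in>A. a \<bullet> u = h u) \<and> (\<forall>u\<in>\<Union>W - A. a \<bullet> u < h u)" using l by auto
  qed
  then obtain a where a: "\<And>A u. A \<in> W \<Longrightarrow> u \<in> A \<Longrightarrow> a A \<bullet> u = h u"
    "\<And>A u. A \<in> W \<Longrightarrow> u \<in> \<Union>W - A \<Longrightarrow> a A \<bullet> u < h u" by metis
  have q1: "a A \<bullet> q u = 1" if "A \<in> W" "u \<in> A" for A u
    using a(1)[OF that] hpos[of u] that by (force simp: q_def)
  have q2: "a A \<bullet> q u < 1" if "A \<in> W" "u \<in> \<Union>W - A" for A u
    using a(2)[OF that] hpos[of u] that by (simp add: q_def field_simps)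
  have aP: "a A \<bullet> y \<le> 1" if A: "A \<in> W" and y: "y \<in> P" for A y
  proof -
    have "q ` \<Union>W \<subseteq> {y. a A \<bullet> y \<le> 1}" using q1[OF A] q2[OF A] by (force simp: less_imp_le)
    then have "P \<subseteq> {y. a A \<bullet> y \<le> 1}" unfolding P_def by (intro hull_minimal convex_halfspace_le)
    then show ?thesis using y by blast
  qed
  have aF: "a A \<bullet> y = 1" if A: "A \<in> W" and y: "y \<in> F A" for A y
  proof -
    have "q ` A \<subseteq> {y. a A \<bullet> y = 1}" using q1[OF A] by auto
    then have "F A \<subseteq> {y. a A \<bullet> y = 1}" unfolding F_def by (intro hull_minimal convex_hyperplane)
    then show ?thesis using y by blast
  qed
  have Fexp: "F A = P \<inter> {y. a A \<bullet> y = 1}" if A: "A \<in> W" for A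
  proof
    show "F A \<subseteq> P \<inter> {y. a A \<bullet> y = 1}" using FP[OF A] aF[OF A] by blast
    show "P \<inter> {y. a A \<bullet> y = 1} \<subseteq> F A"
    proof
      fix y assume y: "y \<in> P \<inter> {y. a A \<bullet> y = 1}"
      have finq: "finite (q ` \<Union>W)" using finW by simp
      obtain l where l: "l \<in> weights (q ` \<Union>W)" "y = bary l"
        using y unfolding P_def convex_hull_weights[OF finq] by blast
      have l0: "\<And>z. 0 \<le> l z" and lsum: "sum l (q ` \<Union>W) = 1" using l(1) by (auto simp: weights_def)
      have "a A \<bullet> y = (\<Sum>z\<in>q ` \<Union>W. l z * (a A \<bullet> z))"
        unfolding l(2) bary_weights[OF finq l(1)] by (simp add: inner_sum_right)
      \<comment> \<open>The weighted average of \<open>1 - a A \<bullet> z\<close> vanishes although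
        no term is negative, so weight can sit only on points with value 1.\<close>
      then have "(\<Sum>z\<in>q ` \<Union>W. l z * (1 - a A \<bullet> z)) = 0"
        using y lsum by (simp add: right_diff_distrib sum_subtractf)
      moreover have "0 \<le> l z * (1 - a A \<bullet> z)" if "z \<in> q ` \<Union>W" for z
        using l0 aP[OF A, of z] that hull_subset[of "q ` \<Union>W" convex]
        unfolding P_def by (intro mult_nonneg_nonneg) auto
      ultimately have z: "\<forall>z\<in>q ` \<Union>W. l z * (1 - a A \<bullet> z) = 0"
        using sum_nonneg_eq_0_iff[OF finq, of "\<lambda>z. l z * (1 - a A \<bullet> z)"] by fast
      have "l \<in> weights (q ` A)"
      proof (rule weights_shrink[OF finq l(1)])
        fix z assume zz: "z \<in> q ` \<Union>W - q ` A"
        then obtain u where u: "u \<in> \<Union>W" "z = q u" "u \<notin> A" by blast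
        then have "a A \<bullet> z < 1" using q2[OF A] by blast
        moreover have "l z * (1 - a A \<bullet> z) = 0" using z zz by blast
        ultimately show "l z = 0" by simp
      qed (use A in blast)
      then show "y \<in> F A" unfolding F_def l(2) using convex_hull_weights[of "q ` A"] finA[OF A] by blast
    qed
  qed
  have Fface: "F A face_of P" if A: "A \<in> W" for A
    unfolding Fexp[OF A] using aP[OF A]
    by (intro face_of_Int_supporting_hyperplane_le) (auto simp: P_def)
  have Fsub: "F A \<subseteq> F B \<longleftrightarrow> A \<subseteq> B" if AB: "A \<in> W" "B \<in> W" for A B
  proof
    assume FAB: "F A \<subseteq> F B"
    show "A \<subseteq> B"
    proof
      fix u assume u: "u \<in> A"
      then have "q u \<in> F B" using FAB hull_inc[of "q u" "q ` A" convex] unfolding F_def by blast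
      then have "a B \<bullet> q u = 1" using aF AB by blast
      then show "u \<in> B" using q2[OF AB(2), of u] u AB by force
    qed
  qed (auto simp: F_def intro!: hull_mono)
  have vertex0: "u \<noteq> 0" if u: "u \<in> \<Union>W" for u
  proof -
    have "{u} \<in> W" using u geometric_down[OF W(1)] by blast
    then have "a {u} \<bullet> u = h u" using a(1) by blast
    then show ?thesis using hpos[OF u] by auto
  qed
  have ray: "\<exists>A\<in>W. \<exists>d>0. d *\<^sub>R y \<in> F A \<and> d *\<^sub>R y \<in> rel_interior (F A)" if y: "y \<in> Y" "y \<noteq> 0" for y
  proof -
    obtain c B where c: "c > 0" "B \<in> W" "c *\<^sub>R y \<in> convex hull B"
      using cover[OF y] unfolding body_eq by blast
    obtain m where m: "m \<in> weights B" "c *\<^sub>R y = bary m"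
      using c(3) convex_hull_weights[OF finA[OF c(2)]] by blast
    define A where "A = {u\<in>B. m u \<noteq> 0}"
    have A: "A \<in> W" using geometric_down[OF W(1) c(2)] by (simp add: A_def)
    have mA: "m \<in> weights A"
      by (rule weights_shrink[OF finA[OF c(2)] m(1)]) (auto simp: A_def)
    have mpos: "0 < m u" if "u \<in> A" for u
      using that mA unfolding A_def weights_def by (auto simp: less_le)
    have msum: "sum m A = 1" using mA by (simp add: weights_def)
    define H where "H = (\<Sum>u\<in>A. m u * h u)"
    have Hpos: "H > 0"
    proof -
      have "A \<noteq> {}" using msum by auto
      moreover have "0 < h u" if "u \<in> A" for u using hpos A that by blast
      ultimately show ?thesis unfolding H_def using finA[OF A] mpos by (intro sum_pos) auto
    qed
    have injq: "inj_on q A"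
    proof (rule inj_onI)
      fix u u' assume u: "u \<in> A" "u' \<in> A" "q u = q u'"
      have "{u} \<in> W" using u A geometric_down[OF W(1)] by blast
      then have "a {u} \<bullet> q u' = 1" using q1 u(3) by (metis singletonI)
      then show "u = u'" using q2[OF \<open>{u} \<in> W\<close>, of u'] u(2) A by force
    qed
    \<comment> \<open>The factor \<open>h u\<close> cancels the division in \<open>q u\<close>, and
      \<open>H\<close> restores total weight one. The resulting point is on the same ray, at scale
      \<open>c / H\<close>.\<close>
    define n where "n u = m u * h u / H" for u
    have npos: "0 < n u" if "u \<in> A" for u
      using mpos[OF that] hpos[of u] that A Hpos by (auto simp: n_def intro!: divide_pos_pos mult_pos_pos)
    have nsum: "sum n A = 1" using Hpos by (simp add: n_def H_def flip: sum_divide_distrib)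
    have "n u *\<^sub>R q u = (1 / H) *\<^sub>R (m u *\<^sub>R u)" if "u \<in> A" for u
      using hpos[of u] that A by (force simp: n_def q_def)
    then have "(\<Sum>u\<in>A. n u *\<^sub>R q u) = (1 / H) *\<^sub>R (c *\<^sub>R y)"
      unfolding m(2) bary_weights[OF finA[OF A] mA] scaleR_right.sum by (intro sum.cong) auto
    then have sumy: "(\<Sum>u\<in>A. n u *\<^sub>R q u) = (c / H) *\<^sub>R y" by simp
    define n' where "n' z = n (the_inv_into A q z)" for z
    have n': "n' (q u) = n u" if "u \<in> A" for u
      using that injq by (simp add: n'_def the_inv_into_f_f)
    have "\<forall>z\<in>q ` A. 0 < n' z" using n' npos by auto
    moreover have "sum n' (q ` A) = 1" using nsum n' by (simp add: sum.reindex[OF injq])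
    moreover have "(\<Sum>z\<in>q ` A. n' z *\<^sub>R z) = (c / H) *\<^sub>R y"
      using sumy n' by (simp add: sum.reindex[OF injq])
    ultimately have ri: "(c / H) *\<^sub>R y \<in> rel_interior (F A)"
      unfolding F_def
      using explicit_subset_rel_interior_convex_hull_minimal[of "q ` A"] finA[OF A] by blast
    then show ?thesis using A c(1) Hpos rel_interior_subset
      by (intro bexI[of _ A] exI[of _ "c / H"]) auto
  qed
  have PY: "P \<subseteq> Y"
    unfolding P_def
    by (rule hull_minimal) (use Y subspace_scale subspace_imp_convex in \<open>auto simp: q_def\<close>)
  have opp: "\<exists>d>0. - d *\<^sub>R y \<in> P" if "y \<in> Y" "y \<noteq> 0" for y
    using ray[of "- y"] FP that subspace_neg[OF Y(1)] by auto
  have seg0: "0 \<in> open_segment y (- d *\<^sub>R y)" if "y \<noteq> 0" "d > 0" for y :: 'b and d :: real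
  proof -
    have "0 = (1 - 1/(1+d)) *\<^sub>R y + (1/(1+d)) *\<^sub>R (- d *\<^sub>R y)"
      using that by (simp add: field_simps flip: scaleR_left_distrib scaleR_left_diff_distrib)
    moreover have "0 < 1/(1+d)" "1/(1+d) < 1" using that by auto
    moreover have "y \<noteq> - d *\<^sub>R y"
    proof
      assume "y = - d *\<^sub>R y"
      then have "(1 + d) *\<^sub>R y = 0" by (simp add: scaleR_add_left eq_neg_iff_add_eq_0)
      then show False using that by simp
    qed
    ultimately show ?thesis unfolding in_segment by blast
  qed
  obtain u where u: "u \<in> \<Union>W" using ne by blast
  have qu: "q u \<in> P" "q u \<noteq> 0" using u hpos[OF u] vertex0[OF u] hull_inc[of "q u" "q ` \<Union>W" convex]
    by (auto simp: P_def q_def)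
  have P0: "0 \<in> P"
  proof -
    obtain d where "d > 0" "- d *\<^sub>R q u \<in> P" using opp qu PY by blast
    then show ?thesis using seg0[OF qu(2)] qu(1) P polytope_imp_convex
      by (metis convex_contains_open_segment subsetD)
  qed
  \<comment> \<open>0 lies strictly between any nonzero point of \<open>P\<close> and a negative
    multiple of it in \<open>P\<close>, so a face through 0 contains everything.\<close>
  have face0: "G = P" if G: "G face_of P" "0 \<in> G" for G
  proof
    show "G \<subseteq> P" using G(1) face_of_imp_subset by blast
    show "P \<subseteq> G"
    proof
      fix y assume y: "y \<in> P"
      show "y \<in> G"
      proof (cases "y = 0")
        case False
        then obtain d where "d > 0" "- d *\<^sub>R y \<in> P" using opp y PY by blast
        then show ?thesis using G y seg0[OF False] unfolding face_of_def by blast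
      qed (use G in simp)
    qed
  qed
  have Fproper: "F A \<noteq> P" if A: "A \<in> W" for A using aF[OF A, of 0] P0 by auto
  have bij: "bij_betw F W (boundary_complex P)"
    unfolding bij_betw_def
  proof
    show "inj_on F W" by (rule inj_onI) (use Fsub in blast)
    show "F ` W = boundary_complex P"
    proof
      show "F ` W \<subseteq> boundary_complex P" unfolding boundary_complex_def using Fface Fproper by blast
      show "boundary_complex P \<subseteq> F ` W"
      proof
        fix G assume "G \<in> boundary_complex P"
        then have G: "G face_of P" "G \<noteq> P" unfolding boundary_complex_def by auto
        show "G \<in> F ` W"
        proof (cases "G = {}")
          case True
          then show ?thesis using W(2) by (auto simp: F_def intro!: image_eqI[of _ _ "{}"])
        next
          case False
          then obtain y where y: "y \<in> rel_interior G"
            using face_of_imp_convex[OF G(1)] rel_interior_eq_empty by blast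
          then have yG: "y \<in> G" using rel_interior_subset by blast
          then have yP: "y \<in> P" using G(1) face_of_imp_subset by blast
          have "0 \<notin> G" using face0 G by blast
          then have y0: "y \<noteq> 0" using yG by blast
          obtain A d where A: "A \<in> W" "d > 0" "d *\<^sub>R y \<in> F A" "d *\<^sub>R y \<in> rel_interior (F A)"
            using ray[OF _ y0] yP PY by blast
          \<comment> \<open>The inequality of \<open>A\<close> is tight at
            \<open>d *\<^sub>R y\<close> and valid at \<open>y\<close>, so \<open>d \<ge> 1\<close>.
            If \<open>d > 1\<close>, then \<open>y\<close> lies strictly between 0 and
            \<open>d *\<^sub>R y\<close>, and the face \<open>G\<close> would contain 0.\<close>
          have "d * (a A \<bullet> y) = 1" using aF[OF A(1,3)] by simp
          moreover have "a A \<bullet> y \<le> 1" using aP[OF A(1) yP] .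
          ultimately have "d \<ge> 1" using mult_left_mono[of "a A \<bullet> y" 1 d] A(2) by simp
          have "d = 1"
          proof (rule ccontr)
            assume "d \<noteq> 1"
            then have d: "d > 1" using \<open>d \<ge> 1\<close> by simp
            have "y = (1 - 1/d) *\<^sub>R 0 + (1/d) *\<^sub>R (d *\<^sub>R y)" using d by simp
            moreover have "0 < 1/d" "1/d < 1" "0 \<noteq> d *\<^sub>R y" using d y0 by auto
            ultimately have "y \<in> open_segment 0 (d *\<^sub>R y)" unfolding in_segment by blast
            then have "0 \<in> G" using G(1) yG P0 A(3) FP[OF A(1)] unfolding face_of_def by blast
            then show False using \<open>0 \<notin> G\<close> by blast
          qed
          then have yF: "y \<in> F A" "y \<in> rel_interior (F A)" using A by auto
          have "G \<subseteq> F A"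
            by (rule subset_of_face_of[OF Fface[OF A(1)] face_of_imp_subset[OF G(1)]]) (use y yF in blast)
          moreover have "F A \<subseteq> G"
            by (rule subset_of_face_of[OF G(1) FP[OF A(1)]]) (use yG yF in blast)
          ultimately show ?thesis using A(1) by blast
        qed
      qed
    qed
  qed
  have Fiff: "F A face_of F B \<longleftrightarrow> A \<subseteq> B" if "A \<in> W" "B \<in> W" for A B
    using face_of_face[OF Fface[OF that(2)]] Fface[OF that(1)] Fsub[OF that] by blast
  define hv where "hv = ((hull) convex :: 'b set \<Rightarrow> 'b set)"
  have bv: "bij_betw hv W (hulls W)" unfolding hv_def
    using geometric_hull_inj[OF W(1)] by (simp add: bij_betw_def hulls_def)
  define G where "G = F \<circ> the_inv_into W hv"
  have Ghv: "G (hv A) = F A" if "A \<in> W" for A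
    using that bv by (simp add: G_def bij_betw_def the_inv_into_f_f)
  have "bij_betw G (hulls W) (boundary_complex P)"
    unfolding G_def using bij_betw_the_inv_into[OF bv] bij by (rule bij_betw_trans)
  moreover have "\<sigma> face_of \<tau> \<longleftrightarrow> G \<sigma> face_of G \<tau>" if st: "\<sigma> \<in> hulls W" "\<tau> \<in> hulls W" for \<sigma> \<tau>
  proof -
    obtain A B where AB: "A \<in> W" "B \<in> W" "\<sigma> = hv A" "\<tau> = hv B"
      using st unfolding hulls_def hv_def by blast
    have "\<sigma> face_of \<tau> \<longleftrightarrow> A \<subseteq> B" unfolding AB hv_def using geometric_face_iff[OF W(1) AB(1,2)] .
    then show ?thesis using Ghv Fiff AB by simp
  qed
  ultimately have "comb_equivalent (hulls W) (boundary_complex P)"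
    unfolding comb_equivalent_def by blast
  then show ?thesis unfolding polytopal_def using P by blast
qed

subsection \<open>Iterated derived subdivisions become polytopal\<close>

text \<open>\<open>B\<close> is extended to a basis \<open>C\<close>, and the functionals are the
  coordinates of the dual basis. Those outside \<open>B\<close> are taken with both signs, which
  forces them to vanish.\<close>

lemma simplicial_cone_halfspaces:
  fixes B :: "'a::euclidean_space set"
  assumes B: "independent B"
  shows "\<exists>E. finite E \<and> (\<forall>e\<in>E. \<forall>u\<in>B. 0 \<le> e \<bullet> u) \<and>
    (\<forall>x. (\<forall>e\<in>E. 0 \<le> e \<bullet> x) \<longrightarrow> (\<exists>w. (\<forall>b\<in>B. 0 \<le> w b) \<and> x = (\<Sum>b\<in>B. w b *\<^sub>R b)))"
proof -
  define C where "C = extend_basis B"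
  have C: "B \<subseteq> C" "independent C" "span C = UNIV"
    using B by (simp_all add: C_def extend_basis_superset independent_extend_basis)
  have finC: "finite C" using C(2) by (rule independent_imp_finite)
  have "\<exists>a. \<forall>x. representation C x c = a \<bullet> x" for c
  proof -
    have "linear (\<lambda>x. representation C x c)"
      by (rule linearI) (simp_all add: representation_add representation_scale C)
    then show ?thesis using linear_real_inner by blast
  qed
  then obtain a where a: "\<And>c x. representation C x c = a c \<bullet> x" by metis
  have dual: "a c \<bullet> u = (if c = u then 1 else 0)" if "u \<in> C" for c u
    unfolding a[symmetric] representation_basis[OF C(2) that] by simp
  define E where "E = a ` C \<union> uminus ` a ` (C - B)"
  show ?thesis
  proof (intro exI[of _ E] conjI ballI allI impI)
    show "finite E" using finC by (simp add: E_def)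
    show "0 \<le> e \<bullet> u" if "e \<in> E" "u \<in> B" for e u
      using that dual[of u] C(1) by (auto simp: E_def)
    fix x assume x: "\<forall>e\<in>E. 0 \<le> e \<bullet> x"
    have pos: "0 \<le> a c \<bullet> x" if "c \<in> C" for c using x that by (simp add: E_def)
    have zero: "a c \<bullet> x = 0" if c: "c \<in> C - B" for c
    proof -
      have "- a c \<in> E" using c by (simp add: E_def)
      then have "0 \<le> - a c \<bullet> x" using x by blast
      then show ?thesis using pos[of c] c by simp
    qed
    have "x = (\<Sum>c\<in>C. representation C x c *\<^sub>R c)"
      using sum_representation_eq[OF C(2) _ finC order_refl, of x] C(3) by simp
    also have "\<dots> = (\<Sum>c\<in>B. (a c \<bullet> x) *\<^sub>R c)"
      unfolding a using finC C(1) zero by (intro sum.mono_neutral_right) auto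
    finally show "\<exists>w. (\<forall>b\<in>B. 0 \<le> w b) \<and> x = (\<Sum>b\<in>B. w b *\<^sub>R b)"
      using pos C(1) by (intro exI[of _ "\<lambda>c. a c \<bullet> x"]) auto
  qed
qed

text \<open>\<open>A\<close> lies on one side of each linear hyperplane, so on \<open>A\<close>
  every absolute value is the functional with a fixed sign. Elsewhere each summand of
  \<open>l\<close> is at most the absolute value, so equality of the sums is equality in each
  summand.\<close>

lemma sum_abs_support:
  fixes E :: "'a::euclidean_space set"
  assumes E: "finite E" and A: "\<And>e. e \<in> E \<Longrightarrow> one_sided (e, 0) A"
  obtains l where "linear l" "\<And>u. u \<in> A \<Longrightarrow> l u = (\<Sum>e\<in>E. \<bar>e \<bullet> u\<bar>)"
    "\<And>x. l x \<le> (\<Sum>e\<in>E. \<bar>e \<bullet> x\<bar>)"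
    "\<And>x e. l x = (\<Sum>e\<in>E. \<bar>e \<bullet> x\<bar>) \<Longrightarrow> e \<in> E \<Longrightarrow> (\<And>u. u \<in> A \<Longrightarrow> 0 \<le> e \<bullet> u) \<Longrightarrow> 0 \<le> e \<bullet> x"
proof -
  \<comment> \<open>The value 0 belongs to functionals that vanish on all of \<open>A\<close>. There
    equality forces \<open>e \<bullet> x = 0\<close>, as the last claim requires.\<close>
  define s where "s e = (if \<exists>u\<in>A. e \<bullet> u > 0 then 1 else if \<exists>u\<in>A. e \<bullet> u < 0 then - 1 else 0 :: real)" for e
  define l where "l x = (\<Sum>e\<in>E. s e * (e \<bullet> x))" for x
  have le: "s e * (e \<bullet> x) \<le> \<bar>e \<bullet> x\<bar>" for e x by (auto simp: s_def)
  have eq: "s e * (e \<bullet> u) = \<bar>e \<bullet> u\<bar>" if "e \<in> E" "u \<in> A" for e u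
    using A[OF that(1)] that(2) unfolding one_sided_def s_def by force
  show thesis
  proof
    show "linear l" unfolding l_def
      by (rule linearI) (simp_all add: inner_add_right sum.distrib distrib_left sum_distrib_left ac_simps)
    show "l u = (\<Sum>e\<in>E. \<bar>e \<bullet> u\<bar>)" if "u \<in> A" for u unfolding l_def using eq that by simp
    show "l x \<le> (\<Sum>e\<in>E. \<bar>e \<bullet> x\<bar>)" for x unfolding l_def by (intro sum_mono le)
    show "0 \<le> e \<bullet> x"
      if x: "l x = (\<Sum>e\<in>E. \<bar>e \<bullet> x\<bar>)" and e: "e \<in> E" "\<And>u. u \<in> A \<Longrightarrow> 0 \<le> e \<bullet> u" for x e
    proof -
      have "(\<Sum>e\<in>E. \<bar>e \<bullet> x\<bar> - s e * (e \<bullet> x)) = 0" using x unfolding l_def by (simp add: sum_subtractf)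
      then have "\<bar>e \<bullet> x\<bar> - s e * (e \<bullet> x) = 0"
        by (rule sum_nonneg_0[OF E _ _ e(1), rotated]) (simp add: le)
      moreover have "\<not> (\<exists>u\<in>A. e \<bullet> u < 0)" using e(2) by (meson not_le)
      then have "s e = 0 \<or> s e = 1" unfolding s_def by simp
      ultimately show ?thesis by auto
    qed
  qed
qed

text \<open>
  The sum of the absolute values of the functionals of the arrangement is convex and linear on the
  cones over simplices of \<open>W\<close>, and it bends between different cones over simplices of \<open>M\<close>; a small
  multiple of a locally convex function makes it bend inside these cones as well.
\<close>

lemma convex_heights_arrangement:
  fixes M W :: "'a::euclidean_space set set"
  assumes M: "geometric M" and W: "geometric W" "body W = body M" "refines W M"
    and N: "\<And>B. B \<in> M \<Longrightarrow> \<exists>l. linear l \<and> (\<forall>u\<in>B. l u = 1) \<and> (\<forall>x\<in>body M. l x \<le> (1::real))"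
    and g: "locally_convex M W g"
    and E: "\<And>B. B \<in> M \<Longrightarrow> E B \<subseteq> EE" "finite EE" "\<And>B e u. B \<in> M \<Longrightarrow> e \<in> E B \<Longrightarrow> u \<in> B \<Longrightarrow> 0 \<le> e \<bullet> u"
      "\<And>B x. B \<in> M \<Longrightarrow> (\<And>e. e \<in> E B \<Longrightarrow> 0 \<le> e \<bullet> x) \<Longrightarrow> \<exists>w. (\<forall>b\<in>B. 0 \<le> w b) \<and> x = (\<Sum>b\<in>B. w b *\<^sub>R b)"
    and sided: "\<And>A e. A \<in> W \<Longrightarrow> e \<in> EE \<Longrightarrow> one_sided (e, 0) A"
  obtains h where "convex_heights W h"
proof -
  define f where "f u = (\<Sum>e\<in>EE. \<bar>e \<bullet> u\<bar>)" for u
  define h where "h t u = 1 + f u + t * g u" for t u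
  have finW: "finite W" "finite (\<Union>W)" using W(1) by (auto simp: geometric_def)
  have pos: "eventually (\<lambda>t. \<forall>u\<in>\<Union>W. 0 < h t u) (at_right 0)"
  proof (intro eventually_ball_finite[OF finW(2)] ballI)
    fix u
    have "0 \<le> f u" unfolding f_def by (intro sum_nonneg) simp
    then have "- 1 - f u < 0" by simp
    then have "eventually (\<lambda>t. - 1 - f u + t * (- g u) < 0) (at_right 0)"
      by (rule eventually_small_perturbation)
    then show "eventually (\<lambda>t. 0 < h t u) (at_right 0)"
      by (rule eventually_mono) (simp add: h_def)
  qed
  have vertW: "u \<in> body M" if "u \<in> \<Union>W" for u
    using that Union_subset_body unfolding W(2)[symmetric] by blast
  let ?P = "\<lambda>A t. \<exists>l. linear l \<and> (\<forall>u\<in>A. l u = h t u) \<and> (\<forall>u\<in>\<Union>W - A. l u < h t u)"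
  have main: "eventually (?P A) (at_right 0)" if A: "A \<in> W" for A
  proof -
    obtain B where B: "B \<in> M" "convex hull A \<subseteq> convex hull B"
      using W(3) A unfolding refines_def by blast
    have finB: "finite B" using M B(1) geometric_finite by blast
    have AB: "A \<subseteq> convex hull B" by (rule order_trans[OF hull_subset B(2)])
    obtain n where n: "linear n" "\<forall>u\<in>B. n u = 1" "\<forall>x\<in>body M. n x \<le> (1::real)"
      using N[OF B(1)] by blast
    obtain p where p: "\<And>x. n x = p \<bullet> x" using linear_real_inner[OF n(1)] by blast
    have "convex hull B \<subseteq> {x. p \<bullet> x = 1}"
      using n(2) p by (intro hull_minimal convex_hyperplane) auto
    then have nB: "n x = 1" if "x \<in> convex hull B" for x using p that by auto
    obtain k where k: "linear k" "\<And>u. u \<in> A \<Longrightarrow> k u = (\<Sum>e\<in>EE. \<bar>e \<bullet> u\<bar>)"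
      "\<And>x. k x \<le> (\<Sum>e\<in>EE. \<bar>e \<bullet> x\<bar>)"
      "\<And>x e. k x = (\<Sum>e\<in>EE. \<bar>e \<bullet> x\<bar>) \<Longrightarrow> e \<in> EE \<Longrightarrow> (\<And>u. u \<in> A \<Longrightarrow> 0 \<le> e \<bullet> u) \<Longrightarrow> 0 \<le> e \<bullet> x"
      using sum_abs_support[OF E(2) sided[OF A]] by blast
    obtain l where l: "linear l" "\<forall>u\<in>A. l u = g u" "\<forall>u\<in>\<Union>W - A. u \<in> convex hull B \<longrightarrow> l u < g u"
      using g B A unfolding locally_convex_def by blast
    \<comment> \<open>If both \<open>n u \<le> 1\<close> and \<open>k u \<le> f u\<close> were
      equalities, \<open>u\<close> would satisfy the inequalities of the cone over \<open>B\<close>,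
      and \<open>n u = 1\<close> would make its cone coefficients sum to 1, which puts
      \<open>u\<close> into the hull of \<open>B\<close>.\<close>
    have strict: "n u + k u < 1 + f u" if u: "u \<in> \<Union>W" "u \<notin> convex hull B" for u
    proof -
      have le: "n u \<le> 1" "k u \<le> f u" using n(3) vertW[OF u(1)] k(3) by (auto simp: f_def)
      have "\<not> (n u = 1 \<and> k u = f u)"
      proof
        assume eq: "n u = 1 \<and> k u = f u"
        have "0 \<le> e \<bullet> u" if e: "e \<in> E B" for e
        proof (rule k(4))
          show "k u = (\<Sum>e\<in>EE. \<bar>e \<bullet> u\<bar>)" using eq by (simp add: f_def)
          show "e \<in> EE" using e E(1)[OF B(1)] by blast
          have "B \<subseteq> {x. e \<bullet> x \<ge> 0}" using E(3)[OF B(1) e] by blast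
          then have "convex hull B \<subseteq> {x. e \<bullet> x \<ge> 0}" by (intro hull_minimal convex_halfspace_ge)
          then show "0 \<le> e \<bullet> y" if "y \<in> A" for y using AB that by blast
        qed
        then obtain w where w: "\<forall>b\<in>B. 0 \<le> w b" "u = (\<Sum>b\<in>B. w b *\<^sub>R b)"
          using E(4)[OF B(1)] by blast
        have "n u = (\<Sum>b\<in>B. w b * n b)"
          unfolding w(2) by (simp add: linear_sum[OF n(1)] linear_cmul[OF n(1)])
        then have "sum w B = 1" using n(2) eq by simp
        then have "u \<in> convex hull B" unfolding convex_hull_finite[OF finB] using w by blast
        then show False using u(2) by blast
      qed
      then show ?thesis using le by linarith
    qed
    have "eventually (\<lambda>t. \<forall>u\<in>\<Union>W. u \<notin> convex hull B \<longrightarrow>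
        (n u + k u) + t * (l u - g u) < 1 + f u) (at_right 0)"
    proof (intro eventually_ball_finite[OF finW(2)] ballI)
      fix u assume u: "u \<in> \<Union>W"
      show "eventually (\<lambda>t. u \<notin> convex hull B \<longrightarrow> (n u + k u) + t * (l u - g u) < 1 + f u) (at_right 0)"
      proof (cases "u \<in> convex hull B")
        case False
        from eventually_small_perturbation[OF strict[OF u False], of "l u - g u"]
        show ?thesis by (rule eventually_mono) simp
      qed simp
    qed
    moreover have "eventually (\<lambda>t::real. t > 0) (at_right 0)" by (rule eventually_at_right_less)
    ultimately show ?thesis
    proof eventually_elim
      case (elim t)
      \<comment> \<open>Outside the hull of \<open>B\<close> the strict inequality for the sum of
        \<open>n\<close> and \<open>k\<close> survives a small \<open>t\<close>. Inside it
        \<open>n\<close> and \<open>k\<close> give only a weak inequality, and strictness comes from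
        \<open>g\<close>.\<close>
      let ?l = "\<lambda>u. (n u + 1 * k u) + t * l u"
      have "linear ?l" by (rule linear_combination[OF linear_combination[OF n(1) k(1)] l(1)])
      moreover have "?l u = h t u" if "u \<in> A" for u
      proof -
        have "n u = 1" using nB AB that by blast
        then show ?thesis using k(2)[OF that] l(2) that by (simp add: h_def f_def)
      qed
      moreover have "?l u < h t u" if u: "u \<in> \<Union>W - A" for u
      proof (cases "u \<in> convex hull B")
        case True
        then have "t * l u < t * g u" using l(3) u elim(2) by simp
        moreover have "n u = 1" "k u \<le> f u" using nB True k(3) by (auto simp: f_def)
        ultimately show ?thesis by (simp add: h_def)
      next
        case False
        then have "(n u + k u) + t * (l u - g u) < 1 + f u" using elim(1) u by blast
        then show ?thesis by (simp add: h_def algebra_simps)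
      qed
      ultimately show ?case by blast
    qed
  qed
  have "eventually (\<lambda>t. \<forall>A\<in>W. ?P A t) (at_right 0)"
    by (intro eventually_ball_finite[OF finW(1)] ballI main)
  then have "eventually (\<lambda>t. (\<forall>u\<in>\<Union>W. 0 < h t u) \<and> (\<forall>A\<in>W. ?P A t)) (at_right 0)"
    using pos by eventually_elim blast
  from eventually_happens[OF this] obtain t where "(\<forall>u\<in>\<Union>W. 0 < h t u) \<and> (\<forall>A\<in>W. ?P A t)"
    by auto
  then show thesis using that[of "h t"] unfolding convex_heights_def by blast
qed

text \<open>The hypotheses are those met by a triangulation of the boundary of a polytope in
  \<open>Y\<close> around the origin: \<open>N\<close> provides supporting hyperplanes, normalised
  to level 1, that contain the simplices, and \<open>cover\<close> says that every ray is
  hit.\<close>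

lemma derived_iter_polytopal:
  fixes M :: "'b::euclidean_space set set"
  assumes M: "geometric M" "{} \<in> M" and ne: "\<Union>M \<noteq> {}"
    and N: "\<And>B. B \<in> M \<Longrightarrow> \<exists>l. linear l \<and> (\<forall>u\<in>B. l u = 1) \<and> (\<forall>x\<in>body M. l x \<le> (1::real))"
    and Y: "subspace Y" "body M \<subseteq> Y"
    and cover: "\<And>y. y \<in> Y \<Longrightarrow> y \<noteq> 0 \<Longrightarrow> \<exists>c>0. c *\<^sub>R y \<in> body M"
  obtains m W where "(derived ^^ m) M W" "polytopal TYPE('b) (hulls W)"
proof -
  \<comment> \<open>Each simplex lies in a hyperplane off the origin, so affine independence becomes
    linear independence.\<close>
  have ind: "independent A" if W: "geometric W" "refines W M" and A: "A \<in> W" for A and W :: "'b set set"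
  proof -
    obtain B where B: "B \<in> M" "convex hull A \<subseteq> convex hull B"
      using W(2) A unfolding refines_def by blast
    obtain n where n: "linear n" "\<forall>u\<in>B. n u = (1::real)" using N[OF B(1)] by blast
    obtain p where p: "\<And>x. n x = p \<bullet> x" using linear_real_inner[OF n(1)] by blast
    have "convex hull B \<subseteq> {x. p \<bullet> x = 1}"
      using n(2) p by (intro hull_minimal convex_hyperplane) auto
    then have "A \<subseteq> {x. p \<bullet> x = 1}" using order_trans[OF hull_subset B(2)] by (rule order_trans[rotated])
    then have "n u = 1" if "u \<in> A" for u using p that by auto
    then show ?thesis
      by (rule independent_height_one[OF geometric_affine_independent[OF W(1) A] n(1)])
  qed
  have indM: "independent B" if "B \<in> M" for B using ind[OF M(1) refines_refl that] .
  have "\<forall>B\<in>M. \<exists>E. finite E \<and> (\<forall>e\<in>E. \<forall>u\<in>B. 0 \<le> e \<bullet> u) \<and>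
      (\<forall>x. (\<forall>e\<in>E. 0 \<le> e \<bullet> x) \<longrightarrow> (\<exists>w. (\<forall>b\<in>B. 0 \<le> w b) \<and> x = (\<Sum>b\<in>B. w b *\<^sub>R b)))"
    using simplicial_cone_halfspaces[OF indM] by (rule ballI)
  from bchoice[OF this] obtain E where E: "\<forall>B\<in>M. finite (E B) \<and> (\<forall>e\<in>E B. \<forall>u\<in>B. 0 \<le> e \<bullet> u) \<and>
      (\<forall>x. (\<forall>e\<in>E B. 0 \<le> e \<bullet> x) \<longrightarrow> (\<exists>w. (\<forall>b\<in>B. 0 \<le> w b) \<and> x = (\<Sum>b\<in>B. w b *\<^sub>R b)))" by blast
  define EE where "EE = (\<Union>B\<in>M. E B)"
  have finEE: "finite EE" using E M(1) by (auto simp: EE_def geometric_def)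
  obtain m W where W: "(derived ^^ m) M W"
    "\<And>A h. A \<in> W \<Longrightarrow> h \<in> (\<lambda>e. (e, 0)) ` EE \<Longrightarrow> one_sided h A"
    using derived_iter_arrangement[OF M finite_imageI[OF finEE]] by blast
  note gW = derived_iter_props[OF W(1) M]
  \<comment> \<open>The heights are followed through the single stellar steps, starting from 0 on
    \<open>M\<close> itself.\<close>
  have "\<exists>g. locally_convex M W g"
    using derived_iter_steps[OF W(1) M]
  proof (induction rule: rtranclp_induct)
    case base
    show ?case using locally_convex_refl[OF M(1) indM] by blast
  next
    case (step U U')
    obtain g where g: "locally_convex M U g" using step.IH by blast
    obtain T x b where sp: "stellar_point U T x b" and U': "U' = stellar T x U"
      using step.hyps(2) unfolding stellar_step_def by blast
    note gU = stellar_steps[OF step.hyps(1) M(1)]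
    show ?case
      using locally_convex_stellar[OF sp M(1) gU(3) ind[OF gU(1,3)] g] U' by blast
  qed
  then obtain g where g: "locally_convex M W g" by blast
  obtain h where h: "convex_heights W h"
  proof (rule convex_heights_arrangement[OF M(1) gW(1,3,4) N g, of E EE])
    show "E B \<subseteq> EE" if "B \<in> M" for B using that by (auto simp: EE_def)
    show "one_sided (e, 0) A" if "A \<in> W" "e \<in> EE" for A e using W(2) that by blast
    show "\<exists>w. (\<forall>b\<in>B. 0 \<le> w b) \<and> x = (\<Sum>b\<in>B. w b *\<^sub>R b)"
      if "B \<in> M" "\<And>e. e \<in> E B \<Longrightarrow> 0 \<le> e \<bullet> x" for B x
      using E that by blast
  qed (use E finEE in auto)
  have "\<Union>W \<noteq> {}"
  proof
    assume "\<Union>W = {}"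
    then have "body W = {}" unfolding body_eq by auto
    then have "body M = {}" using gW(3) by simp
    then show False using ne Union_subset_body[of M] by blast
  qed
  moreover have "\<Union>W \<subseteq> Y"
    using Union_subset_body[of W] gW(3) Y(2) by simp
  ultimately have "polytopal TYPE('b) (hulls W)"
    using convex_heights_polytopal[OF gW(1,2) _ h Y(1)] cover gW(3) by simp
  then show thesis using that W(1) by blast
qed

section \<open>The boundary of a simplex, and the conclusion\<close>

lemma simplex_boundary_nonempty:
  assumes S: "n simplex S" "n \<ge> 1"
  shows "\<Union>(boundary_complex S) \<noteq> {}" "polytope S"
proof -
  obtain C where C: "finite C" "\<not> affine_dependent C" "int (card C) = n + 1" "S = convex hull C"
    using S(1) unfolding simplex by blast
  show "polytope S" unfolding C(4) polytope_def using C(1) by blast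
  have "card C \<ge> 2" using C(3) S(2) by linarith
  then obtain c where c: "c \<in> C" by fastforce
  have "{c} face_of S" unfolding C(4) face_of_convex_hull_affine_independent[OF C(2)]
    using c by (intro exI[of _ "{c}"]) simp
  moreover have "{c} \<noteq> S"
  proof
    assume "{c} = S"
    then have "C \<subseteq> {c}" using C(4) hull_subset[of C convex] by simp
    then have "card C \<le> 1" using card_mono[of "{c}" C] by simp
    then show False using \<open>card C \<ge> 2\<close> by simp
  qed
  ultimately show "\<Union>(boundary_complex S) \<noteq> {}" unfolding boundary_complex_def by blast
qed

lemma geometric_empty_face:
  "geometric V \<Longrightarrow> body V \<noteq> {} \<Longrightarrow> {} \<in> V"
  unfolding body_eq using geometric_down by blast

theorem theorem1:
  fixes \<Delta> :: "'a::euclidean_space set set"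
  assumes "PL_sphere TYPE('b::euclidean_space) \<Delta>"
  shows "\<exists>k::nat. \<forall>\<Delta>'. (derived_subdivision ^^ k) \<Delta> \<Delta>' \<longrightarrow> polytopal TYPE('b) \<Delta>'"
proof -
  obtain d and S :: "'b set" and K' :: "'a set set" and L' :: "'b set set"
    where \<Delta>: "simplicial_complex \<Delta>" and S: "(int d + 1) simplex S"
    and K': "simplicial_subdivision K' \<Delta>" and L': "simplicial_subdivision L' (boundary_complex S)"
    and iso: "comb_equivalent K' L'"
    using assms unfolding PL_sphere_def PL_d_sphere_def PL_homeomorphic_def by blast
  have bd: "\<Union>(boundary_complex S) \<noteq> {}" and polyS: "polytope S"
    using simplex_boundary_nonempty[OF S] by auto
  obtain V where V: "geometric V" "\<Delta> = hulls V"
    using simplicial_complex_obtain_geometric[OF \<Delta>] by blast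
  obtain VK where VK: "geometric VK" "K' = hulls VK"
    using simplicial_complex_obtain_geometric K' unfolding simplicial_subdivision_def by blast
  obtain VL where VL: "geometric VL" "L' = hulls VL"
    using simplicial_complex_obtain_geometric L' unfolding simplicial_subdivision_def by blast
  have bodyL: "body VL = \<Union>(boundary_complex S)"
    using L' VL(2) unfolding simplicial_subdivision_def body_def by simp
  have bodyK: "body VK = body V"
    using K' VK(2) V(2) unfolding simplicial_subdivision_def body_def by simp
  have isoKL: "set_iso VK VL" using iso comb_equivalent_hulls[OF VK(1) VL(1)] VK(2) VL(2) by simp
  obtain \<phi> where \<phi>: "inj_on \<phi> (\<Union>VK)" "VL = (`) \<phi> ` VK"
    by (rule set_iso_vertex_map[OF isoKL geometric_down[OF VK(1)] geometric_down[OF VL(1)]])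
  \<comment> \<open>A nonempty body guarantees that the family is nonempty and so contains the empty
    face.\<close>
  have "body VK \<noteq> {}"
  proof
    assume "body VK = {}"
    then have "\<forall>A\<in>VK. A = {}" unfolding body_eq by auto
    then have "\<forall>A\<in>VL. A = {}" unfolding \<phi>(2) by auto
    then have "body VL = {}" unfolding body_eq by auto
    then show False using bodyL bd by simp
  qed
  then have V0: "{} \<in> V" "{} \<in> VK"
    using geometric_empty_face V(1) VK(1) bodyK by auto
  have VKfin: "finite VK" using VK(1) by (simp add: geometric_def)
  obtain k U where U: "(derived ^^ k) V U" "\<forall>A\<in>U. \<exists>\<sigma>\<in>hulls VK. convex hull A \<subseteq> \<sigma>"
  proof (rule derived_iter_refines[OF V(1) V0(1), of "hulls VK"])
    show "finite (hulls VK)" "\<Union>(hulls VK) = body V" "hulls VK \<noteq> {}"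
      using VKfin bodyK V0(2) by (auto simp: hulls_def body_def)
    show "polytope \<sigma>" if "\<sigma> \<in> hulls VK" for \<sigma>
      using that geometric_finite[OF VK(1)] unfolding hulls_def polytope_def by blast
  qed
  note gU = derived_iter_props[OF U(1) V(1) V0(1)]
  have refU: "refines U VK" using U(2) unfolding refines_def hulls_def by blast
  \<comment> \<open>A relative interior point of the simplex, to be moved to the origin.\<close>
  obtain p where p: "p \<in> rel_interior S"
    using bd rel_interior_eq_empty[OF polytope_imp_convex[OF polyS]]
    unfolding boundary_complex_def by (fastforce dest: face_of_imp_subset)
  obtain M where M: "geometric M" "body M = (\<lambda>y. y - p) ` body ((`) \<phi> ` VK)" "set_iso U M"
    using transport[OF VK(1) \<phi>(1) _ gU(1) refU] VL(1) \<phi>(2) gU(3) bodyK by metis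
  have bodyM: "body M = (\<lambda>y. y - p) ` \<Union>(boundary_complex S)" using M(2) \<phi>(2) bodyL by simp
  have M0: "{} \<in> M" using geometric_empty_face[OF M(1)] bodyM bd by simp
  obtain m W where W: "(derived ^^ m) M W" "polytopal TYPE('b) (hulls W)"
  proof (rule derived_iter_polytopal[OF M(1) M0])
    show "\<Union>M \<noteq> {}"
    proof
      assume "\<Union>M = {}"
      then have "body M = {}" unfolding body_eq by auto
      then show False using bodyM bd by simp
    qed
    \<comment> \<open>\<open>S\<close> need not be full-dimensional in its space, so rays are taken
      in its translated affine hull.\<close>
    show "subspace ((\<lambda>y. y - p) ` (affine hull S))"
      using p rel_interior_subset hull_subset[of S affine]
      by (intro affine_diffs_subspace_subtract affine_affine_hull) blast
    show "body M \<subseteq> (\<lambda>y. y - p) ` (affine hull S)"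
      unfolding bodyM boundary_complex_def
      using face_of_imp_subset hull_subset[of S affine] by (intro image_mono) blast
    show "\<exists>c>0. c *\<^sub>R y \<in> body M" if y: "y \<in> (\<lambda>y. y - p) ` (affine hull S)" "y \<noteq> 0" for y
    proof -
      have py: "p + y \<in> affine hull S" using y(1) by auto
      obtain c where c: "0 < c" "p + c *\<^sub>R y \<in> rel_frontier S"
        using ray_to_rel_frontier[OF polytope_imp_bounded[OF polyS] p py y(2)] by blast
      then have "p + c *\<^sub>R y \<in> \<Union>(boundary_complex S)"
        unfolding boundary_complex_def rel_frontier_of_polyhedron_alt[OF polytope_imp_polyhedron[OF polyS]]
        by simp
      then have "c *\<^sub>R y \<in> body M" unfolding bodyM by (intro image_eqI) auto
      then show ?thesis using c(1) by blast
    qed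
    show "\<exists>l. linear l \<and> (\<forall>u\<in>B. l u = 1) \<and> (\<forall>x\<in>body M. l x \<le> (1::real))" if B: "B \<in> M" for B
    proof -
      \<comment> \<open>A simplex of \<open>M\<close> lies in a single proper face of the translated
        \<open>S\<close>, because a point of its relative interior lies in such a face.\<close>
      have "\<exists>F. F face_of S \<and> F \<noteq> S \<and> B \<subseteq> (\<lambda>y. y - p) ` F"
      proof (cases "B = {}")
        case True
        then show ?thesis using bd unfolding boundary_complex_def by blast
      next
        case False
        then obtain x where x: "x \<in> rel_interior (convex hull B)"
          by (metis convex_convex_hull equals0I rel_interior_eq_empty convex_hull_eq_empty)
        have hullB: "convex hull B \<subseteq> body M" using B unfolding body_eq by blast
        have "x \<in> body M" using x hullB rel_interior_subset by blast
        then obtain F where F: "F face_of S" "F \<noteq> S" "x \<in> (\<lambda>y. y - p) ` F"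
          unfolding bodyM boundary_complex_def by blast
        have "(\<lambda>y. y - p) = (+) (- p)" by (simp add: fun_eq_iff)
        then have face: "(\<lambda>y. y - p) ` F face_of (\<lambda>y. y - p) ` S"
          using face_of_translation_eq[of "- p" F S] F(1) by (simp del: add_uminus_conv_diff)
        have sub: "convex hull B \<subseteq> (\<lambda>y. y - p) ` S"
          using hullB face_of_imp_subset unfolding bodyM boundary_complex_def by blast
        have "convex hull B \<subseteq> (\<lambda>y. y - p) ` F"
          by (rule subset_of_face_of[OF face sub]) (use x F(3) in blast)
        then have "B \<subseteq> (\<lambda>y. y - p) ` F" by (rule order_trans[OF hull_subset])
        then show ?thesis using F by blast
      qed
      then obtain F where F: "F face_of S" "F \<noteq> S" "B \<subseteq> (\<lambda>y. y - p) ` F" by blast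
      have pF: "p \<notin> F" using face_of_disjoint_rel_interior[OF F(1,2)] p by blast
      have "F exposed_face_of S"
        using exposed_face_of_polyhedron[OF polytope_imp_polyhedron[OF polyS]] F(1) by blast
      then obtain a b where ab: "S \<subseteq> {x. a \<bullet> x \<le> b}" "F = S \<inter> {x. a \<bullet> x = b}"
        unfolding exposed_face_of_def by blast
      have "p \<in> S" using p rel_interior_subset by blast
      then have c: "b - a \<bullet> p > 0" using ab pF by force
      \<comment> \<open>Seen from \<open>p\<close> as origin, the hyperplane exposing
        \<open>F\<close> has level \<open>b - a \<bullet> p\<close>, positive because
        \<open>p\<close> is not in \<open>F\<close>. The division normalises the level to 1.\<close>
      define l where "l x = (a \<bullet> x) / (b - a \<bullet> p)" for x
      have "linear l" unfolding l_def
        by (rule linearI) (simp_all add: inner_add_right add_divide_distrib)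
      moreover have "l u = 1" if "u \<in> B" for u
        using F(3) that ab(2) c by (auto simp: l_def inner_diff_right)
      moreover have "l x \<le> 1" if x: "x \<in> body M" for x
      proof -
        obtain y where y: "y \<in> S" "x = y - p"
          using x face_of_imp_subset unfolding bodyM boundary_complex_def by blast
        then have "a \<bullet> y \<le> b" using ab(1) by blast
        then show ?thesis using c y(2) by (simp add: l_def inner_diff_right)
      qed
      ultimately show ?thesis by blast
    qed
  qed
  \<comment> \<open>An arbitrary run of \<open>k + m\<close> derived subdivisions is compared in two
    stages: after \<open>k\<close> steps with \<open>U\<close>, hence with \<open>M\<close>, and
    after \<open>m\<close> more with \<open>W\<close>. Both numbers are fixed before
    \<open>\<Delta>'\<close> is chosen.\<close>
  have "polytopal TYPE('b) \<Delta>'" if \<Delta>': "(derived_subdivision ^^ (k + m)) \<Delta> \<Delta>'" for \<Delta>'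
  proof -
    obtain U' where U': "(derived ^^ (k + m)) V U'" "\<Delta>' = hulls U'"
      using derived_subdivision_iter_hulls[OF V(1) V0(1)] \<Delta>' V(2) by blast
    obtain U1 where U1: "(derived ^^ k) V U1" "(derived ^^ m) U1 U'"
      using U'(1) unfolding relpowp_add by blast
    note gU1 = derived_iter_props[OF U1(1) V(1) V0(1)]
    note gU' = derived_iter_props[OF U'(1) V(1) V0(1)]
    note gW = derived_iter_props[OF W(1) M(1) M0]
    have "set_iso U1 U"
      by (rule derived_iter_set_iso[OF V(1) V0(1) V(1) V0(1) set_iso_refl U1(1) U(1)])
    then have "set_iso U1 M" using M(3) set_iso_trans by blast
    then have "set_iso U' W"
      by (rule derived_iter_set_iso[OF gU1(1,2) M(1) M0 _ U1(2) W(1)])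
    then have eqv: "comb_equivalent \<Delta>' (hulls W)"
      unfolding U'(2) using comb_equivalent_hulls[OF gU'(1) gW(1)] by simp
    obtain P :: "'b set" where P: "polytope P" "comb_equivalent (hulls W) (boundary_complex P)"
      using W(2) unfolding polytopal_def by blast
    obtain f where f: "bij_betw f \<Delta>' (hulls W)" "\<forall>\<sigma>\<in>\<Delta>'. \<forall>\<tau>\<in>\<Delta>'. \<sigma> face_of \<tau> \<longleftrightarrow> f \<sigma> face_of f \<tau>"
      using eqv unfolding comb_equivalent_def by blast
    obtain g where g: "bij_betw g (hulls W) (boundary_complex P)"
      "\<forall>\<sigma>\<in>hulls W. \<forall>\<tau>\<in>hulls W. \<sigma> face_of \<tau> \<longleftrightarrow> g \<sigma> face_of g \<tau>"
      using P(2) unfolding comb_equivalent_def by blast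
    have "bij_betw (g \<circ> f) \<Delta>' (boundary_complex P)" by (rule bij_betw_trans[OF f(1) g(1)])
    moreover have "f \<sigma> \<in> hulls W" if "\<sigma> \<in> \<Delta>'" for \<sigma> using f(1) that by (meson bij_betwE)
    ultimately have "comb_equivalent \<Delta>' (boundary_complex P)"
      unfolding comb_equivalent_def using f(2) g(2) by (intro exI[of _ "g \<circ> f"]) simp
    then show ?thesis unfolding polytopal_def using P(1) by blast
  qed
  then show ?thesis by blast
qed

end
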